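(* Let $\xi,\eta,\xi_0,\eta_0\in\mathbb{C}$, and let $k>0$, $c>0$, $q=\frac14c^2k^2$. Then $$J_0(kr)=\frac1\pi\sum_{n=0}^\infty\mu_n(q)\,\mathrm{ce}_n(i\xi,q)\,\mathrm{ce}_n(\eta,q)\,\mathrm{ce}_n(i\xi_0,q)\,\mathrm{ce}_n(\eta_0,q)+\frac1\pi\sum_{n=1}^\infty\nu_n(q)\,\mathrm{se}_n(i\xi,q)\,\mathrm{se}_n(\eta,q)\,\mathrm{se}_n(i\xi_0,q)\,\mathrm{se}_n(\eta_0,q),$$ where $r$ is given by $$r^2=c^2\left[(\cosh\xi\cos\eta-\cosh\xi_0\cos\eta_0)^2+(\sinh\xi\sin\eta-\sinh\xi_0\sin\eta_0)^2\right].$$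
   Context: $J_0(z)=\sum_{n=0}^\infty\frac{(-z^2/4)^n}{(n!)^2}$ is the Bessel function of order $0$; it is an even entire function, so $J_0(kr)$ depends only on $r^2$. Mathieu's equation is $u''(\eta)+(\lambda-2q\cos2\eta)u(\eta)=0$. For real $q\neq0$, $a_0(q)<a_1(q)<a_2(q)<\cdots$ are the values of $\lambda$ for which it has a nontrivial even $2\pi$-periodic solution, and $b_1(q)<b_2(q)<\cdots$ are those for which it has a nontrivial odd $2\pi$-periodic solution. $\mathrm{ce}_n(\eta,q)$ ($n\ge0$) is the real even $2\pi$-periodic solution for $\lambda=a_n(q)$, and $\mathrm{se}_n(\eta,q)$ ($n\ge1$) the real odd $2\pi$-periodic solution for $\lambda=b_n(q)$, normalized by $\int_0^{2\pi}\mathrm{ce}_n^2(\eta,q)\,d\eta=\int_0^{2\pi}\mathrm{se}_n^2(\eta,q)\,d\eta=\pi$ (the choice of sign is irrelevant here). They are entire functions of $\eta$ and satisfy $\mathrm{ce}_n(\eta+\pi,q)=(-1)^n\mathrm{ce}_n(\eta,q)$, $\mathrm{se}_n(\eta+\pi,q)=(-1)^n\mathrm{se}_n(\eta,q)$. Definition of $\mu_n(q)$, $n\ge0$: let $u_1=\mathrm{ce}_n(\cdot,q)$ and let $u_2$ be a second, linearly independent solution of Mathieu's equation with $\lambda=a_n(q)$. There is a constant $\sigma$ with $u_2(\eta+\pi)=\sigma u_1(\eta)+(-1)^nu_2(\eta)$, and $\mu_n(q)=\frac{2(-1)^n\sigma}{W[u_1,u_2]}$, where $W[u_1,u_2]=u_1u_2'-u_1'u_2$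 is the Wronskian. Definition of $\nu_n(q)$, $n\ge1$: let $u_3=\mathrm{se}_n(\cdot,q)$ and let $u_4$ be a second, linearly independent solution with $\lambda=b_n(q)$. There is a constant $\tau$ with $u_4(\eta+\pi)=\tau u_3(\eta)+(-1)^nu_4(\eta)$, and $\nu_n(q)=\frac{2(-1)^n\tau}{W[u_3,u_4]}$. These do not depend on the choice of $u_2$, $u_4$. *)

theory Defs
  imports "HOL-Complex_Analysis.Complex_Analysis"
begin

definition bessel_J0 :: "complex \<Rightarrow> complex" where
  "bessel_J0 z = (\<Sum>n. (- (z\<^sup>2) / 4) ^ n / (fact n)\<^sup>2)"

text \<open>Solutions of Mathieu's equation are taken on the whole complex plane: the equation is linear
  with entire coefficients, so each of its solutions on the real line extends uniquely to an
  entire one.\<close>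

definition mathieu_solution :: "real \<Rightarrow> real \<Rightarrow> (complex \<Rightarrow> complex) \<Rightarrow> bool" where
  "mathieu_solution q l u \<longleftrightarrow> u holomorphic_on UNIV \<and>
     (\<forall>z. deriv (deriv u) z + (of_real l - 2 * of_real q * cos (2 * z)) * u z = 0)"

definition two_pi_periodic :: "(complex \<Rightarrow> complex) \<Rightarrow> bool" where
  "two_pi_periodic u \<longleftrightarrow> (\<forall>z. u (z + 2 * of_real pi) = u z)"

definition even_function :: "(complex \<Rightarrow> complex) \<Rightarrow> bool" where
  "even_function u \<longleftrightarrow> (\<forall>z. u (- z) = u z)"

definition odd_function :: "(complex \<Rightarrow> complex) \<Rightarrow> bool" where
  "odd_function u \<longleftrightarrow> (\<forall>z. u (- z) = - u z)"

definition even_eigenvalues :: "real \<Rightarrow> real set" where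
  "even_eigenvalues q = {l. \<exists>u. mathieu_solution q l u \<and> even_function u \<and>
     two_pi_periodic u \<and> (\<exists>z. u z \<noteq> 0)}"

definition odd_eigenvalues :: "real \<Rightarrow> real set" where
  "odd_eigenvalues q = {l. \<exists>u. mathieu_solution q l u \<and> odd_function u \<and>
     two_pi_periodic u \<and> (\<exists>z. u z \<noteq> 0)}"

definition increasing_enumeration :: "real set \<Rightarrow> nat \<Rightarrow> real" where
  "increasing_enumeration S = (THE f. strict_mono f \<and> range f = S)"

definition mathieu_a :: "nat \<Rightarrow> real \<Rightarrow> real" where
  "mathieu_a n q = increasing_enumeration (even_eigenvalues q) n"

text \<open>The \<open>b\<^sub>n\<close>, \<open>se\<^sub>n\<close> and \<open>\<nu>\<^sub>n\<close> below are numbered from \<open>n = 1\<close>; their values at \<open>n = 0\<close>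
  have no meaning.\<close>

definition mathieu_b :: "nat \<Rightarrow> real \<Rightarrow> real" where
  "mathieu_b n q = increasing_enumeration (odd_eigenvalues q) (n - 1)"

definition real_on_reals :: "(complex \<Rightarrow> complex) \<Rightarrow> bool" where
  "real_on_reals u \<longleftrightarrow> (\<forall>x::real. u (of_real x) \<in> \<real>)"

definition mathieu_normalized :: "(complex \<Rightarrow> complex) \<Rightarrow> bool" where
  "mathieu_normalized u \<longleftrightarrow>
     integral {0..2 * pi} (\<lambda>t::real. (u (of_real t))\<^sup>2) = of_real pi"

text \<open>The conditions below determine \<open>ce\<^sub>n\<close> and \<open>se\<^sub>n\<close> up to sign; one sign is chosen.\<close>

definition mathieu_ce :: "nat \<Rightarrow> complex \<Rightarrow> real \<Rightarrow> complex" where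
  "mathieu_ce n z q = (SOME u. mathieu_solution q (mathieu_a n q) u \<and> even_function u \<and>
     two_pi_periodic u \<and> real_on_reals u \<and> mathieu_normalized u) z"

definition mathieu_se :: "nat \<Rightarrow> complex \<Rightarrow> real \<Rightarrow> complex" where
  "mathieu_se n z q = (SOME u. mathieu_solution q (mathieu_b n q) u \<and> odd_function u \<and>
     two_pi_periodic u \<and> real_on_reals u \<and> mathieu_normalized u) z"

definition wronskian :: "(complex \<Rightarrow> complex) \<Rightarrow> (complex \<Rightarrow> complex) \<Rightarrow> complex \<Rightarrow> complex" where
  "wronskian u v z = u z * deriv v z - deriv u z * v z"

definition linearly_independent2 :: "(complex \<Rightarrow> complex) \<Rightarrow> (complex \<Rightarrow> complex) \<Rightarrow> bool" where
  "linearly_independent2 u v \<longleftrightarrow>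
     (\<forall>\<alpha> \<beta>. (\<forall>z. \<alpha> * u z + \<beta> * v z = 0) \<longrightarrow> \<alpha> = 0 \<and> \<beta> = 0)"

text \<open>The common shape of \<open>\<mu>\<^sub>n\<close> and \<open>\<nu>\<^sub>n\<close>, for the first solution \<open>u\<close> and the eigenvalue \<open>l\<close>. The value
  does not depend on the second solution \<open>v\<close>. The Wronskian of two solutions of Mathieu's equation
  is constant, so it may be evaluated at \<open>0\<close>.\<close>

definition connection_coefficient ::
    "nat \<Rightarrow> real \<Rightarrow> real \<Rightarrow> (complex \<Rightarrow> complex) \<Rightarrow> complex" where
  "connection_coefficient n q l u = (THE m. \<exists>v \<sigma>. mathieu_solution q l v \<and>
     linearly_independent2 u v \<and>
     (\<forall>z. v (z + of_real pi) = \<sigma> * u z + (-1) ^ n * v z) \<and>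
     m = 2 * (-1) ^ n * \<sigma> / wronskian u v 0)"

definition mathieu_mu :: "nat \<Rightarrow> real \<Rightarrow> complex" where
  "mathieu_mu n q = connection_coefficient n q (mathieu_a n q) (\<lambda>z. mathieu_ce n z q)"

definition mathieu_nu :: "nat \<Rightarrow> real \<Rightarrow> complex" where
  "mathieu_nu n q = connection_coefficient n q (mathieu_b n q) (\<lambda>z. mathieu_se n z q)"

end

theory Submission
  imports Defs
begin

text \<open>Put \<open>a = \<i> * \<xi>\<close> and \<open>c = \<i> * \<xi>\<^sub>0\<close>. Then \<open>J\<^sub>0(k r)\<close> is a function \<open>F(a, b, c, d)\<close> that is symmetric in
  its four arguments and satisfies \<open>L\<^sub>a F = L\<^sub>b F\<close> for \<open>L\<^sub>x = d\<^sup>2/dx\<^sup>2 - 2 q cos 2x\<close>. Hence the coefficient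
  of \<open>F(a, \<cdot>, c, d)\<close> with respect to an eigenfunction \<open>u\<close> solves Mathieu's equation in each of its
  three variables and is of the form \<open>D u(a) u(c) u(d)\<close>. Moreover \<open>F\<close> is the Riemann function of the hyperbolic equation
  \<open>L\<^sub>a w = L\<^sub>b w\<close>; Riemann's representation of \<open>w = u(a) v(b)\<close> over one period, where \<open>v\<close> is a second
  solution, gives \<open>D W[u, v] = 2 \<epsilon> \<sigma>\<close> with \<open>\<epsilon> = \<plusminus>1\<close> the multiplier of \<open>u\<close>, that is, \<open>D = \<mu>\<^sub>n\<close> or \<open>D = \<nu>\<^sub>n\<close>.

  The multiplier alternates because \<open>\<epsilon>\<close> determines the sign of the derivative of the characteristic function at
  its simple zeros. Completeness follows from the resolvent: for \<open>f\<close> orthogonal to all eigenfunctions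
  \<open>\<langle>R(\<lambda>) f, f\<rangle>\<close> is entire and bounded by \<open>\<parallel>f\<parallel>\<^sup>2 / \<bar>Im \<lambda>\<bar>\<close>, hence zero. Convergence at complex arguments
  follows, without asymptotics of the eigenvalues, from the log-convexity in \<open>y\<close> of the norms \<open>I\<^sub>n(y)\<close> of the eigenfunctions
  on \<open>Im z = y\<close>, the bound \<open>\<bar>D\<^sub>n\<bar> I\<^sub>n(y)\<^bsup>3/2\<^esup> \<le> C(y)\<close> and the convergence of \<open>\<Sum> 1 / I\<^sub>n(y)\<close>.\<close>

section \<open>Entire solutions of Mathieu's equation\<close>

text \<open>Even and odd \<open>2 * pi\<close>-periodic solutions are the Neumann and Dirichlet
  eigenfunctions on \<open>{0..pi}\<close>; the flag \<open>ev\<close> lets one argument serve both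
  self-adjoint problems. The coefficient to be found is defined through a second solution that need
  not be periodic, while the expansion sees only periodic ones. Riemann's method is the bridge: the
  base of its characteristic triangle is a whole period, where \<open>D\<close> appears, and the
  failure of \<open>v\<close> to be periodic survives as the boundary term with \<sigma>. The
  obstacle at complex arguments is growth: four factors on the line \<open>Im z = y\<close> are
  controlled only by \<open>I\<^sub>n(y)\<^sup>2\<close>, more than the decay of \<open>D\<close> on
  that same line compensates. Since \<open>I\<^sub>n(y)\<^sup>4\<close> is at most
  \<open>pi ^ 3 * I\<^sub>n(4 * y)\<close>, the decay taken on the higher line
  \<open>Im z = 4 * y\<close> leaves the summable \<open>1 / I\<^sub>n(4 * y)\<close>.\<close>

fun ode_coeff :: "(nat \<Rightarrow> 'a::real_normed_field) \<Rightarrow> 'a \<Rightarrow> 'a \<Rightarrow> nat \<Rightarrow> 'a" where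
  "ode_coeff g a b 0 = a"
| "ode_coeff g a b (Suc 0) = b"
| "ode_coeff g a b (Suc (Suc n)) =
     (\<Sum>j\<in>{..n}. g j * ode_coeff g a b (n - j)) / (of_nat (Suc n) * of_nat (Suc (Suc n)))"

text \<open>\<open>ode_coeff g a b\<close> lists the Taylor coefficients of the solution of
  \<open>u'' = g * u\<close> with \<open>u 0 = a\<close> and \<open>u' 0 = b\<close>. The recursion
  has nonnegative weights, so majorants of the data give majorants of all coefficients; this is why
  it is defined over any normed field.\<close>

lemma norm_ode_coeff_le:
  fixes g :: "nat \<Rightarrow> 'a::real_normed_field" and h :: "nat \<Rightarrow> real"
  assumes "\<And>j. norm (g j) \<le> h j" "norm a \<le> a'" "norm b \<le> b'"
  shows "norm (ode_coeff g a b n) \<le> ode_coeff h a' b' n"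
proof (induction n rule: less_induct)
  case (less n)
  consider "n = 0" | "n = Suc 0" | k where "n = Suc (Suc k)"
    by (metis not0_implies_Suc)
  then show ?case
  proof cases
    case 3
    have h0: "h j \<ge> 0" for j
      using assms(1)[of j] norm_ge_zero order_trans by blast
    have "norm (\<Sum>j\<in>{..k}. g j * ode_coeff g a b (k - j)) \<le>
        (\<Sum>j\<in>{..k}. h j * ode_coeff h a' b' (k - j))"
      using less.IH 3
      by (intro sum_norm_le) (auto simp: norm_mult intro!: mult_mono assms h0)
    then show ?thesis unfolding 3 ode_coeff.simps
      by (simp add: norm_divide norm_mult divide_right_mono del: of_nat_Suc)
  qed (use assms in auto)
qed

lemma ode_coeff_nonneg:
  fixes h :: "nat \<Rightarrow> real"
  assumes "\<And>j. h j \<ge> 0" "a \<ge> 0" "b \<ge> 0"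
  shows "ode_coeff h a b n \<ge> 0"
proof -
  have "norm (ode_coeff h a b n) \<le> ode_coeff h a b n"
    by (rule norm_ode_coeff_le) (use assms in auto)
  then show ?thesis using norm_ge_zero order_trans by blast
qed

text \<open>The convolution sum at radius \<open>R\<close> is at most \<open>G\<close> times a bound
  for the earlier terms, and dividing by \<open>(k + 1) * (k + 2)\<close> absorbs the factor
  \<open>R\<^sup>2 * G\<close> once \<open>k\<close> reaches \<open>M\<close>. A bound for the first
  \<open>M + 2\<close> terms therefore persists.\<close>

lemma ode_coeff_bound:
  fixes h :: "nat \<Rightarrow> real"
  assumes h0: "\<And>j. h j \<ge> 0" and ab: "a \<ge> 0" "b \<ge> 0"
    and R: "R > 0" and sm: "summable (\<lambda>j. h j * R ^ j)"
  obtains A where "\<And>n. ode_coeff h a b n * R ^ n \<le> A"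
proof -
  let ?c = "ode_coeff h a b"
  define G where "G = (\<Sum>j. h j * R ^ j)"
  have c0: "?c n \<ge> 0" for n
    by (rule ode_coeff_nonneg) (use assms in auto)
  obtain M :: nat where M: "R\<^sup>2 * G \<le> real M"
    using real_arch_simple by blast
  define A where "A = (\<Sum>k\<le>Suc M. ?c k * R ^ k)"
  have A0: "A \<ge> 0" unfolding A_def by (intro sum_nonneg mult_nonneg_nonneg c0) (use R in auto)
  have "?c n * R ^ n \<le> A" for n
  proof (induction n rule: less_induct)
    case (less n)
    show ?case
    proof (cases "n \<le> Suc M")
      case True
      then show ?thesis unfolding A_def
        using c0 R by (intro member_le_sum) auto
    next
      case False
      then obtain k where k: "n = Suc (Suc k)" "M \<le> k"
        by (metis Suc_le_D Suc_le_mono not_less_eq_eq)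
      have "(\<Sum>j\<in>{..k}. h j * ?c (k - j)) * R ^ k = (\<Sum>j\<in>{..k}. (h j * R ^ j) * (?c (k - j) * R ^ (k - j)))"
        unfolding sum_distrib_right
      proof (rule sum.cong)
        fix j assume "j \<in> {..k}"
        then have "R ^ k = R ^ j * R ^ (k - j)" by (simp add: power_add[symmetric])
        then show "h j * ?c (k - j) * R ^ k = (h j * R ^ j) * (?c (k - j) * R ^ (k - j))"
          by simp
      qed auto
      also have "\<dots> \<le> (\<Sum>j\<in>{..k}. (h j * R ^ j) * A)"
        by (intro sum_mono mult_left_mono less.IH) (use k h0 R in auto)
      also have "\<dots> = (\<Sum>j\<in>{..k}. (h j * R ^ j)) * A" by (simp add: sum_distrib_right)
      also have "\<dots> \<le> G * A" unfolding G_def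
        by (intro mult_right_mono sum_le_suminf A0 sm) (use h0 R in auto)
      finally have 1: "(\<Sum>j\<in>{..k}. h j * ?c (k - j)) * R ^ k \<le> G * A" .
      have "?c n * R ^ n = ((\<Sum>j\<in>{..k}. h j * ?c (k - j)) * R ^ k) * R\<^sup>2 / (real (Suc k) * real (Suc (Suc k)))"
        unfolding k by (simp add: power2_eq_square del: of_nat_Suc)
      also have "\<dots> \<le> (G * A) * R\<^sup>2 / (real (Suc k) * real (Suc (Suc k)))"
        using 1 by (intro divide_right_mono mult_right_mono) auto
      also have "\<dots> \<le> real M * A / (real (Suc k) * real (Suc (Suc k)))"
        using mult_right_mono[OF M A0] by (intro divide_right_mono) (auto simp: algebra_simps)
      also have "\<dots> \<le> A"
      proof -
        have "real M \<le> real (Suc k)" using k by simp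
        also have "\<dots> \<le> real (Suc k) * real (Suc (Suc k))"
          by simp
        finally have "real M * A \<le> (real (Suc k) * real (Suc (Suc k))) * A"
          using A0 by (intro mult_right_mono) auto
        then show ?thesis
          by (simp add: divide_le_eq mult.commute del: of_nat_Suc)
      qed
      finally show ?thesis .
    qed
  qed
  then show thesis using that by blast
qed

lemma ode_coeff_summable:
  fixes h :: "nat \<Rightarrow> real"
  assumes h0: "\<And>j. h j \<ge> 0" and ab: "a \<ge> 0" "b \<ge> 0"
    and sm: "\<And>R. R > 0 \<Longrightarrow> summable (\<lambda>j. h j * R ^ j)" and R: "R > 0"
  shows "summable (\<lambda>n. ode_coeff h a b n * R ^ n)"
proof -
  \<comment> \<open>Boundedness at the doubled radius leaves the geometric factor
    \<open>(1 / 2) ^ n\<close> at radius \<open>R\<close>.\<close>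
  obtain A where A: "\<And>n. ode_coeff h a b n * (2 * R) ^ n \<le> A"
    using ode_coeff_bound[OF h0 ab _ sm, of "2 * R"] R by auto
  show ?thesis
  proof (rule summable_comparison_test)
    show "summable (\<lambda>n. A * (1 / 2) ^ n)" by (intro summable_mult summable_geometric) auto
    have "norm (ode_coeff h a b n * R ^ n) \<le> A * (1 / 2) ^ n" for n
    proof -
      have "norm (ode_coeff h a b n * R ^ n) = ode_coeff h a b n * R ^ n"
        using ode_coeff_nonneg[of h a b n] h0 ab R by simp
      also have "\<dots> = ode_coeff h a b n * (2 * R) ^ n * (1 / 2) ^ n"
        by (simp add: power_mult_distrib power_one_over)
      also have "\<dots> \<le> A * (1 / 2) ^ n" by (intro mult_right_mono A) auto
      finally show ?thesis .
    qed
    then show "\<exists>N. \<forall>n\<ge>N. norm (ode_coeff h a b n * R ^ n) \<le> A * (1 / 2) ^ n" by blast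
  qed
qed

lemma holomorphic_ode_coeff:
  assumes "\<And>j. (\<lambda>l. g l j) holomorphic_on S"
  shows "(\<lambda>l. ode_coeff (g l) a b n) holomorphic_on S"
proof (induction n rule: less_induct)
  case (less n)
  consider "n = 0" | "n = Suc 0" | k where "n = Suc (Suc k)"
    by (metis not0_implies_Suc)
  then show ?case
  proof cases
    case 3
    show ?thesis unfolding 3 ode_coeff.simps
      using less.IH 3 by (intro holomorphic_intros assms) (auto simp del: of_nat_Suc)
  qed auto
qed

text \<open>A majorant that depends only on a bound \<open>L\<close> for the parameter makes the
  series converge locally uniformly in both variables; this gives joint continuity and, at fixed
  \<open>z\<close>, holomorphy in the parameter.\<close>

lemma power_series_family:
  fixes c :: "complex \<Rightarrow> nat \<Rightarrow> complex"
  assumes hol: "\<And>m. (\<lambda>l. c l m) holomorphic_on UNIV"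
    and bd: "\<And>L. \<exists>B. (\<forall>l m. norm l \<le> L \<longrightarrow> norm (c l m) \<le> B m) \<and> (\<forall>R>0. summable (\<lambda>m. B m * R ^ m))"
  shows "continuous_on UNIV (\<lambda>p. \<Sum>m. c (fst p) m * snd p ^ m)"
    and "(\<lambda>l. \<Sum>m. c l m * z ^ m) holomorphic_on UNIV"
proof -
  have ul: "uniform_limit (cball 0 L \<times> cball 0 R) (\<lambda>n p. \<Sum>m<n. c (fst p) m * snd p ^ m)
      (\<lambda>p. \<Sum>m. c (fst p) m * snd p ^ m) sequentially" if R: "R > 0" for L R
  proof -
    obtain B where B: "\<And>l m. norm l \<le> L \<Longrightarrow> norm (c l m) \<le> B m" "\<And>R. R > 0 \<Longrightarrow> summable (\<lambda>m. B m * R ^ m)"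
      using bd[of L] by auto
    show ?thesis
    proof (rule Weierstrass_m_test)
      show "summable (\<lambda>m. B m * R ^ m)" using B R by auto
      fix n p assume "p \<in> cball (0::complex) L \<times> cball (0::complex) R"
      then have "norm (fst p) \<le> L" "norm (snd p) \<le> R" by auto
      then show "norm (c (fst p) n * snd p ^ n) \<le> B n * R ^ n"
        using B(1)[of "fst p" n] order_trans[OF norm_ge_zero B(1)[of "fst p" n]]
        by (auto simp: norm_mult norm_power intro!: mult_mono power_mono)
    qed
  qed
  have contc: "continuous_on UNIV (\<lambda>l. c l m)" for m
    using hol holomorphic_on_imp_continuous_on by blast
  have "continuous_on (cball 0 (K + 1) \<times> cball 0 (K + 1)) (\<lambda>p. \<Sum>m. c (fst p) m * snd p ^ m)" if "K \<ge> 0" for K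
  proof (rule uniform_limit_theorem[OF _ ul])
    show "\<forall>\<^sub>F n in sequentially. continuous_on (cball 0 (K + 1) \<times> cball 0 (K + 1))
        (\<lambda>p. \<Sum>m<n. c (fst p) m * snd p ^ m)"
      by (intro always_eventually allI continuous_intros continuous_on_compose2[OF contc]) auto
  qed (use that in auto)
  note * = this
  have "isCont (\<lambda>p. \<Sum>m. c (fst p) m * snd p ^ m) x" for x
  proof -
    define K where "K = norm (fst x) + norm (snd x)"
    have "continuous_on (ball 0 (K + 1) \<times> ball 0 (K + 1)) (\<lambda>p. \<Sum>m. c (fst p) m * snd p ^ m)"
      by (rule continuous_on_subset[OF *[of K]]) (auto simp: K_def)
    moreover have "x \<in> ball 0 (K + 1) \<times> ball 0 (K + 1)"
    proof -
      have "norm (fst x) < K + 1" "norm (snd x) < K + 1"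
        using norm_ge_zero[of "fst x"] norm_ge_zero[of "snd x"] unfolding K_def by linarith+
      then show ?thesis by (auto simp: mem_Times_iff)
    qed
    moreover have "open (ball (0::complex) (K + 1) \<times> ball (0::complex) (K + 1))"
      by (intro open_Times) auto
    ultimately show ?thesis using continuous_on_eq_continuous_at by blast
  qed
  then show "continuous_on UNIV (\<lambda>p. \<Sum>m. c (fst p) m * snd p ^ m)"
    by (simp add: continuous_on_eq_continuous_at)
  show "(\<lambda>l. \<Sum>m. c l m * z ^ m) holomorphic_on UNIV"
  proof (rule holomorphic_uniform_sequence[where f = "\<lambda>n l. \<Sum>m<n. c l m * z ^ m"])
    fix l :: complex
    have "uniform_limit (cball 0 (norm l + 1)) (\<lambda>n l. \<Sum>m<n. c l m * z ^ m) (\<lambda>l. \<Sum>m. c l m * z ^ m) sequentially"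
    proof (rule uniform_limitI)
      fix e :: real assume "e > 0"
      from uniform_limitD[OF ul[of "norm z + 1" "norm l + 1"] this]
      have "\<forall>\<^sub>F n in sequentially. \<forall>p\<in>cball 0 (norm l + 1) \<times> cball 0 (norm z + 1).
          dist (\<Sum>m<n. c (fst p) m * snd p ^ m) (\<Sum>m. c (fst p) m * snd p ^ m) < e"
        by (auto simp: add_nonneg_pos)
      then show "\<forall>\<^sub>F n in sequentially. \<forall>l\<in>cball 0 (norm l + 1).
          dist (\<Sum>m<n. c l m * z ^ m) (\<Sum>m. c l m * z ^ m) < e"
        by (rule eventually_mono) fastforce
    qed
    then have "uniform_limit (cball l 1) (\<lambda>n l. \<Sum>m<n. c l m * z ^ m) (\<lambda>l. \<Sum>m. c l m * z ^ m) sequentially"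
      by (rule uniform_limit_on_subset) (simp add: cball_subset_cball_iff)
    then show "\<exists>d>0. cball l d \<subseteq> UNIV \<and> uniform_limit (cball l d) (\<lambda>n l. \<Sum>m<n. c l m * z ^ m) (\<lambda>l. \<Sum>m. c l m * z ^ m) sequentially"
      by (intro exI[of _ 1]) auto
  qed (auto intro!: holomorphic_intros hol)
qed

section \<open>Fundamental solutions of Mathieu's equation as power series\<close>

definition mathieu_potential :: "real \<Rightarrow> complex \<Rightarrow> complex fps" where
  "mathieu_potential q l = fps_const (2 * of_real q) * fps_cos 2 - fps_const l"

text \<open>The flag \<open>ev\<close> selects the initial values \<open>(1, 0)\<close> of the even solution or \<open>(0, 1)\<close> of the odd one.\<close>

definition mathieu_init :: "bool \<Rightarrow> nat \<Rightarrow> complex" where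
  "mathieu_init ev n = (if ev = (n = 0) then 1 else 0)"

definition mathieu_coeff :: "real \<Rightarrow> bool \<Rightarrow> complex \<Rightarrow> nat \<Rightarrow> complex" where
  "mathieu_coeff q ev l =
     ode_coeff (fps_nth (mathieu_potential q l)) (mathieu_init ev 0) (mathieu_init ev 1)"

definition mathieu_fund :: "real \<Rightarrow> bool \<Rightarrow> complex \<Rightarrow> complex \<Rightarrow> complex" where
  "mathieu_fund q ev l = eval_fps (Abs_fps (mathieu_coeff q ev l))"

definition mathieu_fund' :: "real \<Rightarrow> bool \<Rightarrow> complex \<Rightarrow> complex \<Rightarrow> complex" where
  "mathieu_fund' q ev l = eval_fps (fps_deriv (Abs_fps (mathieu_coeff q ev l)))"

text \<open>The spectral parameter enters only the constant term of the potential, so adding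
  \<open>\<bar>L\<bar>\<close> to one coefficient of the majorant covers all \<open>l\<close> of
  norm at most \<open>L\<close>.\<close>

lemma mathieu_coeff_bound:
  "\<exists>B. (\<forall>l m. norm l \<le> L \<longrightarrow> norm (mathieu_coeff q ev l m) \<le> B m) \<and> (\<forall>R>0. summable (\<lambda>m. B m * R ^ m))"
proof -
  define C where "C = fps_const (2 * complex_of_real q) * fps_cos 2"
  define h where "h j = norm (fps_nth C j) + (if j = 0 then \<bar>L\<bar> else 0)" for j
  define B where "B = ode_coeff h 1 1"
  have "norm (mathieu_coeff q ev l m) \<le> B m" if "norm l \<le> L" for l m
    unfolding mathieu_coeff_def B_def
  proof (rule norm_ode_coeff_le)
    show "norm (fps_nth (mathieu_potential q l) j) \<le> h j" for j
    proof (cases "j = 0")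
      case True
      have "norm (fps_nth C 0 - l) \<le> norm (fps_nth C 0) + norm l" by (rule norm_triangle_ineq4)
      also have "\<dots> \<le> norm (fps_nth C 0) + \<bar>L\<bar>" using that by linarith
      finally show ?thesis using True by (simp add: h_def mathieu_potential_def C_def)
    qed (simp add: h_def mathieu_potential_def C_def)
  qed (auto simp: mathieu_init_def)
  moreover have "summable (\<lambda>m. B m * R ^ m)" if R: "R > 0" for R
    unfolding B_def
  proof (rule ode_coeff_summable)
    fix R :: real assume R: "R > 0"
    have "fps_conv_radius C = \<infinity>" unfolding C_def
      by (cases "q = 0") (auto simp: fps_conv_radius_cmult_left)
    then have "summable (\<lambda>j. norm (fps_nth C j * of_real R ^ j))"
      by (intro abs_summable_in_conv_radius) (auto simp: fps_conv_radius_def)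
    then have "summable (\<lambda>j. norm (fps_nth C j) * R ^ j)"
      using R by (simp add: norm_mult norm_power)
    moreover have "summable (\<lambda>j. (if j = 0 then \<bar>L\<bar> else 0) * R ^ j)"
      by (rule summable_finite[of "{0}"]) auto
    ultimately have "summable (\<lambda>j. norm (fps_nth C j) * R ^ j + (if j = 0 then \<bar>L\<bar> else 0) * R ^ j)"
      by (rule summable_add)
    then show "summable (\<lambda>j. h j * R ^ j)" by (simp add: h_def algebra_simps)
  qed (use R in \<open>auto simp: h_def\<close>)
  ultimately show ?thesis by blast
qed

lemma holomorphic_mathieu_coeff: "(\<lambda>l. mathieu_coeff q ev l m) holomorphic_on UNIV"
  unfolding mathieu_coeff_def
proof (rule holomorphic_ode_coeff)
  show "(\<lambda>l. fps_nth (mathieu_potential q l) j) holomorphic_on UNIV" for j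
    by (cases "j = 0") (auto simp: mathieu_potential_def intro!: holomorphic_intros)
qed

lemma conv_radius_mathieu_coeff: "fps_conv_radius (Abs_fps (mathieu_coeff q ev l)) = \<infinity>"
proof -
  obtain B where B: "\<And>l' m. norm l' \<le> norm l \<Longrightarrow> norm (mathieu_coeff q ev l' m) \<le> B m"
    "\<And>R. R > 0 \<Longrightarrow> summable (\<lambda>m. B m * R ^ m)"
    using mathieu_coeff_bound[of "norm l" q ev] by auto
  have "conv_radius (mathieu_coeff q ev l) \<ge> ereal R" if R: "R > 0" for R
  proof -
    have "summable (\<lambda>m. mathieu_coeff q ev l m * of_real R ^ m)"
    proof (rule summable_comparison_test)
      show "\<exists>N. \<forall>n\<ge>N. norm (mathieu_coeff q ev l n * of_real R ^ n) \<le> B n * R ^ n"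
        using B(1)[of l] R by (auto simp: norm_mult norm_power intro!: mult_right_mono)
    qed (use B(2) R in auto)
    then have "conv_radius (mathieu_coeff q ev l) \<ge> norm (of_real R :: complex)"
      by (rule conv_radius_geI)
    then show ?thesis using R by simp
  qed
  then have "conv_radius (mathieu_coeff q ev l) = \<infinity>"
    by (intro ereal_top) (meson ereal_less_eq(3) max.cobounded1 max.cobounded2 order_trans zero_less_one less_le_trans)
  then show ?thesis by (simp add: fps_conv_radius_def)
qed

lemma has_deriv_mathieu_fund [derivative_intros]:
  "(mathieu_fund q ev l has_field_derivative mathieu_fund' q ev l z) (at z within S)"
  unfolding mathieu_fund_def mathieu_fund'_def
  by (rule has_field_derivative_eval_fps) (simp add: conv_radius_mathieu_coeff)

lemma conv_radius_deriv_mathieu: "fps_conv_radius (fps_deriv (Abs_fps (mathieu_coeff q ev l))) = \<infinity>"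
  using fps_conv_radius_deriv[of "Abs_fps (mathieu_coeff q ev l)"]
  by (simp add: conv_radius_mathieu_coeff)

lemma mathieu_series_ode:
  "fps_deriv (fps_deriv (Abs_fps (mathieu_coeff q ev l))) =
     mathieu_potential q l * Abs_fps (mathieu_coeff q ev l)"
proof (rule fps_ext)
  fix n
  show "fps_nth (fps_deriv (fps_deriv (Abs_fps (mathieu_coeff q ev l)))) n =
    fps_nth (mathieu_potential q l * Abs_fps (mathieu_coeff q ev l)) n"
    by (simp add: fps_mult_nth mathieu_coeff_def atMost_atLeast0 field_simps del: of_nat_Suc of_nat_add)
qed

lemma has_deriv_mathieu_fund' [derivative_intros]:
  "(mathieu_fund' q ev l has_field_derivative (2 * of_real q * cos (2 * z) - l) * mathieu_fund q ev l z) (at z within S)"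
proof -
  let ?f = "Abs_fps (mathieu_coeff q ev l)"
  have "eval_fps (fps_deriv (fps_deriv ?f)) z = (2 * of_real q * cos (2 * z) - l) * eval_fps ?f z"
  proof -
    have 1: "fps_conv_radius (fps_const (2 * of_real q) * fps_cos (2::complex)) = \<infinity>"
      by (cases "q = 0") (auto simp: fps_conv_radius_cmult_left)
    have 2: "fps_conv_radius (mathieu_potential q l) = \<infinity>"
      using fps_conv_radius_diff[of "fps_const (2 * of_real q) * fps_cos (2::complex)" "fps_const l"]
      by (simp add: 1 mathieu_potential_def)
    show ?thesis unfolding mathieu_series_ode
      by (subst eval_fps_mult)
         (simp_all add: 2 conv_radius_mathieu_coeff, simp add: 1 mathieu_potential_def eval_fps_diff eval_fps_mult)
  qed
  then show ?thesis
    unfolding mathieu_fund_def mathieu_fund'_def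
    using has_field_derivative_eval_fps[of z "fps_deriv ?f" S]
    by (simp add: conv_radius_deriv_mathieu)
qed

lemma mathieu_fund_0: "mathieu_fund q ev l 0 = (if ev then 1 else 0)"
  "mathieu_fund' q ev l 0 = (if ev then 0 else 1)"
  by (auto simp: mathieu_fund_def mathieu_fund'_def eval_fps_at_0 mathieu_coeff_def mathieu_init_def)

lemma continuous_mathieu_fund_joint:
  "continuous_on UNIV (\<lambda>p. mathieu_fund q ev (fst p) (snd p))"
  "continuous_on UNIV (\<lambda>p. mathieu_fund' q ev (fst p) (snd p))"
  and holomorphic_mathieu_fund_param:
  "(\<lambda>l. mathieu_fund q ev l z) holomorphic_on UNIV"
  "(\<lambda>l. mathieu_fund' q ev l z) holomorphic_on UNIV"
proof -
  \<comment> \<open>The majorant for the derivative series is the formal derivative of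
    \<open>B\<close>, which still converges at every radius.\<close>
  have 1: "\<exists>B. (\<forall>l m. norm l \<le> L \<longrightarrow> norm (of_nat (Suc m) * mathieu_coeff q ev l (Suc m)) \<le> B m) \<and> (\<forall>R>0. summable (\<lambda>m. B m * R ^ m))" for L
  proof -
    obtain B where B: "\<And>l m. norm l \<le> L \<Longrightarrow> norm (mathieu_coeff q ev l m) \<le> B m"
    "\<And>R. R > 0 \<Longrightarrow> summable (\<lambda>m. B m * R ^ m)"
      using mathieu_coeff_bound[of L q ev] by auto
    have "summable (\<lambda>m. real (Suc m) * B (Suc m) * R ^ m)" if R: "R > 0" for R
    proof -
      have s: "summable (\<lambda>m. B m * x ^ m)" for x
      proof (cases "x = 0")
        case True
        then show ?thesis by (intro summable_finite[of "{0}"]) (auto simp: zero_power)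
      next
        case False
        show ?thesis
        proof (rule summable_in_conv_radius)
          have "conv_radius B \<ge> norm (2 * \<bar>x\<bar>)" using B(2)[of "2 * \<bar>x\<bar>"] False
            by (intro conv_radius_geI) auto
          moreover have "ereal (norm x) < ereal (norm (2 * \<bar>x\<bar>))" using False by simp
          ultimately show "ereal (norm x) < conv_radius B" using less_le_trans by blast
        qed
      qed
      from termdiff_converges_all[of B R, OF s] show ?thesis by (simp add: diffs_def)
    qed
    moreover have "norm (of_nat (Suc m) * mathieu_coeff q ev l (Suc m)) \<le> real (Suc m) * B (Suc m)" if "norm l \<le> L" for l m
      using B(1)[OF that, of "Suc m"] by (simp add: norm_mult mult_left_mono del: of_nat_Suc)
    ultimately show ?thesis by (intro exI[of _ "\<lambda>m. real (Suc m) * B (Suc m)"]) auto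
  qed
  have 2: "(\<lambda>l. of_nat (Suc m) * mathieu_coeff q ev l (Suc m)) holomorphic_on UNIV" for m
    by (intro holomorphic_intros holomorphic_mathieu_coeff)
  have e: "mathieu_fund q ev l z = (\<Sum>m. mathieu_coeff q ev l m * z ^ m)"
    "mathieu_fund' q ev l z = (\<Sum>m. of_nat (Suc m) * mathieu_coeff q ev l (Suc m) * z ^ m)" for l z
    by (simp_all add: mathieu_fund_def mathieu_fund'_def eval_fps_def)
  show "continuous_on UNIV (\<lambda>p. mathieu_fund q ev (fst p) (snd p))"
    "continuous_on UNIV (\<lambda>p. mathieu_fund' q ev (fst p) (snd p))"
  "(\<lambda>l. mathieu_fund q ev l z) holomorphic_on UNIV"
  "(\<lambda>l. mathieu_fund' q ev l z) holomorphic_on UNIV"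
    unfolding e
    using power_series_family[OF holomorphic_mathieu_coeff mathieu_coeff_bound, of q ev]
       power_series_family[OF 2 1] by auto
qed

lemma ode_coeff_cnj: "cnj (ode_coeff g a b n) = ode_coeff (\<lambda>j. cnj (g j)) (cnj a) (cnj b) n"
proof (induction n rule: less_induct)
  case (less n)
  consider "n = 0" | "n = Suc 0" | k where "n = Suc (Suc k)"
    by (metis not0_implies_Suc)
  then show ?case
    by cases (use less.IH in \<open>auto simp del: of_nat_Suc intro!: arg_cong2[where f="(/)"] sum.cong\<close>)
qed

lemma mathieu_coeff_cnj: "cnj (mathieu_coeff q ev l n) = mathieu_coeff q ev (cnj l) n"
proof -
  have "cnj (fps_nth (mathieu_potential q l) j) = fps_nth (mathieu_potential q (cnj l)) j" for j
    by (cases "j = 0") (auto simp: mathieu_potential_def fps_cos_def)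
  then show ?thesis unfolding mathieu_coeff_def ode_coeff_cnj by (simp add: mathieu_init_def)
qed

lemma mathieu_fund_cnj: "mathieu_fund q ev (cnj l) (cnj z) = cnj (mathieu_fund q ev l z)"
  "mathieu_fund' q ev (cnj l) (cnj z) = cnj (mathieu_fund' q ev l z)"
proof -
  have "(\<lambda>m. mathieu_coeff q ev l m * z ^ m) sums mathieu_fund q ev l z" for l z
    using sums_eval_fps[of z "Abs_fps (mathieu_coeff q ev l)"]
    by (simp add: conv_radius_mathieu_coeff mathieu_fund_def)
  from this[of "cnj l" "cnj z"] iffD2[OF sums_cnj this[of l z]]
  show "mathieu_fund q ev (cnj l) (cnj z) = cnj (mathieu_fund q ev l z)"
    by (auto simp: mathieu_coeff_cnj intro: sums_unique2)
  have "(\<lambda>m. of_nat (Suc m) * mathieu_coeff q ev l (Suc m) * z ^ m) sums mathieu_fund' q ev l z" for l z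
    using sums_eval_fps[of z "fps_deriv (Abs_fps (mathieu_coeff q ev l))"]
    by (simp add: conv_radius_deriv_mathieu mathieu_fund'_def)
  from this[of "cnj l" "cnj z"] iffD2[OF sums_cnj this[of l z]]
  show "mathieu_fund' q ev (cnj l) (cnj z) = cnj (mathieu_fund' q ev l z)"
    by (auto simp: mathieu_coeff_cnj intro: sums_unique2)
qed

text \<open>Unlike \<open>mathieu_solution\<close> this allows a complex spectral parameter, as
  analyticity in \<open>l\<close> and the resolvent require.\<close>

definition mathieu_sol :: "real \<Rightarrow> complex \<Rightarrow> (complex \<Rightarrow> complex) \<Rightarrow> bool" where
  "mathieu_sol q l u \<longleftrightarrow> u holomorphic_on UNIV \<and>
     (\<forall>z. deriv (deriv u) z = (2 * of_real q * cos (2 * z) - l) * u z)"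

lemma mathieu_solution_iff: "mathieu_solution q l u \<longleftrightarrow> mathieu_sol q (of_real l) u"
  unfolding mathieu_solution_def mathieu_sol_def
  by (simp add: algebra_simps add_eq_0_iff eq_neg_iff_add_eq_0)

lemma mathieu_solI:
  assumes "\<And>z. (u has_field_derivative u' z) (at z)"
    and "\<And>z. (u' has_field_derivative (2 * of_real q * cos (2 * z) - l) * u z) (at z)"
  shows "mathieu_sol q l u" "deriv u = u'"
proof -
  show *: "deriv u = u'" using assms(1) DERIV_imp_deriv by blast
  show "mathieu_sol q l u" unfolding mathieu_sol_def *
    using assms(1) DERIV_imp_deriv[OF assms(2)] by (auto simp: holomorphic_on_open)
qed

lemma mathieu_solD:
  assumes "mathieu_sol q l u"
  shows "(u has_field_derivative deriv u z) (at z within S)"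
    and "(deriv u has_field_derivative (2 * of_real q * cos (2 * z) - l) * u z) (at z within S)"
proof -
  have 1: "u holomorphic_on UNIV" using assms by (simp add: mathieu_sol_def)
  then show "(u has_field_derivative deriv u z) (at z within S)"
    by (intro has_field_derivative_at_within[OF holomorphic_derivI[OF 1]]) auto
  have 2: "deriv u holomorphic_on UNIV" using 1 by (intro holomorphic_deriv) auto
  have "(deriv u has_field_derivative deriv (deriv u) z) (at z)"
    by (intro holomorphic_derivI[OF 2]) auto
  then show "(deriv u has_field_derivative (2 * of_real q * cos (2 * z) - l) * u z) (at z within S)"
    using assms by (auto simp: mathieu_sol_def intro: has_field_derivative_at_within)
qed

lemma mathieu_sol_fund: "mathieu_sol q l (mathieu_fund q ev l)"
  and deriv_mathieu_fund: "deriv (mathieu_fund q ev l) = mathieu_fund' q ev l"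
proof -
  show "mathieu_sol q l (mathieu_fund q ev l)" "deriv (mathieu_fund q ev l) = mathieu_fund' q ev l"
    using mathieu_solI[of "mathieu_fund q ev l" "mathieu_fund' q ev l" q l]
      has_deriv_mathieu_fund has_deriv_mathieu_fund' by blast+
qed

lemma wronskian_const:
  assumes u: "mathieu_sol q l u" and v: "mathieu_sol q l v"
  shows "wronskian u v z = wronskian u v w"
proof -
  have "(wronskian u v has_field_derivative 0) (at x)" for x
    unfolding wronskian_def
    by (rule derivative_eq_intros mathieu_solD[OF u] mathieu_solD[OF v] refl)+ (simp add: algebra_simps)
  then obtain c where "\<And>x. wronskian u v x = c"
    using has_field_derivative_zero_constant[of UNIV "wronskian u v"] by auto
  then show ?thesis by simp
qed

text \<open>Constancy of the Wronskian replaces a uniqueness theorem: Cramer's rule expresses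
  \<open>u z\<close> by the Wronskians of \<open>u\<close> with the two fundamental solutions, and
  these are known at \<open>0\<close>.\<close>

lemma mathieu_sol_repr:
  assumes "mathieu_sol q l u"
  shows "u z = u 0 * mathieu_fund q True l z + deriv u 0 * mathieu_fund q False l z"
proof -
  let ?f = "mathieu_fund q True l" and ?g = "mathieu_fund q False l"
  have 1: "wronskian ?f u z = deriv u 0" "wronskian ?g u z = - u 0" "wronskian ?f ?g z = 1"
    using wronskian_const[OF mathieu_sol_fund assms, of True z 0]
       wronskian_const[OF mathieu_sol_fund assms, of False z 0]
       wronskian_const[OF mathieu_sol_fund mathieu_sol_fund, of q True l False z 0]
    by (auto simp: wronskian_def deriv_mathieu_fund mathieu_fund_0)
  have "u z * wronskian ?f ?g z = wronskian ?f u z * ?g z - wronskian ?g u z * ?f z"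
    by (simp add: wronskian_def algebra_simps)
  then show ?thesis unfolding 1 by simp
qed

lemma mathieu_sol_shift:
  assumes "mathieu_sol q l u"
  shows "mathieu_sol q l (\<lambda>z. u (z + of_real pi))"
    and "deriv (\<lambda>z. u (z + of_real pi)) = (\<lambda>z. deriv u (z + of_real pi))"
proof -
  have 1: "((\<lambda>z. u (z + of_real pi)) has_field_derivative deriv u (z + of_real pi)) (at z)" for z
    by (rule mathieu_solD(1)[OF assms, of "z + of_real pi" UNIV, unfolded DERIV_shift])
  have c: "cos (2 * (z + of_real pi)) = cos (2 * z)" for z :: complex
  proof -
    have "cos (2 * (z + of_real pi)) = cos (2 * z + of_real (2 * pi))" by (simp add: algebra_simps)
    also have "\<dots> = cos (2 * z)"
      by (simp only: cos_add cos_of_real sin_of_real cos_two_pi sin_two_pi) simp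
    finally show ?thesis .
  qed
  have 2: "((\<lambda>z. deriv u (z + of_real pi)) has_field_derivative (2 * of_real q * cos (2 * z) - l) * u (z + of_real pi)) (at z)" for z
    by (rule mathieu_solD(2)[OF assms, of "z + of_real pi" UNIV, unfolded c DERIV_shift])
  show "mathieu_sol q l (\<lambda>z. u (z + of_real pi))"
    "deriv (\<lambda>z. u (z + of_real pi)) = (\<lambda>z. deriv u (z + of_real pi))"
    using mathieu_solI[OF 1 2] by auto
qed

lemma mathieu_sol_neg:
  assumes "mathieu_sol q l u"
  shows "mathieu_sol q l (\<lambda>z. u (- z))"
    and "deriv (\<lambda>z. u (- z)) = (\<lambda>z. - deriv u (- z))"
proof -
  have 1: "((\<lambda>z. u (- z)) has_field_derivative - deriv u (- z)) (at z)" for z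
    using DERIV_chain2[OF mathieu_solD(1)[OF assms], of "\<lambda>z. - z" "-1" z UNIV]
    by (simp add: DERIV_minus[OF DERIV_ident])
  have 2: "((\<lambda>z. - deriv u (- z)) has_field_derivative (2 * of_real q * cos (2 * z) - l) * u (- z)) (at z)" for z
    using DERIV_minus[OF DERIV_chain2[OF mathieu_solD(2)[OF assms], of "\<lambda>z. - z" "-1" z UNIV]]
    by (simp add: DERIV_minus[OF DERIV_ident])
  show "mathieu_sol q l (\<lambda>z. u (- z))" "deriv (\<lambda>z. u (- z)) = (\<lambda>z. - deriv u (- z))"
    using mathieu_solI[OF 1 2] by auto
qed

lemma mathieu_sol_cmult:
  assumes "mathieu_sol q l u"
  shows "mathieu_sol q l (\<lambda>z. c * u z)"
    and "deriv (\<lambda>z. c * u z) = (\<lambda>z. c * deriv u z)"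
proof -
  have 1: "((\<lambda>z. c * u z) has_field_derivative c * deriv u z) (at z)" for z
    by (intro DERIV_cmult mathieu_solD(1)[OF assms])
  have 2: "((\<lambda>z. c * deriv u z) has_field_derivative (2 * of_real q * cos (2 * z) - l) * (c * u z)) (at z)" for z
    using DERIV_cmult[OF mathieu_solD(2)[OF assms], of c z UNIV] by (simp add: algebra_simps)
  show "mathieu_sol q l (\<lambda>z. c * u z)" "deriv (\<lambda>z. c * u z) = (\<lambda>z. c * deriv u z)"
    using mathieu_solI[OF 1 2] by auto
qed

definition par :: "bool \<Rightarrow> complex" where "par ev = (if ev then 1 else - 1)"

lemma par_sq [simp]: "par ev * par ev = 1" "par ev * (par ev * x) = x" "par ev \<noteq> 0" "cnj (par ev) = par ev"
  by (auto simp: par_def)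

lemma mathieu_fund_par:
  "mathieu_fund q ev l (- z) = par ev * mathieu_fund q ev l z"
  "mathieu_fund' q ev l (- z) = - par ev * mathieu_fund' q ev l z"
proof -
  have *: "mathieu_fund q ev l (- z) = par ev * mathieu_fund q ev l z" for z
    using mathieu_sol_repr[OF mathieu_sol_neg(1)[OF mathieu_sol_fund], of q ev l z]
    by (simp add: mathieu_fund_0 mathieu_sol_neg(2)[OF mathieu_sol_fund] deriv_mathieu_fund par_def)
  then show "mathieu_fund q ev l (- z) = par ev * mathieu_fund q ev l z" .
  have "(\<lambda>z. - mathieu_fund' q ev l (- z)) = (\<lambda>z. par ev * mathieu_fund' q ev l z)"
    using mathieu_sol_neg(2)[OF mathieu_sol_fund, of q ev l] mathieu_sol_cmult(2)[OF mathieu_sol_fund, of "par ev" q ev l]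
    by (simp add: * deriv_mathieu_fund)
  then show "mathieu_fund' q ev l (- z) = - par ev * mathieu_fund' q ev l z"
    by (metis minus_equation_iff mult_minus_left)
qed

lemma mathieu_sol_par:
  assumes "mathieu_sol q l u" "\<And>z. u (- z) = par ev * u z"
  obtains c where "\<And>z. u z = c * mathieu_fund q ev l z" "c = (if ev then u 0 else deriv u 0)"
proof (cases ev)
  case True
  have "(\<lambda>z. u (- z)) = u" using assms(2) True by (simp add: par_def)
  then have "deriv u 0 = - deriv u (- 0)"
    using fun_cong[OF mathieu_sol_neg(2)[OF assms(1)], of 0] by simp
  then have *: "deriv u 0 = 0" by simp
  show ?thesis
  proof (rule that[of "u 0"])
    show "u z = u 0 * mathieu_fund q ev l z" for z
      using mathieu_sol_repr[OF assms(1), of z] *  True by simp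
  qed (use True in simp)
next
  case False
  have *: "u 0 = 0" using assms(2)[of 0] False by (simp add: par_def)
  show ?thesis
  proof (rule that[of "deriv u 0"])
    show "u z = deriv u 0 * mathieu_fund q ev l z" for z
      using mathieu_sol_repr[OF assms(1), of z] *  False by simp
  qed (use False in simp)
qed

lemma holomorphic_mathieu_fund: "mathieu_fund q ev l holomorphic_on S"
  using mathieu_sol_fund[of q l ev] holomorphic_on_subset unfolding mathieu_sol_def by blast

text \<open>\<open>disc\<close> vanishes exactly at the eigenvalues, and there \<open>codisc\<close> is the multiplier of the solution
  under translation by \<open>pi\<close>.\<close>

definition disc :: "real \<Rightarrow> bool \<Rightarrow> complex \<Rightarrow> complex" where
  "disc q ev l = (if ev then mathieu_fund' q ev l (of_real pi) else mathieu_fund q ev l (of_real pi))"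

definition codisc :: "real \<Rightarrow> bool \<Rightarrow> complex \<Rightarrow> complex" where
  "codisc q ev l = (if ev then mathieu_fund q ev l (of_real pi) else mathieu_fund' q ev l (of_real pi))"

lemma holomorphic_disc: "disc q ev holomorphic_on S"
proof -
  have "(\<lambda>l. disc q ev l) holomorphic_on UNIV"
    by (cases ev) (simp_all add: disc_def holomorphic_mathieu_fund_param)
  then show ?thesis using holomorphic_on_subset by blast
qed

lemma continuous_mathieu_fund [continuous_intros]:
  assumes "continuous_on S f" "continuous_on S g"
  shows "continuous_on S (\<lambda>x. mathieu_fund q ev (f x) (g x))"
   "continuous_on S (\<lambda>x. mathieu_fund' q ev (f x) (g x))"
  using continuous_on_compose2[OF continuous_mathieu_fund_joint(1), of S "\<lambda>x. (f x, g x)" q ev]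
    continuous_on_compose2[OF continuous_mathieu_fund_joint(2), of S "\<lambda>x. (f x, g x)" q ev] assms
  by (auto intro!: continuous_intros)

text \<open>Lagrange's identity. The boundary term at \<open>0\<close> vanishes because both
  solutions have the same initial data; at \<open>pi\<close> it is the left side up to the sign
  \<open>par ev\<close>. The reality of the zeros, the orthogonality and the derivative of
  \<open>disc\<close> all come from this identity.\<close>

lemma disc_lagrange:
  "codisc q ev l * disc q ev m - disc q ev l * codisc q ev m =
     par ev * ((l - m) * integral {0..pi} (\<lambda>x. mathieu_fund q ev l (of_real x) * mathieu_fund q ev m (of_real x)))"
proof -
  let ?u = "mathieu_fund q ev l" and ?v = "mathieu_fund q ev m"
  let ?u' = "mathieu_fund' q ev l" and ?v' = "mathieu_fund' q ev m"
  let ?W = "\<lambda>z. ?u z * ?v' z - ?u' z * ?v z"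
  have "(?W has_field_derivative (l - m) * (?u z * ?v z)) (at z)" for z
    by (rule derivative_eq_intros refl)+ (simp add: algebra_simps)
  then have "((\<lambda>x. ?W (of_real x)) has_vector_derivative (l - m) * (?u (of_real x) * ?v (of_real x)))
      (at x within {0..pi})" for x
    by (rule has_vector_derivative_real_field)
  then have "((\<lambda>x. (l - m) * (?u (of_real x) * ?v (of_real x))) has_integral (?W (of_real pi) - ?W (of_real 0))) {0..pi}"
    by (intro fundamental_theorem_of_calculus) auto
  then have "integral {0..pi} (\<lambda>x. (l - m) * (?u (of_real x) * ?v (of_real x))) = ?W (of_real pi) - ?W (of_real 0)"
    by (rule integral_unique)
  then have "(l - m) * integral {0..pi} (\<lambda>x. ?u (of_real x) * ?v (of_real x)) = ?W (of_real pi)"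
    by (simp add: mathieu_fund_0)
  then show ?thesis
    by (cases ev) (simp_all add: disc_def codisc_def par_def)
qed

lemma disc_zero:
  assumes "disc q ev l = 0"
  shows "mathieu_fund q ev l (z + of_real pi) = codisc q ev l * mathieu_fund q ev l z"
    and "(codisc q ev l)\<^sup>2 = 1"
proof -
  let ?u = "mathieu_fund q ev l"
  have *: "?u (z + of_real pi) = codisc q ev l * ?u z" for z
    using mathieu_sol_repr[OF mathieu_sol_shift(1)[OF mathieu_sol_fund], of q ev l z] assms
    by (cases ev) (simp_all add: mathieu_sol_shift(2)[OF mathieu_sol_fund] deriv_mathieu_fund disc_def codisc_def)
  then show "?u (z + of_real pi) = codisc q ev l * ?u z" .
  have d: "mathieu_fund' q ev l (z + of_real pi) = codisc q ev l * mathieu_fund' q ev l z" for z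
  proof -
    have "(\<lambda>z. mathieu_fund' q ev l (z + of_real pi)) = deriv (\<lambda>z. ?u (z + of_real pi))"
      by (simp add: mathieu_sol_shift(2)[OF mathieu_sol_fund] deriv_mathieu_fund)
    also have "\<dots> = deriv (\<lambda>z. codisc q ev l * ?u z)" by (simp only: *)
    also have "\<dots> = (\<lambda>z. codisc q ev l * mathieu_fund' q ev l z)"
      by (simp add: mathieu_sol_cmult(2)[OF mathieu_sol_fund] deriv_mathieu_fund)
    finally show ?thesis by (rule fun_cong)
  qed
  show "(codisc q ev l)\<^sup>2 = 1"
  \<comment> \<open>Translating from \<open>- pi\<close> to \<open>0\<close> and using parity
    returns the initial value \<open>1\<close> as the square of the multiplier.\<close>
  proof (cases ev)
    case True
    then show ?thesis using *[of "- of_real pi"]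
      by (simp add: mathieu_fund_par mathieu_fund_0 par_def codisc_def power2_eq_square)
  next
    case False
    then show ?thesis using d[of "- of_real pi"]
      by (simp add: mathieu_fund_par mathieu_fund_0 par_def codisc_def power2_eq_square)
  qed
qed

lemma entire_zero_on_interval:
  fixes f :: "complex \<Rightarrow> complex" and a b :: real
  assumes "f holomorphic_on UNIV" "a < b" "\<And>x. x \<in> {a..b} \<Longrightarrow> f (of_real x) = 0"
  shows "f z = 0"
proof (rule analytic_continuation[of f UNIV "of_real ` {a..b}" "of_real a"])
  show "complex_of_real a islimpt complex_of_real ` {a..b}"
    unfolding islimpt_approachable
  proof (intro allI impI)
    fix e :: real assume e: "e > 0"
    define x where "x = a + min (e / 2) (b - a)"
    have "x \<in> {a..b}" "x \<noteq> a" "\<bar>x - a\<bar> < e" using e assms(2) by (auto simp: x_def)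
    then show "\<exists>x'\<in>complex_of_real ` {a..b}. x' \<noteq> complex_of_real a \<and> dist x' (complex_of_real a) < e"
      by (intro bexI[of _ "of_real x"]) (auto simp: dist_norm norm_of_real simp flip: of_real_diff)
  qed
qed (use assms in auto)

lemma integral_of_real_cont:
  fixes f :: "real \<Rightarrow> real"
  assumes "continuous_on {a..b} f"
  shows "integral {a..b} (\<lambda>x. complex_of_real (f x)) = of_real (integral {a..b} f)"
  using integral_linear[OF integrable_continuous_interval[OF assms] bounded_linear_of_real]
  by (simp add: o_def)

lemma mathieu_fund_norm_pos:
  "integral {0..pi} (\<lambda>x. (norm (mathieu_fund q ev l (of_real x)))\<^sup>2) > 0"
proof -
  let ?f = "\<lambda>x. (norm (mathieu_fund q ev l (of_real x)))\<^sup>2"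
  have c: "continuous_on {0..pi} ?f" by (intro continuous_intros)
  have "integral {0..pi} ?f \<noteq> 0"
  proof
    assume "integral {0..pi} ?f = 0"
    then have "\<forall>x\<in>{0..pi}. ?f x = 0"
      using integral_eq_0_iff[OF c] by simp
    then have *: "mathieu_fund q ev l (of_real x) = 0" if "x \<in> {0..pi}" for x using that by simp
    have z: "mathieu_fund q ev l z = 0" for z
      by (rule entire_zero_on_interval[OF holomorphic_mathieu_fund pi_gt_zero *])
    then have "mathieu_fund q ev l = (\<lambda>z. 0)" by auto
    then have "deriv (mathieu_fund q ev l) 0 = 0" by simp
    then have "mathieu_fund' q ev l 0 = 0" unfolding deriv_mathieu_fund .
    then show False using z[of 0] mathieu_fund_0[of q ev l] by (auto split: if_splits)
  qed
  moreover have "integral {0..pi} ?f \<ge> 0" by (rule integral_nonneg) (auto intro!: integrable_continuous_interval c)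
  ultimately show ?thesis by simp
qed

lemma disc_cnj: "disc q ev (cnj l) = cnj (disc q ev l)" "codisc q ev (cnj l) = cnj (codisc q ev l)"
  using mathieu_fund_cnj[of q ev l "of_real pi"] by (auto simp: disc_def codisc_def)

lemma mathieu_fund_real: "mathieu_fund q ev (of_real l) (of_real x) \<in> \<real>"
  "mathieu_fund' q ev (of_real l) (of_real x) \<in> \<real>"
  using mathieu_fund_cnj[of q ev "of_real l" "of_real x"] by (auto simp: Reals_cnj_iff)

text \<open>Self-adjointness: in Lagrange's identity for \<open>l\<close> and \<open>cnj l\<close>
  the integrand is the squared modulus of one solution, whose integral is positive.\<close>

lemma disc_zero_real:
  assumes "disc q ev l = 0"
  shows "l \<in> \<real>"
proof -
  have "disc q ev (cnj l) = 0" using assms by (simp add: disc_cnj)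
  then have "(l - cnj l) * integral {0..pi} (\<lambda>x. mathieu_fund q ev l (of_real x) * mathieu_fund q ev (cnj l) (of_real x)) = 0"
    using disc_lagrange[of q ev l "cnj l"] assms by simp
  moreover have "(\<lambda>x. mathieu_fund q ev l (of_real x) * mathieu_fund q ev (cnj l) (of_real x)) =
      (\<lambda>x. complex_of_real ((norm (mathieu_fund q ev l (of_real x)))\<^sup>2))"
    using mathieu_fund_cnj(1)[of q ev l "of_real _"] by (simp add: complex_norm_square del: of_real_power)
  ultimately have "(l - cnj l) * of_real (integral {0..pi} (\<lambda>x. (norm (mathieu_fund q ev l (of_real x)))\<^sup>2)) = 0"
    by (simp add: integral_of_real_cont continuous_intros del: of_real_power)
  then have "l = cnj l" using mathieu_fund_norm_pos[of q ev l] by (simp add: less_le)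
  then show ?thesis by (simp add: Reals_cnj_iff)
qed

text \<open>At a zero only one product is left on the left side of Lagrange's identity; dividing by
  the difference of the parameters and passing to the limit gives the derivative. It is nonzero, so
  all zeros are simple, and its sign is decided by the multiplier.\<close>

lemma disc_has_deriv:
  fixes l0 :: real
  assumes "disc q ev (of_real l0) = 0"
  shows "(disc q ev has_field_derivative - par ev * codisc q ev (of_real l0) *
    of_real (integral {0..pi} (\<lambda>x. (norm (mathieu_fund q ev (of_real l0) (of_real x)))\<^sup>2))) (at (of_real l0))"
proof -
  let ?l = "complex_of_real l0" and ?k = "codisc q ev (of_real l0)"
  let ?J = "\<lambda>m. integral {0..pi} (\<lambda>x. mathieu_fund q ev ?l (of_real x) * mathieu_fund q ev m (of_real x))"
  have k: "?k * ?k = 1" using disc_zero(2)[OF assms] by (simp only: power2_eq_square)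
  have d: "disc q ev m = - par ev * ?k * ((m - ?l) * ?J m)" for m
  proof -
    have "?k * disc q ev m = par ev * ((?l - m) * ?J m)" using disc_lagrange[of q ev ?l m] assms by simp
    then have "(?k * ?k) * disc q ev m = ?k * (par ev * ((?l - m) * ?J m))" by (simp only: mult.assoc)
    also have "\<dots> = - par ev * ?k * ((m - ?l) * ?J m)" by (simp add: algebra_simps)
    finally show ?thesis using k by simp
  qed
  have "continuous_on UNIV (\<lambda>m. integral (cbox 0 pi) (\<lambda>x. mathieu_fund q ev ?l (of_real x) * mathieu_fund q ev m (of_real x)))"
    by (rule integral_continuous_on_param) (auto intro!: continuous_intros simp: split_beta)
  then have "isCont ?J ?l" by (simp add: continuous_on_eq_continuous_at)
  then have J: "(?J \<longlongrightarrow> ?J ?l) (at ?l)" by (simp add: isCont_def)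
  have JJ: "?J ?l = of_real (integral {0..pi} (\<lambda>x. (norm (mathieu_fund q ev (of_real l0) (of_real x)))\<^sup>2))"
  proof -
    have "(\<lambda>x. mathieu_fund q ev ?l (of_real x) * mathieu_fund q ev ?l (of_real x)) =
      (\<lambda>x. complex_of_real ((norm (mathieu_fund q ev ?l (of_real x)))\<^sup>2))"
      by (simp only: complex_norm_square Reals_cnj_iff[THEN iffD1, OF mathieu_fund_real(1)])
    then show ?thesis by (simp only: integral_of_real_cont continuous_intros continuous_on_of_real)
  qed
  have "((\<lambda>m. - par ev * ?k * ?J m) \<longlongrightarrow> - par ev * ?k * ?J ?l) (at ?l)"
    by (intro tendsto_intros J)
  then have "((\<lambda>m. (disc q ev m - disc q ev ?l) / (m - ?l)) \<longlongrightarrow> - par ev * ?k * ?J ?l) (at ?l)"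
    by (rule Lim_transform_eventually) (auto simp: eventually_at_filter assms d)
  then show ?thesis unfolding has_field_derivative_iff JJ .
qed

lemma codisc_real: "codisc q ev (of_real l) = of_real (Re (codisc q ev (of_real l)))"
  and disc_real: "disc q ev (of_real l) = of_real (Re (disc q ev (of_real l)))"
proof -
  have "codisc q ev (of_real l) \<in> \<real>" "disc q ev (of_real l) \<in> \<real>"
    unfolding codisc_def disc_def using mathieu_fund_real[of q ev l pi] by (cases ev; force)+
  then show "codisc q ev (of_real l) = of_real (Re (codisc q ev (of_real l)))"
    "disc q ev (of_real l) = of_real (Re (disc q ev (of_real l)))"
    by (simp_all only: of_real_Re)
qed

section \<open>Parameter integrals, quotients and a Liouville theorem\<close>

text \<open>Morera's theorem: the integral over a triangle is exchanged with the one over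
  \<open>{a..b}\<close>, where Cauchy's theorem applies for each fixed \<open>x\<close>.\<close>

lemma holomorphic_integral_param:
  fixes K :: "complex \<Rightarrow> real \<Rightarrow> complex"
  assumes cont: "continuous_on (UNIV \<times> {a..b}) (\<lambda>(l, x). K l x)"
    and hol: "\<And>x. x \<in> {a..b} \<Longrightarrow> (\<lambda>l. K l x) holomorphic_on UNIV"
  shows "(\<lambda>l. integral {a..b} (K l)) holomorphic_on UNIV"
proof -
  let ?F = "\<lambda>l. integral {a..b} (K l)"
  have contF: "continuous_on UNIV ?F"
    using integral_continuous_on_param[of UNIV a b K] cont by simp
  have K2: "continuous_on S (\<lambda>s. K (g s) (h s))"
    if "continuous_on S g" "continuous_on S h" "h ` S \<subseteq> {a..b}" for g h and S :: "(real \<times> real) set"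
    using continuous_on_compose2[OF cont, of S "\<lambda>s. (g s, h s)"] that
    by (auto intro!: continuous_intros)
  have lp: "continuous_on S (\<lambda>s. linepath p r (h s))" if "continuous_on S h" for p r h and S :: "(real \<times> real) set"
    unfolding linepath_def using that by (intro continuous_intros)
  have swap: "contour_integral (linepath p r) ?F = integral {a..b} (\<lambda>x. contour_integral (linepath p r) (\<lambda>l. K l x))" for p r
  proof -
    have "contour_integral (linepath p r) ?F = integral {0..1} (\<lambda>t. integral {a..b} (\<lambda>x. K (linepath p r t) x * (r - p)))"
      by (simp add: contour_integral_integral)
    also have "\<dots> = integral {a..b} (\<lambda>x. integral {0..1} (\<lambda>t. K (linepath p r t) x * (r - p)))"
    proof -
      have "continuous_on (cbox (0, a) (1, b)) (\<lambda>(t, x). K (linepath p r t) x * (r - p))"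
        by (auto simp: split_beta cbox_Pair_eq intro!: continuous_intros K2 lp)
      from integral_swap_continuous[OF this] show ?thesis by simp
    qed
    finally show ?thesis by (simp add: contour_integral_integral)
  qed
  have ci: "continuous_on {a..b} (\<lambda>x. contour_integral (linepath p r) (\<lambda>l. K l x))" for p r
  proof -
    have "continuous_on {a..b} (\<lambda>x. integral (cbox 0 1) (\<lambda>t. K (linepath p r t) x * (r - p)))"
      by (rule integral_continuous_on_param) (auto simp: split_beta intro!: continuous_intros K2 lp)
    then show ?thesis by (simp add: contour_integral_integral)
  qed
  have "?F analytic_on UNIV"
  proof (rule Morera_triangle[OF contF])
    fix x y z :: complex
    have 0: "contour_integral (linepath x y) (\<lambda>l. K l t) + contour_integral (linepath y z) (\<lambda>l. K l t) +
        contour_integral (linepath z x) (\<lambda>l. K l t) = 0" if t: "t \<in> {a..b}" for t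
    proof -
      have "((\<lambda>l. K l t) has_contour_integral 0) (linepath x y +++ linepath y z +++ linepath z x)"
        using hol[OF t] holomorphic_on_subset by (intro Cauchy_theorem_triangle) blast
      then show ?thesis
        using contour_integral_unique has_chain_integral_chain_integral3 by blast
    qed
    have i: "(\<lambda>t. contour_integral (linepath p r) (\<lambda>l. K l t)) integrable_on {a..b}" for p r
      by (intro integrable_continuous_interval ci)
    have "contour_integral (linepath x y) ?F + contour_integral (linepath y z) ?F + contour_integral (linepath z x) ?F =
      integral {a..b} (\<lambda>t. contour_integral (linepath x y) (\<lambda>l. K l t) + contour_integral (linepath y z) (\<lambda>l. K l t) +
        contour_integral (linepath z x) (\<lambda>l. K l t))"
      unfolding swap by (simp add: integral_add i integrable_add)
    also have "\<dots> = integral {a..b} (\<lambda>t. 0)" by (rule integral_cong) (rule 0)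
    finally show "convex hull {x, y, z} \<subseteq> UNIV \<longrightarrow> contour_integral (linepath x y) ?F + contour_integral (linepath y z) ?F + contour_integral (linepath z x) ?F = 0"
      by simp
  qed auto
  then show ?thesis by (rule analytic_imp_holomorphic)
qed

text \<open>Rescaling to the fixed interval from \<open>0\<close> to \<open>1\<close> turns the
  upper limit into an ordinary parameter.\<close>

lemma continuous_indefinite_integral_param:
  fixes g :: "complex \<Rightarrow> real \<Rightarrow> complex"
  assumes cont: "continuous_on (UNIV \<times> {0..b}) (\<lambda>(l, x). g l x)"
  shows "continuous_on (UNIV \<times> {0..b}) (\<lambda>(l, x). integral {0..x} (g l))"
proof -
  have *: "integral {0..x} (g l) = integral (cbox 0 1) (\<lambda>t. of_real x * g l (x * t))" if x: "x \<in> {0..b}" for l x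
  proof (cases "x = 0")
    case False
    then have x0: "x > 0" using x by auto
    have "continuous_on {0..x} (g l)"
    proof -
      have "continuous_on {0..x} (\<lambda>t. (l, t))" by (intro continuous_intros)
      from continuous_on_compose2[OF cont this] show ?thesis using x by fastforce
    qed
    then have "(g l has_integral integral {0..x} (g l)) {0..x}"
      using integrable_continuous_interval integrable_integral by fastforce
    from has_integral_stretch_real[OF this, of x] x0
    have "((\<lambda>t. g l (x * t)) has_integral (1 / x) *\<^sub>R integral {0..x} (g l)) ((\<lambda>t. t / x) ` {0..x})"
      by simp
    moreover have "(\<lambda>t. t / x) ` {0..x} = {0..1}"
      using image_divide_atLeastAtMost[OF x0, of 0 x] x0 by simp
    ultimately have "((\<lambda>t. of_real x * g l (x * t)) has_integral of_real x * ((1 / x) *\<^sub>R integral {0..x} (g l))) {0..1}"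
      by (intro has_integral_mult_right) simp
    then have "((\<lambda>t. of_real x * g l (x * t)) has_integral integral {0..x} (g l)) {0..1}"
      using x0 by (simp add: scaleR_conv_of_real)
    from integral_unique[OF this] show ?thesis by simp
  qed simp
  have "continuous_on (UNIV \<times> {0..b}) (\<lambda>p. integral (cbox 0 1) (\<lambda>t. of_real (snd p) * g (fst p) (snd p * t)))"
  proof (rule integral_continuous_on_param, unfold split_beta, intro continuous_intros)
    have "continuous_on ((UNIV \<times> {0..b}) \<times> cbox 0 1) (\<lambda>x::(complex \<times> real) \<times> real. (fst (fst x), snd (fst x) * snd x))"
      by (intro continuous_intros)
    moreover have "(\<lambda>x::(complex \<times> real) \<times> real. (fst (fst x), snd (fst x) * snd x)) ` ((UNIV \<times> {0..b}) \<times> cbox 0 1) \<subseteq> UNIV \<times> {0..b}"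
      by (auto intro: order_trans[OF mult_left_le])
    ultimately have "continuous_on ((UNIV \<times> {0..b}) \<times> cbox 0 1)
        (\<lambda>x. case (fst (fst x), snd (fst x) * snd x) of (l, x) \<Rightarrow> g l x)"
      by (rule continuous_on_compose2[OF cont])
    then show "continuous_on ((UNIV \<times> {0..b}) \<times> cbox 0 1) (\<lambda>x. g (fst (fst x)) (snd (fst x) * snd x))"
      by simp
  qed
  then show ?thesis
    by (rule continuous_on_eq) (auto simp: *)
qed

text \<open>At a simple zero of \<open>g\<close> that is also a zero of \<open>f\<close> the
  quotient has a removable singularity, with the quotient of the derivatives as its value.\<close>

lemma entire_quotient:
  fixes f g :: "complex \<Rightarrow> complex"
  assumes f: "f holomorphic_on UNIV" and g: "g holomorphic_on UNIV"
    and z: "\<And>z. g z = 0 \<Longrightarrow> f z = 0 \<and> deriv g z \<noteq> 0"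
  obtains h where "h holomorphic_on UNIV" "\<And>z. f z = h z * g z"
proof -
  define h where "h z = (if g z = 0 then deriv f z / deriv g z else f z / g z)" for z
  have fd: "(f has_field_derivative deriv f z) (at z)" and gd: "(g has_field_derivative deriv g z) (at z)" for z
    using f g by (auto intro!: holomorphic_derivI)
  have "\<exists>h'. (h has_field_derivative h') (at w)" for w
  proof (cases "g w = 0")
    case False
    have "isCont g w" using gd DERIV_isCont by blast
    then have "\<forall>\<^sub>F z in nhds w. g z \<noteq> 0"
      using False continuous_at_avoid[of w g 0]
      by (metis (mono_tags, lifting) eventually_nhds_metric dist_commute)
    then have ev: "\<forall>\<^sub>F z in nhds w. f z / g z = h z"
      by (rule eventually_mono) (simp add: h_def)
    have "((\<lambda>z. f z / g z) has_field_derivative (deriv f w * g w - f w * deriv g w) / (g w * g w)) (at w)"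
      by (rule DERIV_divide[OF fd gd False])
    then show ?thesis
      using DERIV_cong_ev[OF refl ev refl] by blast
  next
    case True
    have "((\<lambda>z. (g z - g w) / (z - w)) \<longlongrightarrow> deriv g w) (at w)"
      using gd has_field_derivative_iff by blast
    then have "\<forall>\<^sub>F z in at w. (g z - g w) / (z - w) \<noteq> 0"
      using z[OF True] tendsto_imp_eventually_ne by blast
    then have "\<forall>\<^sub>F z in at w. g z \<noteq> 0" by (rule eventually_mono) (use True in auto)
    then obtain d where d: "d > 0" "\<And>z. z \<noteq> w \<Longrightarrow> dist z w < d \<Longrightarrow> g z \<noteq> 0"
      by (auto simp: eventually_at)
    have "((\<lambda>z. ((f z - f w) / (z - w)) / ((g z - g w) / (z - w))) \<longlongrightarrow> deriv f w / deriv g w) (at w)"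
      using fd gd z[OF True] has_field_derivative_iff by (intro tendsto_divide) blast+
    note 1 = this
    have lim: "(h \<longlongrightarrow> h w) (at w)"
    proof -
      have "\<forall>\<^sub>F z in at w. ((f z - f w) / (z - w)) / ((g z - g w) / (z - w)) = h z"
        unfolding eventually_at using d z[OF True] True by (intro exI[of _ d]) (auto simp: h_def)
      note * = tendsto_cong[OF this, THEN iffD1, OF 1]
      then show ?thesis using True by (subst h_def) simp
    qed
    have "h holomorphic_on ball w d"
    proof (rule no_isolated_singularity'[of "{w}"])
      show "(h \<longlongrightarrow> h z) (at z within ball w d)" if "z \<in> {w}" for z
        using lim that tendsto_within_subset by blast
      have "(\<lambda>z. f z / g z) holomorphic_on ball w d - {w}"
        using d f g by (intro holomorphic_intros) (auto simp: dist_commute intro: holomorphic_on_subset)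
      then show "h holomorphic_on ball w d - {w}"
        by (rule holomorphic_transform) (use d in \<open>auto simp: h_def dist_commute\<close>)
    qed auto
    then show ?thesis
      using d by (auto simp: holomorphic_on_open)
  qed
  then have "h holomorphic_on UNIV" by (auto simp: holomorphic_on_open)
  moreover have "f z = h z * g z" for z using z by (auto simp: h_def)
  ultimately show thesis by (rule that)
qed

text \<open>On the circle \<open>\<bar>z\<bar> = R\<close> the factor \<open>z\<^sup>2 - R\<^sup>2\<close> has modulus \<open>2 * R * \<bar>Im z\<bar>\<close>, so it cancels the singular
  bound on the real axis and the maximum principle applies.\<close>

lemma entire_zero_of_Im_bound:
  fixes f :: "complex \<Rightarrow> complex"
  assumes f: "f holomorphic_on UNIV" and C: "\<And>z. \<bar>Im z\<bar> * norm (f z) \<le> C"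
  shows "f z = 0"
proof (rule ccontr)
  assume nz: "f z \<noteq> 0"
  define d where "d = norm (f z)"
  have d: "d > 0" using nz by (simp add: d_def)
  have C0: "C \<ge> 0" using C[of 0] by simp
  \<comment> \<open>The maximum principle on this disc will give
    \<open>(R - norm z) * d \<le> 2 * C\<close>; the radius is chosen to violate this.\<close>
  define R where "R = norm z + 1 + 2 * C / d"
  have R: "R > norm z" "R > 0" "R - norm z > 2 * C / d"
    using C0 d by (auto simp: R_def add_pos_nonneg add_nonneg_pos)
  have "norm ((z\<^sup>2 - of_real (R\<^sup>2)) * f z) \<le> 2 * R * C"
  proof (rule maximum_modulus_frontier[of "\<lambda>z. (z\<^sup>2 - of_real (R\<^sup>2)) * f z" "cball 0 R"])
    show "(\<lambda>z. (z\<^sup>2 - of_real (R\<^sup>2)) * f z) holomorphic_on interior (cball 0 R)"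
      using f by (auto intro!: holomorphic_intros intro: holomorphic_on_subset)
    have "continuous_on UNIV f" using f by (rule holomorphic_on_imp_continuous_on)
    then show "continuous_on (closure (cball 0 R)) (\<lambda>z. (z\<^sup>2 - of_real (R\<^sup>2)) * f z)"
      by (auto intro!: continuous_intros intro: continuous_on_subset)
    fix w :: complex assume "w \<in> frontier (cball 0 R)"
    then have w: "norm w = R" using R by (simp add: frontier_cball)
    have "complex_of_real (R\<^sup>2) = w * cnj w" using complex_norm_square[of w] w by simp
    then have "w\<^sup>2 - of_real (R\<^sup>2) = w * (w - cnj w)" by (simp add: power2_eq_square algebra_simps)
    then have "norm (w\<^sup>2 - of_real (R\<^sup>2)) = R * (2 * \<bar>Im w\<bar>)"
      by (simp add: norm_mult w complex_diff_cnj)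
    then have "norm ((w\<^sup>2 - of_real (R\<^sup>2)) * f w) = 2 * R * (\<bar>Im w\<bar> * norm (f w))"
      by (simp add: norm_mult)
    also have "\<dots> \<le> 2 * R * C" using C[of w] R by (intro mult_left_mono) auto
    finally show "norm ((w\<^sup>2 - of_real (R\<^sup>2)) * f w) \<le> 2 * R * C" .
  qed (use R in auto)
  moreover have "norm (z\<^sup>2 - of_real (R\<^sup>2)) \<ge> R\<^sup>2 - (norm z)\<^sup>2"
    using norm_triangle_ineq3[of "of_real (R\<^sup>2)" "z\<^sup>2"] R(2) norm_minus_commute[of "of_real (R\<^sup>2)" "z\<^sup>2"]
    by (simp add: norm_power)
  ultimately have "(R\<^sup>2 - (norm z)\<^sup>2) * d \<le> 2 * R * C"
    using d by (simp add: norm_mult d_def) (meson dual_order.trans mult_right_mono norm_ge_zero)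
  moreover have "R\<^sup>2 - (norm z)\<^sup>2 = (R - norm z) * (R + norm z)" by (simp add: power2_eq_square algebra_simps)
  moreover have "(R - norm z) * (R + norm z) \<ge> (R - norm z) * R" using R by (intro mult_left_mono) auto
  ultimately have "(R - norm z) * R * d \<le> 2 * R * C" using d by (smt (verit) mult_right_mono)
  then have "(R - norm z) * d \<le> 2 * C" using R(2) by (simp add: mult_ac)
  then show False using R(3) d by (simp add: pos_divide_less_eq)
qed

section \<open>Completeness of the eigenfunctions\<close>

lemma Cauchy_Schwarz_integral:
  fixes f g :: "real \<Rightarrow> complex"
  assumes f: "continuous_on {a..b} f" and g: "continuous_on {a..b} g"
  shows "(norm (integral {a..b} (\<lambda>x. f x * g x)))\<^sup>2 \<le>
    integral {a..b} (\<lambda>x. (norm (f x))\<^sup>2) * integral {a..b} (\<lambda>x. (norm (g x))\<^sup>2)"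
proof -
  let ?A = "integral {a..b} (\<lambda>x. (norm (f x))\<^sup>2)" and ?B = "integral {a..b} (\<lambda>x. (norm (g x))\<^sup>2)"
  let ?C = "integral {a..b} (\<lambda>x. norm (f x) * norm (g x))"
  have i: "(\<lambda>x. (norm (f x))\<^sup>2) integrable_on {a..b}" "(\<lambda>x. (norm (g x))\<^sup>2) integrable_on {a..b}"
    "(\<lambda>x. norm (f x) * norm (g x)) integrable_on {a..b}" "(\<lambda>x. f x * g x) integrable_on {a..b}"
    by (intro integrable_continuous_interval continuous_intros f g)+
  have 1: "norm (integral {a..b} (\<lambda>x. f x * g x)) \<le> ?C"
    by (rule integral_norm_bound_integral) (use i in \<open>auto simp: norm_mult\<close>)
  have 2: "?A - 2 * s * ?C + s\<^sup>2 * ?B \<ge> 0" for s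
  proof -
    have "0 \<le> integral {a..b} (\<lambda>x. (norm (f x) - s * norm (g x))\<^sup>2)"
      by (intro integral_nonneg integrable_continuous_interval continuous_intros f g) auto
    also have "(\<lambda>x. (norm (f x) - s * norm (g x))\<^sup>2) =
        (\<lambda>x. (norm (f x))\<^sup>2 - (2 * s) * (norm (f x) * norm (g x)) + s\<^sup>2 * (norm (g x))\<^sup>2)"
      by (auto simp: power2_eq_square algebra_simps)
    also have "integral {a..b} \<dots> = ?A - 2 * s * ?C + s\<^sup>2 * ?B"
      by (intro integral_unique has_integral_add has_integral_diff has_integral_mult_right integrable_integral i)
    finally show ?thesis .
  qed
  have B0: "?B \<ge> 0" and A0: "?A \<ge> 0" using i by (auto intro!: integral_nonneg)
  have C0: "?C \<ge> 0" using i by (auto intro!: integral_nonneg)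
  have "?C\<^sup>2 \<le> ?A * ?B"
  proof (cases "?B = 0")
    case True
    have "?C = 0"
    proof (rule ccontr)
      assume "?C \<noteq> 0"
      \<comment> \<open>With \<open>?B = 0\<close> the expression is linear in \<open>s\<close>, and
        this \<open>s\<close> gives it the value \<open>- 1\<close>.\<close>
      then show False using 2[of "(?A + 1) / (2 * ?C)"] True by simp
    qed
    then show ?thesis using True by simp
  next
    case False
    then have B: "?B > 0" using B0 by simp
    have "?A - 2 * (?C / ?B) * ?C + (?C / ?B)\<^sup>2 * ?B = ?A - ?C\<^sup>2 / ?B"
      using B by (simp add: power2_eq_square field_simps)
    then have "?C\<^sup>2 / ?B \<le> ?A" using 2[of "?C / ?B"] by linarith
    then show ?thesis using B by (simp add: pos_divide_le_eq)
  qed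
  moreover have "(norm (integral {a..b} (\<lambda>x. f x * g x)))\<^sup>2 \<le> ?C\<^sup>2"
    using 1 by (intro power_mono) auto
  ultimately show ?thesis by linarith
qed

text \<open>The resolvent applied to \<open>f\<close> has poles at the eigenvalues;
  \<open>U l\<close> is its multiple by \<open>disc q ev l\<close>, which is entire in
  \<open>l\<close>, and \<open>N l\<close> pairs \<open>U l\<close> with \<open>f\<close>.
  Orthogonality makes \<open>N\<close> vanish at the zeros of \<open>disc\<close>, so that
  \<open>N / disc\<close> is entire and the bound by \<open>1 / \<bar>Im l\<bar>\<close> annihilates
  it.\<close>

lemma mathieu_complete:
  fixes f :: "real \<Rightarrow> real"
  assumes cont: "continuous_on {0..pi} f"
    and orth: "\<And>l::real. disc q ev (of_real l) = 0 \<Longrightarrow>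
      integral {0..pi} (\<lambda>x. of_real (f x) * mathieu_fund q ev (of_real l) (of_real x)) = 0"
    and x: "x \<in> {0..pi}"
  shows "f x = 0"
proof -
  define ph where "ph l x = mathieu_fund q ev l (of_real x)" for l and x :: real
  define ph' where "ph' l x = mathieu_fund' q ev l (of_real x)" for l and x :: real
  \<comment> \<open>The potential is symmetric about \<open>pi / 2\<close>, so reflecting
    \<open>ph\<close> gives the solution that satisfies the boundary condition at
    \<open>pi\<close>.\<close>
  define ps where "ps l x = mathieu_fund q ev l (- of_real x + of_real pi)" for l and x :: real
  define ps' where "ps' l x = - mathieu_fund' q ev l (- of_real x + of_real pi)" for l and x :: real
  define A where "A l x = integral {0..x} (\<lambda>t. ph l t * of_real (f t))" for l x
  define A2 where "A2 l x = integral {0..x} (\<lambda>t. ps l t * of_real (f t))" for l x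
  \<comment> \<open>Green's function applied to \<open>f\<close>, without its denominator, which up
    to sign is the Wronskian of \<open>ph\<close> and \<open>ps\<close>.\<close>
  define U where "U l x = ps l x * A l x + ph l x * (A2 l pi - A2 l x)" for l x
  define U' where "U' l x = ps' l x * A l x + ph' l x * (A2 l pi - A2 l x)" for l x
  define N where "N l = integral {0..pi} (\<lambda>x. of_real (f x) * U l x)" for l
  let ?V = "\<lambda>x. 2 * complex_of_real q * cos (2 * complex_of_real x)"

  have dph: "(ph l has_vector_derivative ph' l x) (at x within S)"
    "(ph' l has_vector_derivative (?V x - l) * ph l x) (at x within S)" for l x S
    unfolding ph_def ph'_def by (rule has_vector_derivative_real_field derivative_intros)+
  have 1: "mathieu_sol q l (\<lambda>z. mathieu_fund q ev l (- z + of_real pi))"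
    "deriv (\<lambda>z. mathieu_fund q ev l (- z + of_real pi)) = (\<lambda>z. - mathieu_fund' q ev l (- z + of_real pi))" for l
    using mathieu_sol_neg[OF mathieu_sol_shift(1)[OF mathieu_sol_fund[of q l ev]]]
    by (simp_all add: mathieu_sol_shift(2)[OF mathieu_sol_fund] deriv_mathieu_fund)
  have dps: "(ps l has_vector_derivative ps' l x) (at x within S)"
    "(ps' l has_vector_derivative (?V x - l) * ps l x) (at x within S)" for l x S
    unfolding ps_def ps'_def
    using has_vector_derivative_real_field[OF mathieu_solD(1)[OF 1(1)]]
      has_vector_derivative_real_field[OF mathieu_solD(2)[OF 1(1)]] unfolding 1(2) by auto
  have W: "ph l x * ps' l x - ph' l x * ps l x = - disc q ev l" for l x
    using wronskian_const[OF mathieu_sol_fund[of q l ev] 1(1), where z = "of_real x" and w = 0]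
    unfolding wronskian_def 1(2) deriv_mathieu_fund
    by (auto simp: ph_def ps_def ph'_def ps'_def disc_def mathieu_fund_0)
  have cph: "continuous_on S (ph l)" "continuous_on S (ps l)" "continuous_on S (ph' l)" "continuous_on S (ps' l)" for l S
    unfolding ph_def ps_def ph'_def ps'_def by (intro continuous_intros)+
  have c2: "continuous_on (UNIV \<times> S) (\<lambda>(l, x). ph l x)" "continuous_on (UNIV \<times> S) (\<lambda>(l, x). ps l x)" for S
    unfolding ph_def ps_def split_beta by (intro continuous_intros)+
  have cf: "continuous_on (UNIV \<times> {0..pi}) (\<lambda>p::complex \<times> real. complex_of_real (f (snd p)))"
    by (intro continuous_on_of_real continuous_on_compose2[OF cont] continuous_intros) auto
  have cA: "continuous_on (UNIV \<times> {0..pi}) (\<lambda>p. A (fst p) (snd p))"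
    "continuous_on (UNIV \<times> {0..pi}) (\<lambda>p. A2 (fst p) (snd p))"
    unfolding A_def A2_def
    by (rule continuous_indefinite_integral_param[unfolded split_beta],
        intro continuous_on_mult cf c2[unfolded split_beta])+
  have cA2: "continuous_on (UNIV \<times> {0..pi}) (\<lambda>p::complex \<times> real. A2 (fst p) pi)"
  proof -
    have "continuous_on (UNIV \<times> {0..pi}) (\<lambda>p::complex \<times> real. (fst p, pi))"
      by (intro continuous_intros)
    moreover have "(\<lambda>p::complex \<times> real. (fst p, pi)) ` (UNIV \<times> {0..pi}) \<subseteq> UNIV \<times> {0..pi}" by auto
    ultimately have "continuous_on (UNIV \<times> {0..pi})
        (\<lambda>p::complex \<times> real. A2 (fst (fst p, pi)) (snd (fst p, pi)))"
      by (rule continuous_on_compose2[OF cA(2)])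
    then show ?thesis by simp
  qed
  have cU: "continuous_on (UNIV \<times> {0..pi}) (\<lambda>p. U (fst p) (snd p))"
    using c2 cA cA2 unfolding U_def split_beta by (intro continuous_intros) auto
  have hA: "(\<lambda>l. A l x) holomorphic_on UNIV" "(\<lambda>l. A2 l x) holomorphic_on UNIV" if "x \<in> {0..pi}" for x
  proof -
    have s: "(UNIV :: complex set) \<times> {0..x} \<subseteq> UNIV \<times> {0..pi}" using that by auto
    show "(\<lambda>l. A l x) holomorphic_on UNIV" "(\<lambda>l. A2 l x) holomorphic_on UNIV"
      unfolding A_def A2_def
      by (rule holomorphic_integral_param, unfold split_beta,
          intro continuous_on_mult continuous_on_subset[OF cf s] c2[unfolded split_beta],
          intro holomorphic_intros, simp add: ph_def ps_def holomorphic_mathieu_fund_param)+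
  qed
  have hN: "N holomorphic_on UNIV"
  proof -
    have "(\<lambda>l. integral {0..pi} (\<lambda>x. of_real (f x) * U l x)) holomorphic_on UNIV"
    proof (rule holomorphic_integral_param)
      show "continuous_on (UNIV \<times> {0..pi}) (\<lambda>(l, x). of_real (f x) * U l x)"
        unfolding split_beta by (intro continuous_on_mult cf cU)
      show "(\<lambda>l. of_real (f x) * U l x) holomorphic_on UNIV" if "x \<in> {0..pi}" for x
        unfolding U_def using that
        by (intro holomorphic_intros hA) (auto simp: ph_def ps_def holomorphic_mathieu_fund_param)
    qed
    then show ?thesis by (simp add: N_def[abs_def])
  qed
  have cfr: "continuous_on {0..pi} (\<lambda>x. complex_of_real (f x))" by (intro continuous_intros cont)
  have dA: "(A l has_vector_derivative ph l x * of_real (f x)) (at x within {0..pi})"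
      "(A2 l has_vector_derivative ps l x * of_real (f x)) (at x within {0..pi})" if "x \<in> {0..pi}" for l x
    unfolding A_def A2_def using that
    by (intro integral_has_vector_derivative continuous_on_mult cph cfr; simp)+
  have dU: "(U l has_vector_derivative U' l x) (at x within {0..pi})" if "x \<in> {0..pi}" for l x
  proof -
    have "(U l has_vector_derivative (ps l x * (ph l x * of_real (f x)) + ps' l x * A l x) +
      (ph l x * (0 - ps l x * of_real (f x)) + ph' l x * (A2 l pi - A2 l x))) (at x within {0..pi})"
      unfolding U_def
      by (intro has_vector_derivative_add has_vector_derivative_mult has_vector_derivative_diff dph dps dA that has_vector_derivative_const)
    then show ?thesis by (simp add: U'_def)
  qed
  have dU': "(U' l has_vector_derivative (?V x - l) * U l x - disc q ev l * of_real (f x)) (at x within {0..pi})"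
    if "x \<in> {0..pi}" for l x
  proof -
    have "(U' l has_vector_derivative (ps' l x * (ph l x * of_real (f x)) + ((?V x - l) * ps l x) * A l x) +
      (ph' l x * (0 - ps l x * of_real (f x)) + ((?V x - l) * ph l x) * (A2 l pi - A2 l x))) (at x within {0..pi})"
      unfolding U'_def
      by (intro has_vector_derivative_add has_vector_derivative_mult has_vector_derivative_diff dph dps dA that has_vector_derivative_const)
    moreover have "(ps' l x * (ph l x * of_real (f x)) + ((?V x - l) * ps l x) * A l x) +
      (ph' l x * (0 - ps l x * of_real (f x)) + ((?V x - l) * ph l x) * (A2 l pi - A2 l x)) =
      (?V x - l) * U l x + (ph l x * ps' l x - ph' l x * ps l x) * of_real (f x)"
      unfolding U_def by (simp add: algebra_simps)
    ultimately show ?thesis unfolding W by simp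
  qed
  have cU1: "continuous_on {0..pi} (U l)" for l
    using dU has_vector_derivative_continuous continuous_on_eq_continuous_within by blast
  \<comment> \<open>\<open>U l\<close> satisfies the Neumann or Dirichlet condition at both ends, so
    one factor of each product vanishes.\<close>
  have bc: "U' l 0 * cnj (U l 0) = 0" "U l 0 * cnj (U' l 0) = 0" "U' l pi * cnj (U l pi) = 0" "U l pi * cnj (U' l pi) = 0" for l
    by (cases ev; simp add: U_def U'_def ph_def ph'_def ps_def ps'_def mathieu_fund_0 A_def A2_def)+
  \<comment> \<open>Green's identity for \<open>U l\<close> and its conjugate: the real potential
    cancels, and only the spectral parameter and the source \<open>disc q ev l * f\<close>
    remain.\<close>
  have key: "Im l * integral {0..pi} (\<lambda>x. (norm (U l x))\<^sup>2) = Im (cnj (disc q ev l) * N l)" for l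
  proof -
    let ?D = "\<lambda>x. U' l x * cnj (U l x) - U l x * cnj (U' l x)"
    let ?g = "\<lambda>x. (cnj l - l) * of_real ((norm (U l x))\<^sup>2) + cnj (disc q ev l) * (of_real (f x) * U l x)
         - disc q ev l * cnj (of_real (f x) * U l x)"
    have "(?D has_vector_derivative ?g x) (at x within {0..pi})" if "x \<in> {0..pi}" for x
    proof -
      have *: "(?D has_vector_derivative (U' l x * cnj (U' l x) + ((?V x - l) * U l x - disc q ev l * of_real (f x)) * cnj (U l x)) -
         (U l x * cnj ((?V x - l) * U l x - disc q ev l * of_real (f x)) + U' l x * cnj (U' l x))) (at x within {0..pi})"
        by (intro has_vector_derivative_diff has_vector_derivative_mult has_vector_derivative_cnj dU dU' that)
      have v: "cnj (?V x) = ?V x"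
      proof -
        have "?V x = of_real (2 * q * cos (2 * x))"
          by (simp add: cos_of_real[symmetric] del: cos_of_real)
        then show ?thesis by (simp only: complex_cnj_complex_of_real)
      qed
      have c: "cnj ((?V x - l) * U l x - disc q ev l * of_real (f x)) =
          (?V x - cnj l) * cnj (U l x) - cnj (disc q ev l) * of_real (f x)"
        by (simp only: complex_cnj_diff complex_cnj_mult[of _ "U l x"] complex_cnj_mult[of "disc q ev l"] v complex_cnj_complex_of_real)
      have "(U' l x * cnj (U' l x) + ((?V x - l) * U l x - disc q ev l * of_real (f x)) * cnj (U l x)) -
         (U l x * cnj ((?V x - l) * U l x - disc q ev l * of_real (f x)) + U' l x * cnj (U' l x)) = ?g x"
        unfolding c complex_norm_square by (simp add: algebra_simps)
      with * show ?thesis by simp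
    qed
    then have "(?g has_integral (?D pi - ?D 0)) {0..pi}"
      by (intro fundamental_theorem_of_calculus) auto
    then have "0 = integral {0..pi} ?g" by (simp add: bc integral_unique)
    also have "\<dots> = (cnj l - l) * of_real (integral {0..pi} (\<lambda>x. (norm (U l x))\<^sup>2)) + cnj (disc q ev l) * N l
        - disc q ev l * cnj (N l)"
    proof -
      have i: "(\<lambda>x. complex_of_real ((norm (U l x))\<^sup>2)) integrable_on {0..pi}"
        "(\<lambda>x. of_real (f x) * U l x) integrable_on {0..pi}"
        by (intro integrable_continuous_interval continuous_intros cU1 cfr)+
      have e: "integral {0..pi} (\<lambda>x. complex_of_real ((norm (U l x))\<^sup>2)) = of_real (integral {0..pi} (\<lambda>x. (norm (U l x))\<^sup>2))"
        by (intro integral_of_real_cont continuous_intros cU1)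
      have "((\<lambda>x. of_real (f x) * U l x) has_integral N l) {0..pi}"
        unfolding N_def using i(2) by (rule integrable_integral)
      from has_integral_linear[OF this bounded_linear_cnj]
      have c: "((\<lambda>x. cnj (of_real (f x) * U l x)) has_integral cnj (N l)) {0..pi}" by (simp add: o_def)
      have "(?g has_integral ((cnj l - l) * of_real (integral {0..pi} (\<lambda>x. (norm (U l x))\<^sup>2)) + cnj (disc q ev l) * N l
        - disc q ev l * cnj (N l))) {0..pi}"
        unfolding N_def e[symmetric] using c i unfolding N_def
        by (intro has_integral_diff has_integral_add has_integral_mult_right integrable_integral) auto
      then show ?thesis by (rule integral_unique)
    qed
    finally have "0 = (cnj l - l) * of_real (integral {0..pi} (\<lambda>x. (norm (U l x))\<^sup>2)) + cnj (disc q ev l) * N l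
        - disc q ev l * cnj (N l)" .
    from arg_cong[OF this, of Im] show ?thesis by (simp add: algebra_simps)
  qed
  define F2 where "F2 = integral {0..pi} (\<lambda>x. (norm (complex_of_real (f x)))\<^sup>2)"
  have F2: "F2 \<ge> 0" unfolding F2_def by (intro integral_nonneg integrable_continuous_interval continuous_intros cfr) auto
  \<comment> \<open>Cauchy-Schwarz bounds the square of \<open>norm (N l)\<close> by
    \<open>F2\<close> times the squared norm of \<open>U l\<close>; after inserting
    \<open>key\<close> one factor \<open>norm (N l)\<close> cancels.\<close>
  have bound: "\<bar>Im l\<bar> * norm (N l) \<le> F2 * norm (disc q ev l)" for l
  proof (cases "N l = 0")
    case False
    have "\<bar>Im l\<bar> * (norm (N l))\<^sup>2 \<le> \<bar>Im l\<bar> * (F2 * integral {0..pi} (\<lambda>x. (norm (U l x))\<^sup>2))"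
      unfolding F2_def N_def by (intro mult_left_mono Cauchy_Schwarz_integral cfr cU1) auto
    also have "\<dots> = F2 * \<bar>Im l * integral {0..pi} (\<lambda>x. (norm (U l x))\<^sup>2)\<bar>"
    proof -
      have "integral {0..pi} (\<lambda>x. (norm (U l x))\<^sup>2) \<ge> 0"
        by (intro integral_nonneg integrable_continuous_interval continuous_intros cU1) auto
      then show ?thesis by (simp add: abs_mult)
    qed
    also have "\<dots> \<le> F2 * norm (cnj (disc q ev l) * N l)"
      unfolding key by (intro mult_left_mono abs_Im_le_cmod F2)
    finally have "(\<bar>Im l\<bar> * norm (N l)) * norm (N l) \<le> (F2 * norm (disc q ev l)) * norm (N l)"
      by (simp add: power2_eq_square norm_mult mult_ac)
    then show ?thesis using False by simp
  qed (simp add: F2)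
  \<comment> \<open>At a zero of \<open>disc\<close> the two boundary solutions are proportional, so
    the two terms of \<open>U\<close> combine to a multiple of the total Fourier coefficient
    \<open>A l pi\<close>, which is \<open>0\<close>.\<close>
  have zero: "N l = 0 \<and> deriv (disc q ev) l \<noteq> 0" if d: "disc q ev l = 0" for l
  proof -
    obtain r where r: "l = of_real r" using disc_zero_real[OF d] by (auto elim: Reals_cases)
    have k0: "codisc q ev l \<noteq> 0" using disc_zero(2)[OF d] by auto
    have "ps l x = par ev * codisc q ev l * ph l x" for x
      using disc_zero(1)[OF d, of "- of_real x"] by (simp add: ps_def ph_def mathieu_fund_par)
    then have ps: "ps l = (\<lambda>x. par ev * codisc q ev l * ph l x)" by auto
    have "A l pi = 0" using orth[of r] d by (simp add: A_def ph_def r mult.commute)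
    moreover have "A2 l x = par ev * codisc q ev l * A l x" for x
      unfolding A2_def A_def ps by (simp only: mult.assoc integral_mult_right)
    ultimately have "U l x = 0" for x by (simp add: U_def ps)
    then have "N l = 0" by (simp add: N_def)
    moreover have "deriv (disc q ev) l \<noteq> 0"
      using DERIV_imp_deriv[OF disc_has_deriv[of q ev r]] d k0 mathieu_fund_norm_pos[of q ev "of_real r"]
      by (simp add: r less_le)
    ultimately show ?thesis by blast
  qed
  obtain h where h: "h holomorphic_on UNIV" "\<And>z. N z = h z * disc q ev z"
    using entire_quotient[OF hN holomorphic_disc zero] by metis
  have "h z = 0" for z
  proof (rule entire_zero_of_Im_bound[OF h(1)])
    fix z
    show "\<bar>Im z\<bar> * norm (h z) \<le> F2"
    proof (cases "disc q ev z = 0")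
      case True
      then have "Im z = 0" using disc_zero_real by (auto simp: complex_is_Real_iff)
      then show ?thesis using F2 by simp
    next
      case False
      then show ?thesis using bound[of z] by (simp add: h(2) norm_mult)
    qed
  qed
  \<comment> \<open>At the nonreal point \<open>\<i>\<close> the norm identity turns
    \<open>N = 0\<close> into \<open>U = 0\<close>; the differential equation for \<open>U\<close>
    then leaves \<open>disc q ev \<i> * f x = 0\<close>.\<close>
  then have "N \<i> = 0" by (simp add: h)
  then have "integral {0..pi} (\<lambda>x. (norm (U \<i> x))\<^sup>2) = 0" using key[of \<i>] by simp
  moreover have "continuous_on {0..pi} (\<lambda>x. (norm (U \<i> x))\<^sup>2)" by (intro continuous_intros cU1)
  ultimately have U0: "U \<i> y = 0" if "y \<in> {0..pi}" for y
    using integral_eq_0_iff[of 0 pi "\<lambda>x. (norm (U \<i> x))\<^sup>2"] that by auto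
  have U'0: "U' \<i> y = 0" if y: "y \<in> {0..pi}" for y
  proof (rule vector_derivative_unique_within_closed_interval[of 0 pi y "U \<i>"])
    show "(U \<i> has_vector_derivative 0) (at y within cbox 0 pi)"
      by (rule has_vector_derivative_transform[where f = "\<lambda>_. 0"]) (use y U0 in auto)
  qed (use y dU in auto)
  have "(?V x - \<i>) * U \<i> x - disc q ev \<i> * of_real (f x) = 0"
  proof (rule vector_derivative_unique_within_closed_interval[of 0 pi x "U' \<i>"])
    show "(U' \<i> has_vector_derivative 0) (at x within cbox 0 pi)"
      by (rule has_vector_derivative_transform[where f = "\<lambda>_. 0"]) (use x U'0 in auto)
  qed (use x dU' in auto)
  moreover have "disc q ev \<i> \<noteq> 0" using disc_zero_real[of q ev \<i>] by (auto simp: complex_is_Real_iff)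
  ultimately show ?thesis using U0[OF x] by simp
qed

section \<open>Enumeration and parity of the eigenvalues\<close>

definition mathieu_eigs :: "real \<Rightarrow> bool \<Rightarrow> real set" where
  "mathieu_eigs q ev = {l. disc q ev (of_real l) = 0}"

text \<open>Periodicity equates the boundary values at \<open>- pi\<close> and \<open>pi\<close>,
  and parity makes them opposite: those of the derivative in the even case, those of the function in
  the odd case.\<close>

lemma mathieu_eig_periodic_imp:
  assumes "\<And>z. mathieu_fund q ev l (z + 2 * of_real pi) = mathieu_fund q ev l z"
  shows "disc q ev l = 0"
proof (cases ev)
  case True
  have "((\<lambda>z. mathieu_fund q ev l (z + 2 * of_real pi)) has_field_derivative
      mathieu_fund' q ev l (- of_real pi + 2 * of_real pi)) (at (- of_real pi))"
    using has_deriv_mathieu_fund[of q ev l "- of_real pi + 2 * of_real pi" UNIV] unfolding DERIV_shift .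
  then have "mathieu_fund' q ev l (- of_real pi + 2 * of_real pi) = mathieu_fund' q ev l (- of_real pi)"
    unfolding assms using has_deriv_mathieu_fund DERIV_unique by blast
  then show ?thesis using True by (simp add: disc_def mathieu_fund_par par_def)
next
  case False
  have "mathieu_fund q ev l (- of_real pi + 2 * of_real pi) = mathieu_fund q ev l (- of_real pi)"
    by (rule assms)
  then show ?thesis using False by (simp add: disc_def mathieu_fund_par par_def)
qed

lemma mathieu_fund_nonzero: "\<exists>x::real. mathieu_fund q ev l (of_real x) \<noteq> 0"
proof (rule ccontr)
  assume "\<nexists>x::real. mathieu_fund q ev l (of_real x) \<noteq> 0"
  then show False using mathieu_fund_norm_pos[of q ev l] by simp
qed

lemma mathieu_fund_two_pi:
  assumes "disc q ev l = 0"
  shows "mathieu_fund q ev l (z + 2 * of_real pi) = mathieu_fund q ev l z"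
  using disc_zero(1)[OF assms, of "z + of_real pi"] disc_zero(1)[OF assms, of z] disc_zero(2)[OF assms]
  by (simp add: power2_eq_square mult.assoc[symmetric] add.assoc)

lemma eigenvalues_eq:
  "even_eigenvalues q = mathieu_eigs q True" "odd_eigenvalues q = mathieu_eigs q False"
proof -
  have *: "(\<exists>u. mathieu_solution q l u \<and> (\<forall>z. u (- z) = par ev * u z) \<and> two_pi_periodic u \<and> (\<exists>z. u z \<noteq> 0)) \<longleftrightarrow>
      l \<in> mathieu_eigs q ev" for ev l
  proof
    assume "\<exists>u. mathieu_solution q l u \<and> (\<forall>z. u (- z) = par ev * u z) \<and> two_pi_periodic u \<and> (\<exists>z. u z \<noteq> 0)"
    then obtain u z0 where u: "mathieu_sol q (of_real l) u" "\<And>z. u (- z) = par ev * u z" "two_pi_periodic u" "u z0 \<noteq> 0"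
      unfolding mathieu_solution_iff by blast
    obtain c where c: "\<And>z. u z = c * mathieu_fund q ev (of_real l) z"
      using mathieu_sol_par[OF u(1,2)] by blast
    then have "c \<noteq> 0" using u(4) by auto
    then have "disc q ev (of_real l) = 0"
      using u(3) unfolding two_pi_periodic_def c by (intro mathieu_eig_periodic_imp) simp
    then show "l \<in> mathieu_eigs q ev" by (simp add: mathieu_eigs_def)
  next
    assume "l \<in> mathieu_eigs q ev"
    then have d: "disc q ev (of_real l) = 0" by (simp add: mathieu_eigs_def)
    show "\<exists>u. mathieu_solution q l u \<and> (\<forall>z. u (- z) = par ev * u z) \<and> two_pi_periodic u \<and> (\<exists>z. u z \<noteq> 0)"
      using mathieu_fund_nonzero[of q ev "of_real l"]
      by (intro exI[of _ "mathieu_fund q ev (of_real l)"])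
         (auto simp: mathieu_solution_iff mathieu_sol_fund mathieu_fund_par two_pi_periodic_def mathieu_fund_two_pi[OF d])
  qed
  show "even_eigenvalues q = mathieu_eigs q True" "odd_eigenvalues q = mathieu_eigs q False"
    using *[of _ True] *[of _ False]
    by (auto simp: even_eigenvalues_def odd_eigenvalues_def even_function_def odd_function_def par_def)
qed

section \<open>Real form of the eigenfunctions on half a period\<close>

definition rfund :: "real \<Rightarrow> bool \<Rightarrow> real \<Rightarrow> real \<Rightarrow> real" where
  "rfund q ev l x = Re (mathieu_fund q ev (of_real l) (of_real x))"

definition rfund' :: "real \<Rightarrow> bool \<Rightarrow> real \<Rightarrow> real \<Rightarrow> real" where
  "rfund' q ev l x = Re (mathieu_fund' q ev (of_real l) (of_real x))"

lemma of_real_rfund: "mathieu_fund q ev (of_real l) (of_real x) = of_real (rfund q ev l x)"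
  "mathieu_fund' q ev (of_real l) (of_real x) = of_real (rfund' q ev l x)"
  using mathieu_fund_real[of q ev l x] by (simp_all add: rfund_def rfund'_def)

lemma DERIV_Re_of_real:
  assumes "(f has_field_derivative D) (at (of_real x))"
  shows "((\<lambda>x. Re (f (of_real x))) has_real_derivative Re D) (at x)"
  using bounded_linear.has_vector_derivative[OF bounded_linear_Re has_vector_derivative_real_field[OF assms]]
  by (simp add: has_real_derivative_iff_has_vector_derivative)

lemma DERIV_rfund:
  "(rfund q ev l has_real_derivative rfund' q ev l x) (at x)"
  "(rfund' q ev l has_real_derivative (2 * q * cos (2 * x) - l) * rfund q ev l x) (at x)"
proof -
  show "(rfund q ev l has_real_derivative rfund' q ev l x) (at x)"
    unfolding rfund_def rfund'_def by (intro DERIV_Re_of_real has_deriv_mathieu_fund)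
  have "((\<lambda>x. rfund' q ev l x) has_real_derivative
     Re ((2 * of_real q * cos (2 * of_real x) - of_real l) * mathieu_fund q ev (of_real l) (of_real x))) (at x)"
    unfolding rfund'_def by (intro DERIV_Re_of_real has_deriv_mathieu_fund')
  moreover have "2 * of_real q * cos (2 * complex_of_real x) - of_real l = of_real (2 * q * cos (2 * x) - l)"
    by (simp add: cos_of_real[symmetric] del: cos_of_real)
  ultimately show "(rfund' q ev l has_real_derivative (2 * q * cos (2 * x) - l) * rfund q ev l x) (at x)"
    by (simp only: of_real_rfund of_real_mult[symmetric] Re_complex_of_real)
qed

lemma continuous_rfund [continuous_intros]: "continuous_on S (rfund q ev l)"
  "continuous_on S (rfund' q ev l)"
  by (intro continuous_at_imp_continuous_on ballI DERIV_isCont[OF DERIV_rfund(1)] DERIV_isCont[OF DERIV_rfund(2)])+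

text \<open>Below the spectrum the potential is positive, and the product of the solution with its
  derivative increases from \<open>0\<close>, so neither factor can change sign.\<close>

lemma disc_pos:
  assumes l: "l < - 2 * \<bar>q\<bar>"
  shows "Re (disc q ev (of_real l)) > 0"
proof -
  let ?y = "rfund q ev l" and ?y' = "rfund' q ev l"
  define P where "P x = ?y x * ?y' x" for x
  \<comment> \<open>\<open>w\<close> is the factor of \<open>P\<close> that starts at
    \<open>1\<close>; the other factor, taken at \<open>pi\<close>, is \<open>disc\<close>.\<close>
  define w where "w x = (if ev then ?y x else ?y' x)" for x
  have g: "2 * q * cos (2 * x) - l > 0" for x
  proof -
    have "\<bar>2 * q * cos (2 * x)\<bar> \<le> 2 * \<bar>q\<bar>"
      using mult_left_mono[OF abs_cos_le_one[of "2 * x"], of "2 * \<bar>q\<bar>"] by (simp add: abs_mult)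
    then show ?thesis using l by linarith
  qed
  have init: "?y 0 = (if ev then 1 else 0)" "?y' 0 = (if ev then 0 else 1)"
    using mathieu_fund_0[of q ev "of_real l"] by (auto simp: rfund_def rfund'_def)
  have dP: "(P has_real_derivative (?y' x)\<^sup>2 + (2 * q * cos (2 * x) - l) * (?y x)\<^sup>2) (at x)" for x
    unfolding P_def by (rule derivative_eq_intros DERIV_rfund refl)+ (simp add: power2_eq_square)
  have mono: "P x \<le> P y" if "x \<le> y" for x y
    using that
  proof (rule DERIV_nonneg_imp_nondecreasing)
    fix t
    show "\<exists>D. (P has_real_derivative D) (at t) \<and> 0 \<le> D"
      using dP[of t] g[of t]
      by (intro exI[of _ "(?y' t)\<^sup>2 + (2 * q * cos (2 * t) - l) * (?y t)\<^sup>2"]) auto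
  qed
  have pos: "P x > 0" if x: "x > 0" for x
  proof -
    have "(?y' 0)\<^sup>2 + (2 * q * cos (2 * 0) - l) * (?y 0)\<^sup>2 > 0" using g[of 0] init by simp
    from DERIV_pos_inc_right[OF dP this] obtain d where d: "d > 0" "\<And>h. h > 0 \<Longrightarrow> h < d \<Longrightarrow> P 0 < P (0 + h)"
      by blast
    have "P 0 < P (min (d / 2) x)" using d(2)[of "min (d / 2) x"] d(1) x by (auto simp: min_def)
    also have "\<dots> \<le> P x" by (rule mono) simp
    finally show ?thesis by (simp add: P_def init split: if_splits)
  qed
  have cw: "continuous_on {0..pi} w"
  proof -
    show ?thesis unfolding w_def[abs_def] by (cases ev) (auto intro: continuous_rfund)
  qed
  have w0: "w 0 = 1" unfolding w_def init by simp
  have wne: "w x \<noteq> 0" if "x \<in> {0..pi}" for x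
  proof (cases "x = 0")
    case False
    then show ?thesis using pos[of x] that by (auto simp: w_def P_def)
  qed (use w0 in simp)
  have "w pi > 0"
  proof (rule ccontr)
    assume "\<not> w pi > 0"
    then have "\<exists>x\<ge>0. x \<le> pi \<and> w x = 0"
      using IVT2'[of w pi 0 0] cw w0 by auto
    then show False using wne by auto
  qed
  moreover have "P pi = w pi * Re (disc q ev (of_real l))"
    by (simp add: P_def w_def disc_def rfund_def rfund'_def)
  ultimately show ?thesis using pos[of pi] by (simp add: zero_less_mult_iff)
qed

lemma mathieu_eigs_finite: "finite {l \<in> mathieu_eigs q ev. l \<le> c}"
proof -
  define R where "R = \<bar>c\<bar> + 2 * \<bar>q\<bar>"
  have "finite {z \<in> cball 0 R. disc q ev z = 0}"
  proof (rule holomorphic_compact_finite_zeros[of "disc q ev" UNIV])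
    show "\<not> disc q ev constant_on UNIV"
    proof
      assume "disc q ev constant_on UNIV"
      then obtain k where k: "\<And>z. disc q ev z = k" by (auto simp: constant_on_def)
      have nz: "k \<noteq> 0" using disc_zero_real[of q ev \<i>] k by (auto simp: complex_is_Real_iff)
      \<comment> \<open>A nonzero constant \<open>disc\<close> would mean that there are no
        eigenvalues at all, so completeness would apply to the constant function
        \<open>1\<close>.\<close>
      have "1 = (0::real)"
        using mathieu_complete[of "\<lambda>_. 1" q ev 0] nz k by simp
      then show False by simp
    qed
  qed (auto simp: holomorphic_disc)
  then have "finite (of_real -` {z \<in> cball 0 R. disc q ev z = 0} :: real set)"
    by (rule finite_vimageI) (auto simp: inj_def)
  moreover have "{l \<in> mathieu_eigs q ev. l \<le> c} \<subseteq> of_real -` {z \<in> cball 0 R. disc q ev z = 0}"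
  proof (clarsimp simp: mathieu_eigs_def)
    fix l assume "disc q ev (of_real l) = 0" "l \<le> c"
    then show "\<bar>l\<bar> \<le> R" using disc_pos[of l q ev] unfolding R_def by fastforce
  qed
  ultimately show ?thesis using finite_subset by blast
qed

lemma rfund_orthogonal:
  assumes "l \<in> mathieu_eigs q ev" "m \<in> mathieu_eigs q ev" "l \<noteq> m"
  shows "integral {0..pi} (\<lambda>x. rfund q ev l x * rfund q ev m x) = 0"
proof -
  have "complex_of_real (integral {0..pi} (\<lambda>x. rfund q ev l x * rfund q ev m x)) =
      integral {0..pi} (\<lambda>x. mathieu_fund q ev (of_real l) (of_real x) * mathieu_fund q ev (of_real m) (of_real x))"
    by (subst integral_of_real_cont[symmetric]) (auto simp: of_real_rfund intro!: continuous_intros)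
  also have "\<dots> = 0" using disc_lagrange[of q ev "of_real l" "of_real m"] assms by (simp add: mathieu_eigs_def)
  finally show ?thesis by simp
qed

lemma rfund_complete:
  assumes "continuous_on {0..pi} f" "\<And>l. l \<in> mathieu_eigs q ev \<Longrightarrow> integral {0..pi} (\<lambda>x. f x * rfund q ev l x) = 0"
    and "x \<in> {0..pi}"
  shows "f x = 0"
proof (rule mathieu_complete[OF assms(1) _ assms(3)])
  fix l :: real assume "disc q ev (of_real l) = 0"
  then have "integral {0..pi} (\<lambda>x. f x * rfund q ev l x) = 0" using assms(2) by (simp add: mathieu_eigs_def)
  then have "integral {0..pi} (\<lambda>x. complex_of_real (f x * rfund q ev l x)) = 0"
    by (subst integral_of_real_cont) (auto intro!: continuous_intros assms(1))
  then show "integral {0..pi} (\<lambda>x. of_real (f x) * mathieu_fund q ev (of_real l) (of_real x)) = 0"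
    by (simp add: of_real_rfund)
qed

lemma rfund_sq_pos: "integral {0..pi} (\<lambda>x. rfund q ev l x * rfund q ev l x) > 0"
  using mathieu_fund_norm_pos[of q ev "of_real l"] by (simp add: of_real_rfund power2_eq_square)

text \<open>Otherwise every continuous function on the interval, in particular one with a corner, would be a
  finite linear combination of eigenfunctions.\<close>

lemma mathieu_eigs_infinite: "infinite (mathieu_eigs q ev)"
proof
  assume fin: "finite (mathieu_eigs q ev)"
  let ?E = "mathieu_eigs q ev" and ?y = "rfund q ev"
  define f where "f x = \<bar>x - pi / 2\<bar>" for x
  define c where "c l = integral {0..pi} (\<lambda>x. f x * ?y l x) / integral {0..pi} (\<lambda>x. ?y l x * ?y l x)" for l
  define S where "S x = (\<Sum>l\<in>?E. c l * ?y l x)" for x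
  have cf: "continuous_on {0..pi} f" unfolding f_def by (intro continuous_intros)
  have cS: "continuous_on {0..pi} S" unfolding S_def by (intro continuous_intros)
  have "f x - S x = 0" if "x \<in> {0..pi}" for x
  proof (rule rfund_complete[OF _ _ that])
    show "continuous_on {0..pi} (\<lambda>x. f x - S x)" by (intro continuous_intros cf cS)
    fix m assume m: "m \<in> ?E"
    have "((\<lambda>x. f x * ?y m x - (\<Sum>l\<in>?E. c l * (?y l x * ?y m x))) has_integral
      integral {0..pi} (\<lambda>x. f x * ?y m x) - (\<Sum>l\<in>?E. c l * integral {0..pi} (\<lambda>x. ?y l x * ?y m x))) {0..pi}"
      by (intro has_integral_diff has_integral_sum has_integral_mult_right integrable_integral
           integrable_continuous_interval continuous_intros cf fin)
    moreover have "(\<Sum>l\<in>?E. c l * integral {0..pi} (\<lambda>x. ?y l x * ?y m x)) =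
        (\<Sum>l\<in>?E. if l = m then c m * integral {0..pi} (\<lambda>x. ?y m x * ?y m x) else 0)"
      by (intro sum.cong) (auto simp: rfund_orthogonal m)
    moreover have "\<dots> = integral {0..pi} (\<lambda>x. f x * ?y m x)"
      using fin m rfund_sq_pos[of q ev m] by (simp add: c_def)
    ultimately show "integral {0..pi} (\<lambda>x. (f x - S x) * ?y m x) = 0"
      by (simp add: S_def left_diff_distrib sum_distrib_right mult.assoc integral_unique)
  qed
  then have fS: "f x = S x" if "x \<in> {0..pi}" for x using that by force
  define D where "D = (\<Sum>l\<in>?E. c l * rfund' q ev l (pi / 2))"
  have D: "(S has_real_derivative D) (at (pi / 2))"
    unfolding S_def D_def by (intro DERIV_sum DERIV_cmult DERIV_rfund)
  have "\<forall>\<^sub>F x in nhds (pi / 2). x \<in> {0<..<pi}"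
    by (rule eventually_nhds_in_open) auto
  then have ev: "\<forall>\<^sub>F x in nhds (pi / 2). S x = f x" by (rule eventually_mono) (use fS in auto)
  have D: "(f has_real_derivative D) (at (pi / 2))"
    using D DERIV_cong_ev[OF refl ev refl] by blast
  \<comment> \<open>The corner of \<open>f\<close> is a minimum, which forces the derivative
    \<open>0\<close>, while all difference quotients near it have modulus \<open>1\<close>.\<close>
  have "D = 0" by (rule DERIV_local_min[OF D, of 1]) (auto simp: f_def)
  moreover have "((\<lambda>h. \<bar>(f (pi / 2 + h) - f (pi / 2)) / h\<bar>) \<longlongrightarrow> \<bar>D\<bar>) (at 0)"
    using D unfolding DERIV_def by (rule tendsto_rabs)
  moreover have "((\<lambda>h. \<bar>(f (pi / 2 + h) - f (pi / 2)) / h\<bar>) \<longlongrightarrow> 1) (at 0)"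
    by (rule Lim_transform_eventually[OF tendsto_const]) (auto simp: f_def eventually_at_filter)
  ultimately show False using tendsto_unique[OF trivial_limit_at[of "0::real"]] by fastforce
qed

section \<open>Enumerating a discrete set of reals by rank\<close>

lemma rank_exists:
  fixes S :: "real set"
  assumes inf: "infinite S" and fin: "\<And>c. finite {x \<in> S. x \<le> c}"
  shows "\<exists>x\<in>S. card {y \<in> S. y < x} = n"
proof (induction n)
  case 0
  obtain s where s: "s \<in> S" using inf by (metis finite.emptyI ex_in_conv)
  let ?A = "{x \<in> S. x \<le> s}"
  have m: "Min ?A \<in> ?A" using fin[of s] s by (intro Min_in) auto
  have "{y \<in> S. y < Min ?A} = {}"
  proof (rule equals0I)
    fix y assume y: "y \<in> {y \<in> S. y < Min ?A}"
    then have "y \<in> ?A" using m by auto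
    then have "Min ?A \<le> y" using fin[of s] by (intro Min_le) auto
    then show False using y by auto
  qed
  then have "card {y \<in> S. y < Min ?A} = 0" by (simp only: card.empty)
  then show ?case using m by blast
next
  case (Suc n)
  then obtain x where x: "x \<in> S" "card {y \<in> S. y < x} = n" by blast
  have "\<not> S \<subseteq> {y \<in> S. y \<le> x}" using inf fin[of x] finite_subset by blast
  then obtain s where s: "s \<in> S" "x < s"
    unfolding subset_eq by (force simp: not_le)
  let ?A = "{y \<in> S. x < y \<and> y \<le> s}"
  have fA: "finite ?A" by (rule finite_subset[OF _ fin[of s]]) auto
  have m: "Min ?A \<in> ?A" using fA s by (intro Min_in) auto
  have "{y \<in> S. y < Min ?A} = insert x {y \<in> S. y < x}"
  proof (intro equalityI subsetI)
    fix y assume y: "y \<in> {y \<in> S. y < Min ?A}"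
    show "y \<in> insert x {y \<in> S. y < x}"
    proof (rule ccontr)
      assume "y \<notin> insert x {y \<in> S. y < x}"
      then have "y \<in> ?A" using y m by auto
      then have "Min ?A \<le> y" using fA by (intro Min_le) auto
      then show False using y by auto
    qed
  next
    fix y assume "y \<in> insert x {y \<in> S. y < x}"
    then show "y \<in> {y \<in> S. y < Min ?A}" using m x by auto
  qed
  moreover have "finite {y \<in> S. y < x}" by (rule finite_subset[OF _ fin[of x]]) auto
  ultimately have "card {y \<in> S. y < Min ?A} = Suc n" using x by simp
  then show ?case using m by blast
qed

lemma rank_unique:
  fixes S :: "real set"
  assumes fin: "\<And>c. finite {x \<in> S. x \<le> c}" and x: "x \<in> S" "y \<in> S" "x < y"
  shows "card {z \<in> S. z < x} < card {z \<in> S. z < y}"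
proof (rule psubset_card_mono)
  show "finite {z \<in> S. z < y}" by (rule finite_subset[OF _ fin[of y]]) auto
qed (use x in auto)

text \<open>An increasing enumeration must send \<open>n\<close> to the element with exactly
  \<open>n\<close> smaller ones; this rank gives both existence and uniqueness for the definite
  description.\<close>

lemma increasing_enumeration:
  fixes S :: "real set"
  assumes inf: "infinite S" and fin: "\<And>c. finite {x \<in> S. x \<le> c}"
  shows "strict_mono (increasing_enumeration S)" "range (increasing_enumeration S) = S"
proof -
  have ru: "x = y" if "x \<in> S" "y \<in> S" "card {z \<in> S. z < x} = card {z \<in> S. z < y}" for x y
    using rank_unique[of S, OF fin, of x y] rank_unique[of S, OF fin, of y x] that by (metis less_irrefl linorder_neqE)
  have rk: "card {z \<in> S. z < f n} = n" if f: "strict_mono f" "range f = S" for f and n :: nat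
  proof -
    have "{z \<in> S. z < f n} = f ` {..<n}" using f strict_mono_less[OF f(1)] by auto
    then show ?thesis using card_image[of f "{..<n}"] strict_mono_imp_inj_on[OF f(1)] inj_on_subset by fastforce
  qed
  obtain f where f: "\<And>n. f n \<in> S" "\<And>n. card {y \<in> S. y < f n} = n"
    using rank_exists[OF inf fin] by metis
  have "strict_mono f"
  proof (rule strict_monoI)
    fix m n :: nat assume "m < n"
    then show "f m < f n" using rank_unique[of S, OF fin f(1)[of n] f(1)[of m]] f(2)
      by (metis less_asym linorder_neqE less_irrefl)
  qed
  moreover have "range f = S"
  proof (intro equalityI subsetI)
    fix x assume "x \<in> S"
    then have "x = f (card {y \<in> S. y < x})" using f by (intro ru) auto
    then show "x \<in> range f" by blast
  qed (use f in auto)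
  ultimately have ex: "strict_mono f \<and> range f = S" by blast
  have "\<exists>!f::nat \<Rightarrow> real. strict_mono f \<and> range f = S"
  proof (rule ex1I[of "\<lambda>f::nat \<Rightarrow> real. strict_mono f \<and> range f = S", OF ex])
    fix g :: "nat \<Rightarrow> real" assume g: "strict_mono g \<and> range g = S"
    show "g = f"
      using rk[of g] rk[of f] g ex by (intro ext ru) auto
  qed
  from theI'[OF this] show "strict_mono (increasing_enumeration S)" "range (increasing_enumeration S) = S"
    unfolding increasing_enumeration_def by auto
qed

definition mathieu_eig :: "real \<Rightarrow> bool \<Rightarrow> nat \<Rightarrow> real" where
  "mathieu_eig q ev = increasing_enumeration (mathieu_eigs q ev)"

lemma mathieu_eig:
  "strict_mono (mathieu_eig q ev)" "range (mathieu_eig q ev) = mathieu_eigs q ev"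
  "disc q ev (of_real (mathieu_eig q ev n)) = 0"
proof -
  show 1: "strict_mono (mathieu_eig q ev)" "range (mathieu_eig q ev) = mathieu_eigs q ev"
    unfolding mathieu_eig_def using increasing_enumeration[OF mathieu_eigs_infinite mathieu_eigs_finite] by auto
  show "disc q ev (of_real (mathieu_eig q ev n)) = 0"
    using 1(2) by (auto simp: mathieu_eigs_def)
qed

text \<open>\<open>e\<close> is positive just after \<open>a\<close> and negative just before
  \<open>b\<close>.\<close>

lemma IVT_between_simple_zeros:
  fixes e :: "real \<Rightarrow> real"
  assumes "a < b" "e a = 0" "e b = 0" "(e has_real_derivative A) (at a)" "A > 0"
    "(e has_real_derivative B) (at b)" "B > 0" and c: "continuous_on {a..b} e"
  obtains x where "a < x" "x < b" "e x = 0"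
proof -
  obtain d where d: "d > 0" "\<And>h. h > 0 \<Longrightarrow> h < d \<Longrightarrow> e a < e (a + h)"
    using DERIV_pos_inc_right[OF assms(4,5)] by blast
  obtain d' where d': "d' > 0" "\<And>h. h > 0 \<Longrightarrow> h < d' \<Longrightarrow> e (b - h) < e b"
    using DERIV_pos_inc_left[OF assms(6,7)] by blast
  define h where "h = min (min d d') (b - a) / 3"
  have h: "h > 0" "h < d" "h < d'" "3 * h \<le> b - a" using d(1) d'(1) assms(1) by (auto simp: h_def)
  have "e (a + h) > 0" "e (b - h) < 0" using d(2)[OF h(1,2)] d'(2)[OF h(1,3)] assms by auto
  moreover have "continuous_on {a + h..b - h} e" by (rule continuous_on_subset[OF c]) (use h in auto)
  ultimately obtain x where "a + h \<le> x" "x \<le> b - h" "e x = 0"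
    using IVT2'[of e "b - h" 0 "a + h"] h by auto
  then show ?thesis using that[of x] h by auto
qed

text \<open>\<open>disc\<close> is positive far to the left, so its derivative at the first zero is
  negative, and \<open>disc_has_deriv\<close> turns this into \<open>s 0 = 1\<close>. Equal signs at
  consecutive zeros would force another zero in between. In the odd family, numbered from
  \<open>0\<close> here, the multiplier itself is \<open>- ((- 1) ^ n)\<close>, in accordance with
  the numbering of \<open>se\<close> from \<open>1\<close>.\<close>

lemma codisc_eig: "par ev * codisc q ev (of_real (mathieu_eig q ev n)) = (- 1) ^ n"
proof -
  define d where "d l = Re (disc q ev (of_real l))" for l
  define s where "s n = Re (par ev) * Re (codisc q ev (of_real (mathieu_eig q ev n)))" for n
  let ?l = "mathieu_eig q ev"
  have cs: "par ev * codisc q ev (of_real (?l n)) = of_real (s n)" for n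
    unfolding s_def by (subst codisc_real) (simp add: par_def)
  have s2: "s n = 1 \<or> s n = -1" for n
  proof -
    have "of_real ((s n)\<^sup>2) = (par ev * codisc q ev (of_real (?l n)))\<^sup>2" by (simp add: cs)
    also have "\<dots> = (codisc q ev (of_real (?l n)))\<^sup>2" by (simp add: par_def power2_eq_square)
    also have "\<dots> = 1" by (rule disc_zero(2)[OF mathieu_eig(3)])
    finally show ?thesis using power2_eq_1_iff by (metis of_real_eq_1_iff)
  qed
  have zero: "d l = 0 \<longleftrightarrow> l \<in> range ?l" for l
  proof -
    have "disc q ev (of_real l) = of_real (d l)" unfolding d_def by (rule disc_real)
    then show ?thesis by (simp add: mathieu_eig(2) mathieu_eigs_def)
  qed
  have cd: "continuous_on X d" for X
  proof -
    have "continuous_on UNIV (disc q ev)" by (rule holomorphic_on_imp_continuous_on[OF holomorphic_disc])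
    then have "continuous_on X (\<lambda>l. Re (disc q ev (of_real l)))"
      by (intro continuous_on_Re continuous_on_compose2[OF _ continuous_on_of_real[OF continuous_on_id]]) auto
    then show ?thesis by (simp add: d_def[abs_def])
  qed
  have der: "\<exists>I>0. (d has_real_derivative - s n * I) (at (?l n))" for n
  proof -
    define I where "I = integral {0..pi} (\<lambda>x. (norm (mathieu_fund q ev (of_real (?l n)) (of_real x)))\<^sup>2)"
    have "I > 0" unfolding I_def by (rule mathieu_fund_norm_pos)
    moreover have "(d has_real_derivative Re (- par ev * codisc q ev (of_real (?l n)) * of_real I)) (at (?l n))"
      unfolding d_def I_def by (intro DERIV_Re_of_real disc_has_deriv mathieu_eig)
    moreover have "- par ev * codisc q ev (of_real (?l n)) * of_real I = of_real (- s n * I)"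
      using cs[of n] by simp
    ultimately show ?thesis by (metis Re_complex_of_real)
  qed
  have ml: "?l m < ?l n \<longleftrightarrow> m < n" for m n using mathieu_eig(1) strict_mono_less by blast
  have "s n = (- 1) ^ n"
  proof (induction n)
    case 0
    have "s 0 \<noteq> - 1"
    proof
      assume s: "s 0 = - 1"
      obtain I where I: "I > 0" "(d has_real_derivative I) (at (?l 0))" using der[of 0] s by auto
      from DERIV_pos_inc_left[OF I(2,1)] obtain e where e: "e > 0" "\<And>h. h > 0 \<Longrightarrow> h < e \<Longrightarrow> d (?l 0 - h) < d (?l 0)"
        by blast
      define b where "b = ?l 0 - e / 2"
      define a where "a = min b (- 2 * \<bar>q\<bar> - 1)"
      have "d (?l 0) = 0" using zero by blast
      then have "d b < 0" using e(2)[of "e / 2"] e(1) by (simp add: b_def)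
      moreover have "d a > 0" unfolding d_def by (rule disc_pos) (auto simp: a_def)
      moreover have ab: "a \<le> b" by (simp add: a_def)
      ultimately obtain x where x: "a \<le> x" "x \<le> b" "d x = 0"
        using IVT2'[of d b 0 a, OF _ _ _ cd] ab by (metis less_imp_le)
      then obtain m where "x = ?l m" using zero by blast
      then have "?l m < ?l 0" using x(2) e(1) by (simp add: b_def)
      then show False unfolding ml by simp
    qed
    then show ?case using s2[of 0] by simp
  next
    case (Suc n)
    have "s (Suc n) \<noteq> s n"
    proof
      assume s: "s (Suc n) = s n"
      obtain I J where I: "I > 0" "(d has_real_derivative - s n * I) (at (?l n))"
         and J: "J > 0" "(d has_real_derivative - s n * J) (at (?l (Suc n)))" using der[of n] der[of "Suc n"] s by auto
      have ss: "s n * s n = 1" using s2[of n] by auto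
      \<comment> \<open>Multiplying by \<open>- s n\<close> makes both derivatives positive, which
        would put an eigenvalue between two consecutive ones.\<close>
      have I': "((\<lambda>x. - s n * d x) has_real_derivative I) (at (?l n))"
        using DERIV_cmult[OF I(2), of "- s n"] ss by (simp add: mult.assoc[symmetric])
      have J': "((\<lambda>x. - s n * d x) has_real_derivative J) (at (?l (Suc n)))"
        using DERIV_cmult[OF J(2), of "- s n"] ss by (simp add: mult.assoc[symmetric])
      have z: "d (?l n) = 0" "d (?l (Suc n)) = 0" using zero by blast+
      obtain x where x: "?l n < x" "x < ?l (Suc n)" "- s n * d x = 0"
      proof (rule IVT_between_simple_zeros[OF _ _ _ I' I(1) J' J(1)])
        show "continuous_on {?l n..?l (Suc n)} (\<lambda>x. - s n * d x)" by (intro continuous_intros cd)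
      qed (auto simp: ml z)
      then have "d x = 0" using ss by auto
      then obtain m where "x = ?l m" using zero by blast
      then show False using x(1,2) unfolding \<open>x = ?l m\<close> ml by simp
    qed
    then show ?case using s2[of n] s2[of "Suc n"] Suc by auto
  qed
  then show ?thesis using cs[of n] by simp
qed

section \<open>Normalized eigenfunctions\<close>

lemma par_mult: "(par ev * a) * (par ev * b) = a * b"
  by (simp add: par_def)

lemma continuous_on_entire_compose:
  assumes "h holomorphic_on UNIV" "continuous_on S g"
  shows "continuous_on S (\<lambda>x. h (g x))"
  using continuous_on_compose2[OF holomorphic_on_imp_continuous_on[OF assms(1)] assms(2)] by simp

text \<open>The increment of a primitive over one period is constant because \<open>h\<close> is
  periodic. Besides the whole plane, half planes are needed as domains, for integrands with a
  pole.\<close>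

lemma periodic_has_integral_on:
  assumes U: "convex U" "open U" and Ut: "\<And>z x. z \<in> U \<Longrightarrow> z + of_real x \<in> U"
    and h: "h holomorphic_on U" and per: "\<And>z. z \<in> U \<Longrightarrow> h (z + 2 * of_real pi) = h z"
  obtains C where "\<And>w. w \<in> U \<Longrightarrow> ((\<lambda>x. h (w + of_real x)) has_integral C) {0..2 * pi}"
proof -
  obtain P where P': "\<And>x. x \<in> U \<Longrightarrow> (P has_field_derivative h x) (at x within U)"
    using holomorphic_convex_primitive'[OF U h] by auto
  then have P: "(P has_field_derivative h x) (at x)" if "x \<in> U" for x
    using that U(2) by (metis at_within_open)
  have 1: "((\<lambda>x. h (w + of_real x)) has_integral (P (w + of_real (2 * pi)) - P (w + of_real 0))) {0..2 * pi}" if w: "w \<in> U" for w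
  proof (rule fundamental_theorem_of_calculus)
    fix x :: real
    have "((\<lambda>z. P (w + z)) has_field_derivative h (w + of_real x)) (at (of_real x))"
      using P[of "of_real x + w"] Ut[OF w, of x] unfolding DERIV_shift by (simp add: add.commute)
    then show "((\<lambda>x. P (w + of_real x)) has_vector_derivative h (w + of_real x)) (at x within {0..2 * pi})"
      by (rule has_vector_derivative_real_field)
  qed auto
  have "((\<lambda>z. P (z + 2 * of_real pi) - P z) has_field_derivative 0) (at w within U)" if w: "w \<in> U" for w
  proof -
    have "w + 2 * of_real pi \<in> U" using Ut[OF w, of "2 * pi"] by simp
    from DERIV_diff[OF P[OF this, unfolded DERIV_shift] P[OF w]] show ?thesis
      using per[OF w] has_field_derivative_at_within by fastforce
  qed
  then obtain C where "\<And>w. w \<in> U \<Longrightarrow> P (w + 2 * of_real pi) - P w = C"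
    using has_field_derivative_zero_constant[OF U(1), of "\<lambda>z. P (z + 2 * of_real pi) - P z"] by blast
  then show ?thesis using 1 by (intro that[of C]) fastforce
qed

lemma periodic_integral_shift:
  assumes "h holomorphic_on UNIV" "\<And>z. h (z + 2 * of_real pi) = h z"
  shows "integral {0..2 * pi} (\<lambda>x. h (w + of_real x)) = integral {0..2 * pi} (\<lambda>x. h (of_real x))"
proof -
  obtain C where "\<And>w. ((\<lambda>x. h (w + of_real x)) has_integral C) {0..2 * pi}"
    using periodic_has_integral_on[OF convex_UNIV open_UNIV UNIV_I assms(1)] assms(2) by auto
  from integral_unique[OF this[of w]] integral_unique[OF this[of 0]] show ?thesis by simp
qed

lemma periodic_integral_reflect:
  assumes h: "h holomorphic_on UNIV" "\<And>z. h (z + 2 * of_real pi) = h z"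
  shows "integral {0..2 * pi} (\<lambda>x. h (- of_real x)) = integral {0..2 * pi} (\<lambda>x. h (of_real x))"
proof -
  have "integral {0..2 * pi} (\<lambda>x. h (of_real x)) = integral {0..2 * pi} (\<lambda>x. h (of_real x - 2 * of_real pi))"
    using periodic_integral_shift[OF h, of "- 2 * of_real pi"] by simp
  also have "\<dots> = integral {0..2 * pi} (\<lambda>x. h (- of_real (2 * pi - x)))"
    by (simp add: algebra_simps)
  also have "\<dots> = integral {0..2 * pi} (\<lambda>x. h (- of_real x))"
  proof -
    have c: "continuous_on {0..2 * pi} (\<lambda>x. h (- of_real x))"
      by (intro continuous_on_entire_compose[OF h(1)] continuous_intros)
    then have "((\<lambda>x. h (- of_real x)) has_integral integral {0..2 * pi} (\<lambda>x. h (- of_real x))) {0..2 * pi}"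
      using integrable_continuous_interval integrable_integral by blast
    from has_integral_affinity[OF this[folded box_real(2)], of "- 1" "2 * pi"]
    have "((\<lambda>x. h (- of_real (2 * pi - x))) has_integral integral {0..2 * pi} (\<lambda>x. h (- of_real x)))
      ((\<lambda>x. 2 * pi - x) ` {0..2 * pi})" by simp
    moreover have "(\<lambda>x. 2 * pi - x) ` {0..2 * pi} = {0..2 * pi}" by simp
    ultimately show ?thesis by (metis integral_unique)
  qed
  finally show ?thesis by simp
qed

lemma periodic_integral_even:
  assumes h: "h holomorphic_on UNIV" "\<And>z. h (z + 2 * of_real pi) = h z" and ev: "\<And>z. h (- z) = h z"
  shows "integral {0..2 * pi} (\<lambda>x. h (of_real x)) = 2 * integral {0..pi} (\<lambda>x. h (of_real x))"
proof -
  have c: "continuous_on S (\<lambda>x::real. h (of_real x))" for S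
    by (intro continuous_on_entire_compose[OF h(1)] continuous_intros)
  have i: "(\<lambda>x. h (of_real x)) integrable_on {a..b}" for a b by (intro integrable_continuous_interval c)
  have "integral {0..2 * pi} (\<lambda>x. h (of_real x)) = integral {0..pi} (\<lambda>x. h (of_real x)) + integral {pi..2 * pi} (\<lambda>x. h (of_real x))"
    using Henstock_Kurzweil_Integration.integral_combine[OF _ _ i[of 0 "2 * pi"], of pi] by simp
  also have "integral {pi..2 * pi} (\<lambda>x. h (of_real x)) = integral {0..pi} (\<lambda>x. h (of_real x))"
  proof -
    have "((\<lambda>x. h (of_real x)) has_integral integral {0..pi} (\<lambda>x. h (of_real x))) {0..pi}"
      using i integrable_integral by blast
    from has_integral_affinity[OF this[folded box_real(2)], of "- 1" "2 * pi"]
    have "((\<lambda>x. h (of_real (2 * pi - x))) has_integral integral {0..pi} (\<lambda>x. h (of_real x)))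
      ((\<lambda>x. 2 * pi - x) ` {0..pi})" by simp
    moreover have "h (of_real (2 * pi - x)) = h (of_real x)" for x
      using ev[of "of_real x - of_real (2 * pi)"] h(2)[of "of_real x - 2 * of_real pi"] by simp
    moreover have "(\<lambda>x. 2 * pi - x) ` {0..pi} = {pi..2 * pi}" by simp
    ultimately show ?thesis by (metis (no_types, lifting) integral_unique has_integral_eq)
  qed
  finally show ?thesis by simp
qed

text \<open>A predicate instead of the chosen functions: it covers \<open>ce\<close> with index
  \<open>n\<close> and \<open>se\<close> with index \<open>Suc n\<close> alike, for either choice of
  sign.\<close>

definition mathieu_eigfun :: "real \<Rightarrow> bool \<Rightarrow> nat \<Rightarrow> (complex \<Rightarrow> complex) \<Rightarrow> bool" where
  "mathieu_eigfun q ev n u \<longleftrightarrow> mathieu_sol q (of_real (mathieu_eig q ev n)) u \<and>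
     (\<forall>z. u (- z) = par ev * u z) \<and> two_pi_periodic u \<and> real_on_reals u \<and> mathieu_normalized u"

lemma mathieu_eigfun_repr:
  assumes "mathieu_eigfun q ev n u"
  obtains c :: real where "c \<noteq> 0" "\<And>z. u z = of_real c * mathieu_fund q ev (of_real (mathieu_eig q ev n)) z"
proof -
  obtain c where c: "\<And>z. u z = c * mathieu_fund q ev (of_real (mathieu_eig q ev n)) z"
    using assms mathieu_sol_par unfolding mathieu_eigfun_def by metis
  obtain x :: real where x: "mathieu_fund q ev (of_real (mathieu_eig q ev n)) (of_real x) \<noteq> 0"
    using mathieu_fund_nonzero by blast
  have "c = u (of_real x) / mathieu_fund q ev (of_real (mathieu_eig q ev n)) (of_real x)" using c x by simp
  also have "\<dots> \<in> \<real>" using assms mathieu_fund_real by (auto simp: mathieu_eigfun_def real_on_reals_def)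
  finally obtain r where r: "c = of_real r" by (auto elim: Reals_cases)
  have "r \<noteq> 0"
  proof
    assume "r = 0"
    then have "mathieu_normalized (\<lambda>z. 0)" using assms c r by (simp add: mathieu_eigfun_def mathieu_normalized_def)
    then show False by (simp add: mathieu_normalized_def)
  qed
  then show ?thesis using c r that by blast
qed

lemma mathieu_eigfun_exists: "\<exists>u. mathieu_eigfun q ev n u"
proof -
  let ?f = "mathieu_fund q ev (of_real (mathieu_eig q ev n))"
  let ?r = "rfund q ev (mathieu_eig q ev n)"
  define I where "I = integral {0..2 * pi} (\<lambda>x. ?r x * ?r x)"
  have per: "?f (z + 2 * of_real pi) = ?f z" for z by (rule mathieu_fund_two_pi[OF mathieu_eig(3)])
  have fI: "integral {0..2 * pi} (\<lambda>x. ?f (of_real x) * ?f (of_real x)) = of_real I"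
    unfolding I_def of_real_rfund of_real_mult[symmetric] by (intro integral_of_real_cont continuous_intros)
  have "integral {0..2 * pi} (\<lambda>x. ?f (of_real x) * ?f (of_real x)) = 2 * integral {0..pi} (\<lambda>x. ?f (of_real x) * ?f (of_real x))"
    by (rule periodic_integral_even[of "\<lambda>z. ?f z * ?f z"])
       (auto simp: per mathieu_fund_par par_mult intro!: holomorphic_intros holomorphic_mathieu_fund)
  moreover have "integral {0..pi} (\<lambda>x. ?f (of_real x) * ?f (of_real x)) = of_real (integral {0..pi} (\<lambda>x. ?r x * ?r x))"
    unfolding of_real_rfund of_real_mult[symmetric] by (intro integral_of_real_cont continuous_intros)
  ultimately have "complex_of_real I = of_real (2 * integral {0..pi} (\<lambda>x. ?r x * ?r x))"
    unfolding fI by (simp only: of_real_mult of_real_numeral)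
  then have "I = 2 * integral {0..pi} (\<lambda>x. ?r x * ?r x)"
    by (simp only: of_real_eq_iff)
  then have I: "I > 0" using rfund_sq_pos[of q ev "mathieu_eig q ev n"] by simp
  define c where "c = sqrt (pi / I)"
  have c2: "c * c = pi / I" using I by (simp add: c_def)
  have "mathieu_eigfun q ev n (\<lambda>z. of_real c * ?f z)"
    unfolding mathieu_eigfun_def
  proof (intro conjI)
    have "(\<lambda>x::real. (of_real c * ?f (of_real x))\<^sup>2) = (\<lambda>x. of_real (c * c) * (?f (of_real x) * ?f (of_real x)))"
      by (simp add: power2_eq_square mult_ac)
    then have "integral {0..2 * pi} (\<lambda>x::real. (of_real c * ?f (of_real x))\<^sup>2) = of_real (c * c) * of_real I"
      by (simp add: fI)
    then show "mathieu_normalized (\<lambda>z. of_real c * ?f z)"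
      unfolding mathieu_normalized_def c2 using I by simp
  qed (auto simp: mathieu_fund_par two_pi_periodic_def per real_on_reals_def mathieu_fund_real intro!: mathieu_sol_cmult mathieu_sol_fund)
  then show ?thesis by blast
qed

lemma mathieu_eigfun_ce: "mathieu_eigfun q True n (\<lambda>z. mathieu_ce n z q)"
proof -
  have "mathieu_solution q (mathieu_a n q) u \<and> even_function u \<and> two_pi_periodic u \<and>
      real_on_reals u \<and> mathieu_normalized u \<longleftrightarrow> mathieu_eigfun q True n u" for u
    by (simp add: mathieu_eigfun_def mathieu_solution_iff mathieu_a_def eigenvalues_eq even_function_def par_def mathieu_eig_def)
  then show ?thesis unfolding mathieu_ce_def
    using someI_ex[OF mathieu_eigfun_exists[of q True n]] by simp
qed

lemma mathieu_eigfun_se: "mathieu_eigfun q False n (\<lambda>z. mathieu_se (Suc n) z q)"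
proof -
  have "mathieu_solution q (mathieu_b (Suc n) q) u \<and> odd_function u \<and> two_pi_periodic u \<and>
      real_on_reals u \<and> mathieu_normalized u \<longleftrightarrow> mathieu_eigfun q False n u" for u
    by (simp add: mathieu_eigfun_def mathieu_solution_iff mathieu_b_def eigenvalues_eq odd_function_def par_def mathieu_eig_def)
  then show ?thesis unfolding mathieu_se_def
    using someI_ex[OF mathieu_eigfun_exists[of q False n]] by simp
qed

lemma mathieu_eigfun_shift_pi:
  assumes "mathieu_eigfun q ev n u"
  shows "u (z + of_real pi) = par ev * (- 1) ^ n * u z"
proof -
  obtain c :: real where c: "\<And>z. u z = of_real c * mathieu_fund q ev (of_real (mathieu_eig q ev n)) z"
    using mathieu_eigfun_repr[OF assms] by blast
  have "codisc q ev (of_real (mathieu_eig q ev n)) = par ev * (- 1) ^ n"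
    using codisc_eig[of ev q n, symmetric] by simp
  then show ?thesis using disc_zero(1)[OF mathieu_eig(3)[of q ev n], of z] by (simp add: c)
qed

lemma mathieu_eigfunD:
  assumes "mathieu_eigfun q ev n u"
  shows "mathieu_sol q (of_real (mathieu_eig q ev n)) u" "u (- z) = par ev * u z"
    "u (z + 2 * of_real pi) = u z" "u (cnj z) = cnj (u z)"
    "u holomorphic_on S" "continuous_on X u" "integral {0..2 * pi} (\<lambda>x. u (of_real x) * u (of_real x)) = of_real pi"
proof -
  show "mathieu_sol q (of_real (mathieu_eig q ev n)) u" "u (- z) = par ev * u z"
    "u (z + 2 * of_real pi) = u z"
    using assms by (auto simp: mathieu_eigfun_def two_pi_periodic_def)
  obtain c :: real where c: "\<And>z. u z = of_real c * mathieu_fund q ev (of_real (mathieu_eig q ev n)) z"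
    using mathieu_eigfun_repr[OF assms] by blast
  show "u (cnj z) = cnj (u z)"
    using mathieu_fund_cnj(1)[of q ev "of_real (mathieu_eig q ev n)" z] by (simp add: c)
  have h: "u holomorphic_on UNIV" using assms by (simp add: mathieu_eigfun_def mathieu_sol_def)
  then show "u holomorphic_on S" "continuous_on X u"
    using holomorphic_on_subset holomorphic_on_imp_continuous_on by blast+
  show "integral {0..2 * pi} (\<lambda>x. u (of_real x) * u (of_real x)) = of_real pi"
    using assms by (simp add: mathieu_eigfun_def mathieu_normalized_def power2_eq_square)
qed

lemma mathieu_eigfun_orthogonal:
  assumes u: "mathieu_eigfun q ev n u" and v: "mathieu_eigfun q ev m v" and nm: "n \<noteq> m"
  shows "integral {0..2 * pi} (\<lambda>x. u (of_real x) * v (of_real x)) = 0"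
proof -
  let ?l = "mathieu_eig q ev"
  obtain c where c: "\<And>z. u z = of_real c * mathieu_fund q ev (of_real (?l n)) z"
    using mathieu_eigfun_repr[OF u] by blast
  obtain d where d: "\<And>z. v z = of_real d * mathieu_fund q ev (of_real (?l m)) z"
    using mathieu_eigfun_repr[OF v] by blast
  have e: "integral {0..2 * pi} (\<lambda>x. u (of_real x) * v (of_real x)) = 2 * integral {0..pi} (\<lambda>x. u (of_real x) * v (of_real x))"
    by (rule periodic_integral_even[of "\<lambda>z. u z * v z"])
       (auto simp: mathieu_eigfunD[OF u] mathieu_eigfunD[OF v] par_mult intro!: holomorphic_intros)
  have "(\<lambda>x::real. u (of_real x) * v (of_real x)) = (\<lambda>x. of_real ((c * d) * (rfund q ev (?l n) x * rfund q ev (?l m) x)))"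
    by (simp add: c d of_real_rfund mult_ac)
  then have "integral {0..pi} (\<lambda>x. u (of_real x) * v (of_real x)) = integral {0..pi} (\<lambda>x. complex_of_real ((c * d) * (rfund q ev (?l n) x * rfund q ev (?l m) x)))"
    by (simp only:)
  also have "integral {0..pi} (\<lambda>x. complex_of_real ((c * d) * (rfund q ev (?l n) x * rfund q ev (?l m) x))) =
      of_real (integral {0..pi} (\<lambda>x. (c * d) * (rfund q ev (?l n) x * rfund q ev (?l m) x)))"
    by (intro integral_of_real_cont continuous_intros)
  also have "integral {0..pi} (\<lambda>x. (c * d) * (rfund q ev (?l n) x * rfund q ev (?l m) x)) = 0"
  proof -
    have "?l n \<noteq> ?l m" using nm strict_mono_eq[OF mathieu_eig(1)] by blast
    then have "integral {0..pi} (\<lambda>x. rfund q ev (?l n) x * rfund q ev (?l m) x) = 0"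
      using mathieu_eig(2)[of q ev] by (intro rfund_orthogonal) auto
    then show ?thesis by simp
  qed
  finally show ?thesis unfolding e by simp
qed

text \<open>Parity and periodicity reduce the integrals to \<open>{0..pi}\<close>; real and
  imaginary parts are separated because \<open>rfund_complete\<close> concerns real
  functions.\<close>

lemma mathieu_eigfun_complete:
  assumes u: "\<And>n. mathieu_eigfun q ev n (u n)"
    and g: "g holomorphic_on UNIV" "\<And>z. g (z + 2 * of_real pi) = g z" "\<And>z. g (- z) = par ev * g z"
    and orth: "\<And>n. integral {0..2 * pi} (\<lambda>x. g (of_real x) * u n (of_real x)) = 0"
  shows "g z = 0"
proof (rule entire_zero_on_interval[OF g(1) pi_gt_zero])
  let ?l = "mathieu_eig q ev"
  have cg: "continuous_on S (\<lambda>x::real. g (of_real x))" for S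
    by (intro continuous_on_entire_compose[OF g(1)] continuous_intros)
  have 0: "((\<lambda>x. g (of_real x) * of_real (rfund q ev l x)) has_integral 0) {0..pi}" if "l \<in> mathieu_eigs q ev" for l
  proof -
    have "l \<in> range ?l" using that by (simp only: mathieu_eig(2))
    then obtain n where n: "l = ?l n" by (rule rangeE)
    obtain c where c: "c \<noteq> 0" "\<And>z. u n z = of_real c * mathieu_fund q ev (of_real (?l n)) z"
      using mathieu_eigfun_repr[OF u[of n]] by blast
    have "integral {0..2 * pi} (\<lambda>x. g (of_real x) * u n (of_real x)) = 2 * integral {0..pi} (\<lambda>x. g (of_real x) * u n (of_real x))"
      by (rule periodic_integral_even[of "\<lambda>z. g z * u n z"])
         (use g in \<open>auto simp: mathieu_eigfunD[OF u] par_mult intro!: holomorphic_intros\<close>)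
    then have "integral {0..pi} (\<lambda>x. g (of_real x) * u n (of_real x)) = 0" using orth by simp
    then have "of_real c * integral {0..pi} (\<lambda>x. g (of_real x) * of_real (rfund q ev l x)) = 0"
      unfolding c n of_real_rfund by (simp only: mult.left_commute[of _ "of_real c"] integral_mult_right)
    then have "integral {0..pi} (\<lambda>x. g (of_real x) * of_real (rfund q ev l x)) = 0" using c by simp
    moreover have "(\<lambda>x. g (of_real x) * of_real (rfund q ev l x)) integrable_on {0..pi}"
      by (intro integrable_continuous_interval continuous_intros cg)
    ultimately show ?thesis using integrable_integral by fastforce
  qed
  fix x assume x: "x \<in> {0..pi}"
  have "Re (g (of_real x)) = 0"
  proof (rule rfund_complete[OF _ _ x])
    fix l assume "l \<in> mathieu_eigs q ev"
    from has_integral_linear[OF 0[OF this] bounded_linear_Re]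
    show "integral {0..pi} (\<lambda>x. Re (g (of_real x)) * rfund q ev l x) = 0" by (simp add: o_def integral_unique)
  qed (intro continuous_intros cg)
  moreover have "Im (g (of_real x)) = 0"
  proof (rule rfund_complete[OF _ _ x])
    fix l assume "l \<in> mathieu_eigs q ev"
    from has_integral_linear[OF 0[OF this] bounded_linear_Im]
    show "integral {0..pi} (\<lambda>x. Im (g (of_real x)) * rfund q ev l x) = 0" by (simp add: o_def integral_unique)
  qed (intro continuous_intros cg)
  ultimately show "g (of_real x) = 0" by (simp add: complex_eq_iff)
qed

section \<open>The Riemann function\<close>

text \<open>\<open>bessel_J0\<close> as a power series in the square of its argument: only
  \<open>r\<^sup>2\<close> is given by the coordinates, so no branch of a square root
  enters.\<close>

definition bessel_fps :: "complex fps" where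
  "bessel_fps = Abs_fps (\<lambda>n. (- 1 / 4) ^ n / (fact n)\<^sup>2)"

definition bessel_aux :: "complex \<Rightarrow> complex" where "bessel_aux = eval_fps bessel_fps"
definition bessel_aux1 :: "complex \<Rightarrow> complex" where "bessel_aux1 = eval_fps (fps_deriv bessel_fps)"
definition bessel_aux2 :: "complex \<Rightarrow> complex" where "bessel_aux2 = eval_fps (fps_deriv (fps_deriv bessel_fps))"

lemma bessel_J0_eq: "bessel_J0 z = bessel_aux (z\<^sup>2)"
  unfolding bessel_J0_def bessel_aux_def eval_fps_def bessel_fps_def
  by (intro arg_cong[of _ _ suminf] ext) (simp add: power_mult_distrib[symmetric])

lemma conv_radius_bessel: "fps_conv_radius bessel_fps = \<infinity>"
  "fps_conv_radius (fps_deriv bessel_fps) = \<infinity>"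
  "fps_conv_radius (fps_deriv (fps_deriv bessel_fps)) = \<infinity>"
proof -
  have "summable (\<lambda>n. fps_nth bessel_fps n * z ^ n)" for z
  proof (rule summable_comparison_test)
    show "summable (\<lambda>n. norm (z / 4) ^ n /\<^sub>R fact n)" by (rule summable_exp_generic)
    have "norm (fps_nth bessel_fps n * z ^ n) \<le> norm (z / 4) ^ n /\<^sub>R fact n" for n
    proof -
      have "norm (fps_nth bessel_fps n * z ^ n) = norm (z / 4) ^ n / (fact n * fact n)"
        by (simp add: bessel_fps_def norm_mult norm_divide norm_power power_divide power2_eq_square divide_simps)
      also have "\<dots> \<le> norm (z / 4) ^ n / (fact n * 1)"
        by (intro divide_left_mono mult_left_mono) auto
      also have "\<dots> = norm (z / 4) ^ n /\<^sub>R fact n"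
        by (simp only: real_scaleR_def mult_1_right divide_inverse_commute)
      finally show ?thesis .
    qed
    then show "\<exists>N. \<forall>n\<ge>N. norm (fps_nth bessel_fps n * z ^ n) \<le> norm (z / 4) ^ n /\<^sub>R fact n" by blast
  qed
  then show 1: "fps_conv_radius bessel_fps = \<infinity>"
    unfolding fps_conv_radius_def by (rule conv_radius_inftyI'')
  show 2: "fps_conv_radius (fps_deriv bessel_fps) = \<infinity>"
    using fps_conv_radius_deriv[of bessel_fps] 1 by simp
  show "fps_conv_radius (fps_deriv (fps_deriv bessel_fps)) = \<infinity>"
    using fps_conv_radius_deriv[of "fps_deriv bessel_fps"] 2 by simp
qed

lemma bessel_aux_deriv:
  "(bessel_aux has_field_derivative bessel_aux1 z) (at z within S)"
  "(bessel_aux1 has_field_derivative bessel_aux2 z) (at z within S)"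
  unfolding bessel_aux_def bessel_aux1_def bessel_aux2_def
  by (rule has_field_derivative_eval_fps; simp add: conv_radius_bessel)+

lemma bessel_aux_continuous: "continuous_on S bessel_aux" "continuous_on S bessel_aux1" "continuous_on S bessel_aux2"
  unfolding bessel_aux_def bessel_aux1_def bessel_aux2_def
  by (rule continuous_on_eval_fps'; simp add: conv_radius_bessel continuous_on_id)+

text \<open>Bessel's equation of order \<open>0\<close> after the substitution
  \<open>z = x\<^sup>2\<close>.\<close>

lemma bessel_aux_ode: "z * bessel_aux2 z + bessel_aux1 z + bessel_aux z / 4 = 0"
proof -
  have "fps_X * fps_deriv (fps_deriv bessel_fps) + fps_deriv bessel_fps + fps_const (1 / 4) * bessel_fps = 0"
  proof (rule fps_ext)
    fix n
    show "fps_nth (fps_X * fps_deriv (fps_deriv bessel_fps) + fps_deriv bessel_fps + fps_const (1 / 4) * bessel_fps) n = fps_nth 0 n"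
      by (cases n) (simp_all add: bessel_fps_def power2_eq_square field_simps del: of_nat_Suc, simp_all add: algebra_simps)
  qed
  then have "eval_fps (fps_X * fps_deriv (fps_deriv bessel_fps) + fps_deriv bessel_fps + fps_const (1 / 4) * bessel_fps) z = 0"
    by simp
  moreover have "fps_conv_radius (fps_X * fps_deriv (fps_deriv bessel_fps)) = \<infinity>"
    using fps_conv_radius_mult[of fps_X "fps_deriv (fps_deriv bessel_fps)"] by (simp add: conv_radius_bessel)
  moreover have "fps_conv_radius (fps_const (1 / 4) * bessel_fps) = \<infinity>"
    using fps_conv_radius_mult[of "fps_const (1 / 4)" bessel_fps] by (simp add: conv_radius_bessel)
  moreover have "fps_conv_radius (fps_X * fps_deriv (fps_deriv bessel_fps) + fps_deriv bessel_fps) = \<infinity>"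
    using fps_conv_radius_add[of "fps_X * fps_deriv (fps_deriv bessel_fps)" "fps_deriv bessel_fps"] calculation(2)
    by (simp add: conv_radius_bessel)
  ultimately show ?thesis
    by (simp add: eval_fps_add eval_fps_mult conv_radius_bessel bessel_aux_def bessel_aux1_def bessel_aux2_def)
qed

text \<open>With \<open>\<xi> = -\<i> * a\<close> the squared distance \<open>r\<^sup>2 / c\<^sup>2\<close> becomes a symmetric function of the four
  elliptic coordinates.\<close>

definition dist_sq :: "complex \<Rightarrow> complex \<Rightarrow> complex \<Rightarrow> complex \<Rightarrow> complex" where
  "dist_sq a b c d = (cos a)\<^sup>2 + (cos b)\<^sup>2 + (cos c)\<^sup>2 + (cos d)\<^sup>2 - 2
     - 2 * (cos a * cos b * cos c * cos d) + 2 * (sin a * sin b * sin c * sin d)"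

text \<open>\<open>dist_sq1\<close> and \<open>dist_sq2\<close> are the first and second derivative
  of \<open>dist_sq\<close> in its first variable, \<open>riem1\<close> and \<open>riem2\<close>
  those of \<open>riem\<close>; symmetry provides the derivatives in the other variables.\<close>

definition dist_sq1 :: "complex \<Rightarrow> complex \<Rightarrow> complex \<Rightarrow> complex \<Rightarrow> complex" where
  "dist_sq1 a b c d = - 2 * cos a * sin a + 2 * (sin a * cos b * cos c * cos d) + 2 * (cos a * sin b * sin c * sin d)"

definition dist_sq2 :: "complex \<Rightarrow> complex \<Rightarrow> complex \<Rightarrow> complex \<Rightarrow> complex" where
  "dist_sq2 a b c d = - 2 * (cos a)\<^sup>2 + 2 * (sin a)\<^sup>2 + 2 * (cos a * cos b * cos c * cos d) - 2 * (sin a * sin b * sin c * sin d)"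

definition riem :: "real \<Rightarrow> complex \<Rightarrow> complex \<Rightarrow> complex \<Rightarrow> complex \<Rightarrow> complex" where
  "riem q a b c d = bessel_aux (4 * of_real q * dist_sq a b c d)"

definition riem1 :: "real \<Rightarrow> complex \<Rightarrow> complex \<Rightarrow> complex \<Rightarrow> complex \<Rightarrow> complex" where
  "riem1 q a b c d = bessel_aux1 (4 * of_real q * dist_sq a b c d) * (4 * of_real q * dist_sq1 a b c d)"

definition riem2 :: "real \<Rightarrow> complex \<Rightarrow> complex \<Rightarrow> complex \<Rightarrow> complex \<Rightarrow> complex" where
  "riem2 q a b c d = bessel_aux2 (4 * of_real q * dist_sq a b c d) * (4 * of_real q * dist_sq1 a b c d)\<^sup>2
     + bessel_aux1 (4 * of_real q * dist_sq a b c d) * (4 * of_real q * dist_sq2 a b c d)"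

lemma riem_sym: "riem q a b c d = riem q b a c d" "riem q a b c d = riem q c b a d" "riem q a b c d = riem q d b c a"
  by (simp_all add: riem_def dist_sq_def algebra_simps)

lemma riem_deriv:
  "((\<lambda>a. riem q a b c d) has_field_derivative riem1 q a b c d) (at a within S)"
  "((\<lambda>a. riem1 q a b c d) has_field_derivative riem2 q a b c d) (at a within S)"
proof -
  have 1: "((\<lambda>a. 4 * of_real q * dist_sq a b c d) has_field_derivative 4 * of_real q * dist_sq1 a b c d) (at a within S)"
    unfolding dist_sq_def dist_sq1_def
    by (rule derivative_eq_intros refl)+ (simp add: algebra_simps)
  have 2: "((\<lambda>a. 4 * of_real q * dist_sq1 a b c d) has_field_derivative 4 * of_real q * dist_sq2 a b c d) (at a within S)"
    unfolding dist_sq2_def dist_sq1_def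
    by (rule derivative_eq_intros refl)+ (simp add: algebra_simps power2_eq_square)
  show "((\<lambda>a. riem q a b c d) has_field_derivative riem1 q a b c d) (at a within S)"
    unfolding riem_def riem1_def by (rule DERIV_chain2[OF bessel_aux_deriv(1) 1])
  have "((\<lambda>a. riem1 q a b c d) has_field_derivative
     bessel_aux1 (4 * of_real q * dist_sq a b c d) * (4 * of_real q * dist_sq2 a b c d) +
     bessel_aux2 (4 * of_real q * dist_sq a b c d) * (4 * of_real q * dist_sq1 a b c d) * (4 * of_real q * dist_sq1 a b c d)) (at a within S)"
    unfolding riem1_def using DERIV_mult[OF DERIV_chain2[OF bessel_aux_deriv(2) 1] 2] by (simp add: mult.commute add.commute)
  then show "((\<lambda>a. riem1 q a b c d) has_field_derivative riem2 q a b c d) (at a within S)"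
    by (simp add: riem2_def power2_eq_square algebra_simps)
qed

lemma riem_continuous:
  fixes S :: "'a::t2_space set"
  assumes "continuous_on S f" "continuous_on S g" "continuous_on S h" "continuous_on S k"
  shows "continuous_on S (\<lambda>x. riem q (f x) (g x) (h x) (k x))"
   "continuous_on S (\<lambda>x. riem1 q (f x) (g x) (h x) (k x))"
   "continuous_on S (\<lambda>x. riem2 q (f x) (g x) (h x) (k x))"
proof -
  have c: "continuous_on S (\<lambda>x. 4 * of_real q * dist_sq (f x) (g x) (h x) (k x))"
    "continuous_on S (\<lambda>x. 4 * of_real q * dist_sq1 (f x) (g x) (h x) (k x))"
    "continuous_on S (\<lambda>x. 4 * of_real q * dist_sq2 (f x) (g x) (h x) (k x))"
    unfolding dist_sq_def dist_sq1_def dist_sq2_def by (intro continuous_intros assms)+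
  show "continuous_on S (\<lambda>x. riem q (f x) (g x) (h x) (k x))"
   "continuous_on S (\<lambda>x. riem1 q (f x) (g x) (h x) (k x))"
   "continuous_on S (\<lambda>x. riem2 q (f x) (g x) (h x) (k x))"
    unfolding riem_def riem1_def riem2_def
    by (intro continuous_on_add continuous_on_mult continuous_on_power c
          continuous_on_compose2[OF bessel_aux_continuous(1) c(1) subset_UNIV]
          continuous_on_compose2[OF bessel_aux_continuous(2) c(1) subset_UNIV]
          continuous_on_compose2[OF bessel_aux_continuous(3) c(1) subset_UNIV])+
qed

lemma riem_holomorphic: "(\<lambda>a. riem q a b c d) holomorphic_on S" "(\<lambda>b. riem q a b c d) holomorphic_on S"
proof -
  show 1: "(\<lambda>a. riem q a b c d) holomorphic_on S" for b c d
    unfolding holomorphic_on_def using riem_deriv(1) field_differentiable_def by blast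
  show "(\<lambda>b. riem q a b c d) holomorphic_on S" using 1[of a c d] by (simp add: riem_sym(1)[of q a])
qed

lemma complex_periodic: "cos (z + 2 * of_real pi) = cos (z::complex)" "sin (z + 2 * of_real pi) = sin (z::complex)"
proof -
  have "cos (z + of_real (2 * pi)) = cos z" "sin (z + of_real (2 * pi)) = sin z"
    by (simp_all only: cos_add sin_add cos_of_real sin_of_real cos_two_pi sin_two_pi) simp_all
  then show "cos (z + 2 * of_real pi) = cos z" "sin (z + 2 * of_real pi) = sin z" by simp_all
qed

lemma riem_periodic: "riem q (a + 2 * of_real pi) b c d = riem q a b c d" "riem1 q (a + 2 * of_real pi) b c d = riem1 q a b c d"
  "riem q a (b + 2 * of_real pi) c d = riem q a b c d"
  by (simp_all add: riem_def riem1_def dist_sq_def dist_sq1_def complex_periodic)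

lemma riem_par: "riem q (- a) (- b) c d = riem q a b c d" "riem q (- a) b c d = riem q a (- b) c d"
  by (simp_all add: riem_def dist_sq_def)

text \<open>With \<open>X\<close> the difference of the squared cosines, the squared gradients of
  \<open>dist_sq\<close> differ by \<open>- 4 * dist_sq a b c d * X\<close> and the second
  derivatives by \<open>- 4 * X\<close>. The two Bessel derivatives thus occur exactly in the
  combination that Bessel's equation replaces by \<open>- B / 4\<close>.\<close>

lemma riem_pde: "riem2 q a b c d - 2 * of_real q * cos (2 * a) * riem q a b c d =
   riem2 q b a c d - 2 * of_real q * cos (2 * b) * riem q a b c d"
proof -
  let ?r = "4 * of_real q * dist_sq a b c d"
  define B B1 B2 where "B = bessel_aux ?r" and "B1 = bessel_aux1 ?r" and "B2 = bessel_aux2 ?r"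
  have s: "dist_sq b a c d = dist_sq a b c d" by (simp add: dist_sq_def algebra_simps)
  define X where "X = (cos a)\<^sup>2 - (cos b)\<^sup>2"
  have pyth: "(sin z)\<^sup>2 = 1 - (cos z)\<^sup>2" for z :: complex by (simp add: sin_squared_eq)
  have A: "(dist_sq1 a b c d)\<^sup>2 - (dist_sq1 b a c d)\<^sup>2 = - 4 * dist_sq a b c d * X"
  proof -
    \<comment> \<open>Named as independent symbols, sines and cosines leave a polynomial identity
      modulo four Pythagorean relations.\<close>
    define A B C D where "A = cos a" and "B = cos b" and "C = cos c" and "D = cos d"
    define a' b' c' d' where "a' = sin a" and "b' = sin b" and "c' = sin c" and "d' = sin d"
    have *: "a'\<^sup>2 = 1 - A\<^sup>2" "b'\<^sup>2 = 1 - B\<^sup>2" "c'\<^sup>2 = 1 - C\<^sup>2" "d'\<^sup>2 = 1 - D\<^sup>2"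
      unfolding A_def B_def C_def D_def a'_def b'_def c'_def d'_def by (rule pyth)+
    have "(- 2 * A * a' + 2 * (a' * B * C * D) + 2 * (A * b' * c' * d'))\<^sup>2 -
       (- 2 * B * b' + 2 * (b' * A * C * D) + 2 * (B * a' * c' * d'))\<^sup>2 =
       - 4 * (A\<^sup>2 + B\<^sup>2 + C\<^sup>2 + D\<^sup>2 - 2 - 2 * (A * B * C * D) + 2 * (a' * b' * c' * d')) * (A\<^sup>2 - B\<^sup>2)"
      using * by algebra
    then show ?thesis
      unfolding dist_sq1_def dist_sq_def X_def A_def B_def C_def D_def a'_def b'_def c'_def d'_def by simp
  qed
  have Bd: "dist_sq2 a b c d - dist_sq2 b a c d = - 4 * X"
    by (simp add: dist_sq2_def X_def pyth algebra_simps)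
  have C: "cos (2 * a) - cos (2 * b) = 2 * X" by (simp add: cos_double_cos X_def)
  have ode: "?r * B2 + B1 + B / 4 = 0" unfolding B_def B1_def B2_def by (rule bessel_aux_ode)
  have "riem2 q a b c d - riem2 q b a c d =
      (4 * of_real q)\<^sup>2 * B2 * ((dist_sq1 a b c d)\<^sup>2 - (dist_sq1 b a c d)\<^sup>2) + 4 * of_real q * B1 * (dist_sq2 a b c d - dist_sq2 b a c d)"
    unfolding riem2_def s B_def B1_def B2_def by (simp add: algebra_simps power2_eq_square)
  also have "\<dots> = - 16 * of_real q * X * (?r * B2 + B1)"
    unfolding A Bd by (simp add: algebra_simps power2_eq_square)
  also have "?r * B2 + B1 = - B / 4" using ode by (simp add: eq_neg_iff_add_eq_0)
  also have "- 16 * of_real q * X * (- B / 4) = 2 * of_real q * (cos (2 * a) - cos (2 * b)) * riem q a b c d"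
    unfolding C by (simp add: riem_def B_def)
  finally show ?thesis by (simp add: algebra_simps)
qed

section \<open>Fourier coefficients of the Riemann function\<close>

definition riem_coeff :: "real \<Rightarrow> (complex \<Rightarrow> complex) \<Rightarrow> complex \<Rightarrow> complex \<Rightarrow> complex \<Rightarrow> complex" where
  "riem_coeff q u a c d = integral {0..2 * pi} (\<lambda>t. riem q a (of_real t) c d * u (of_real t))"

definition riem_coeff1 :: "real \<Rightarrow> (complex \<Rightarrow> complex) \<Rightarrow> complex \<Rightarrow> complex \<Rightarrow> complex \<Rightarrow> complex" where
  "riem_coeff1 q u a c d = integral {0..2 * pi} (\<lambda>t. riem1 q a (of_real t) c d * u (of_real t))"

lemma riem_coeff_sym: "riem_coeff q u a c d = riem_coeff q u c a d" "riem_coeff q u a c d = riem_coeff q u d c a"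
proof -
  have "riem q a t c d = riem q c t a d" "riem q a t c d = riem q d t c a" for t by (rule riem_sym)+
  then show "riem_coeff q u a c d = riem_coeff q u c a d" "riem_coeff q u a c d = riem_coeff q u d c a"
    unfolding riem_coeff_def by presburger+
qed

lemma riem_coeff_deriv:
  assumes u: "\<And>S. continuous_on S u"
  shows "((\<lambda>a. riem_coeff q u a c d) has_field_derivative riem_coeff1 q u a c d) (at a)"
    and "((\<lambda>a. riem_coeff1 q u a c d) has_field_derivative
      integral {0..2 * pi} (\<lambda>t. riem2 q a (of_real t) c d * u (of_real t))) (at a)"
proof -
  have cu: "continuous_on X (\<lambda>x. u (f x))" if "continuous_on X f" for f and X :: "'x::t2_space set"
    using continuous_on_compose2[OF u that subset_UNIV] .
  have "((\<lambda>a. integral (cbox 0 (2 * pi)) (\<lambda>t. riem q a (of_real t) c d * u (of_real t))) has_field_derivative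
     integral (cbox 0 (2 * pi)) (\<lambda>t. riem1 q a (of_real t) c d * u (of_real t))) (at a within UNIV)"
  proof (rule leibniz_rule_field_derivative)
    show "((\<lambda>a. riem q a (of_real t) c d * u (of_real t)) has_field_derivative riem1 q a (of_real t) c d * u (of_real t)) (at a within UNIV)" for a t
      by (rule DERIV_cmult_right[OF riem_deriv(1)])
    show "continuous_on (UNIV \<times> cbox 0 (2 * pi)) (\<lambda>(x, t). riem1 q x (of_real t) c d * u (of_real t))"
      unfolding split_beta by (intro continuous_on_mult riem_continuous cu continuous_intros)
    show "(\<lambda>t. riem q x (of_real t) c d * u (of_real t)) integrable_on cbox 0 (2 * pi)" for x
      by (intro integrable_continuous continuous_on_mult riem_continuous cu continuous_intros)
  qed auto
  then show "((\<lambda>a. riem_coeff q u a c d) has_field_derivative riem_coeff1 q u a c d) (at a)"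
    by (simp add: riem_coeff_def riem_coeff1_def)
  have "((\<lambda>a. integral (cbox 0 (2 * pi)) (\<lambda>t. riem1 q a (of_real t) c d * u (of_real t))) has_field_derivative
     integral (cbox 0 (2 * pi)) (\<lambda>t. riem2 q a (of_real t) c d * u (of_real t))) (at a within UNIV)"
  proof (rule leibniz_rule_field_derivative)
    show "((\<lambda>a. riem1 q a (of_real t) c d * u (of_real t)) has_field_derivative riem2 q a (of_real t) c d * u (of_real t)) (at a within UNIV)" for a t
      by (rule DERIV_cmult_right[OF riem_deriv(2)])
    show "continuous_on (UNIV \<times> cbox 0 (2 * pi)) (\<lambda>(x, t). riem2 q x (of_real t) c d * u (of_real t))"
      unfolding split_beta by (intro continuous_on_mult riem_continuous cu continuous_intros)
    show "(\<lambda>t. riem1 q x (of_real t) c d * u (of_real t)) integrable_on cbox 0 (2 * pi)" for x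
      by (intro integrable_continuous continuous_on_mult riem_continuous cu continuous_intros)
  qed auto
  then show "((\<lambda>a. riem_coeff1 q u a c d) has_field_derivative
      integral {0..2 * pi} (\<lambda>t. riem2 q a (of_real t) c d * u (of_real t))) (at a)"
    by (simp add: riem_coeff1_def)
qed

text \<open>\<open>riem_pde\<close> moves the operator from \<open>a\<close> to the integration
  variable, and two integrations by parts move it on to \<open>u\<close>. The boundary terms,
  collected in \<open>?F\<close>, cancel by periodicity.\<close>

lemma riem_coeff_sol:
  assumes u: "mathieu_sol q l u" and per: "\<And>z. u (z + 2 * of_real pi) = u z"
  shows "mathieu_sol q l (\<lambda>a. riem_coeff q u a c d)" "deriv (\<lambda>a. riem_coeff q u a c d) = (\<lambda>a. riem_coeff1 q u a c d)"
proof -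
  have hu: "u holomorphic_on UNIV" using u by (simp add: mathieu_sol_def)
  then have cu: "continuous_on S u" for S
    using holomorphic_on_imp_continuous_on holomorphic_on_subset by blast
  have per': "deriv u (z + 2 * of_real pi) = deriv u z" for z
    using DERIV_unique[OF mathieu_solD(1)[OF u, of "z + 2 * of_real pi" UNIV, unfolded DERIV_shift per] mathieu_solD(1)[OF u, of z UNIV]] .
  have "integral {0..2 * pi} (\<lambda>t. riem2 q a (of_real t) c d * u (of_real t)) =
    (2 * of_real q * cos (2 * a) - l) * riem_coeff q u a c d" for a
  proof -
    let ?F = "\<lambda>t. riem1 q t a c d * u t - riem q t a c d * deriv u t"
    have "(?F has_field_derivative riem2 q t a c d * u t - riem q t a c d * ((2 * of_real q * cos (2 * t) - l) * u t)) (at t)" for t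
      by (rule derivative_eq_intros riem_deriv mathieu_solD[OF u] refl)+ (simp add: algebra_simps)
    then have "((\<lambda>x. ?F (of_real x)) has_vector_derivative riem2 q (of_real t) a c d * u (of_real t) -
       riem q (of_real t) a c d * ((2 * of_real q * cos (2 * of_real t) - l) * u (of_real t))) (at t within {0..2 * pi})" for t
      by (rule has_vector_derivative_real_field)
    then have "((\<lambda>t. riem2 q (of_real t) a c d * u (of_real t) -
       riem q (of_real t) a c d * ((2 * of_real q * cos (2 * of_real t) - l) * u (of_real t))) has_integral
       (?F (of_real (2 * pi)) - ?F (of_real 0))) {0..2 * pi}"
      by (intro fundamental_theorem_of_calculus) auto
    moreover have "?F (of_real (2 * pi)) = ?F (of_real 0)"
      using riem_periodic(1)[of q 0 a c d] riem_periodic(2)[of q 0 a c d] per[of 0] per'[of 0] by simp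
    ultimately have 1: "((\<lambda>t. riem2 q (of_real t) a c d * u (of_real t) -
       riem q (of_real t) a c d * ((2 * of_real q * cos (2 * of_real t) - l) * u (of_real t))) has_integral 0) {0..2 * pi}"
      by simp
    have 2: "((\<lambda>t. (2 * of_real q * cos (2 * a) - l) * (riem q a (of_real t) c d * u (of_real t))) has_integral
        (2 * of_real q * cos (2 * a) - l) * riem_coeff q u a c d) {0..2 * pi}"
      unfolding riem_coeff_def
      by (intro has_integral_mult_right integrable_integral integrable_continuous_interval continuous_on_mult riem_continuous continuous_intros
         continuous_on_entire_compose[OF hu])
    have e: "riem2 q (of_real t) a c d * u (of_real t) -
       riem q (of_real t) a c d * ((2 * of_real q * cos (2 * of_real t) - l) * u (of_real t)) +
       (2 * of_real q * cos (2 * a) - l) * (riem q a (of_real t) c d * u (of_real t)) =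
       riem2 q a (of_real t) c d * u (of_real t)" for t
    proof -
      have r2: "riem2 q a (of_real t) c d = riem2 q (of_real t) a c d + (2 * of_real q * cos (2 * a) - 2 * of_real q * cos (2 * of_real t)) * riem q a (of_real t) c d"
        using riem_pde[of q a "of_real t" c d] by (simp add: algebra_simps)
      show ?thesis unfolding r2 riem_sym(1)[of q "of_real t" a c d] by (simp add: algebra_simps)
    qed
    from has_integral_add[OF 1 2] show ?thesis unfolding e by (simp add: integral_unique)
  qed
  note * = mathieu_solI[OF riem_coeff_deriv(1)[OF cu, where q = q and c = c and d = d]
      riem_coeff_deriv(2)[OF cu, where q = q and c = c and d = d, unfolded this]]
  show "mathieu_sol q l (\<lambda>a. riem_coeff q u a c d)" "deriv (\<lambda>a. riem_coeff q u a c d) = (\<lambda>a. riem_coeff1 q u a c d)"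
    using * .
qed

text \<open>In \<open>a\<close> the coefficient solves the equation of \<open>u\<close> and has its
  parity, so it is a multiple of \<open>u a\<close>; permuting the arguments of \<open>riem\<close>
  extracts \<open>u c\<close> and \<open>u d\<close> in the same way.\<close>

lemma riem_coeff_factor:
  assumes u: "mathieu_eigfun q ev n u"
  obtains D where "\<And>a c d. riem_coeff q u a c d = D * u a * u c * u d"
proof -
  note U = mathieu_eigfunD[OF u]
  have sol: "mathieu_sol q (of_real (mathieu_eig q ev n)) (\<lambda>a. riem_coeff q u a c d)" for c d
    by (rule riem_coeff_sol(1)[OF U(1,3)])
  have par: "riem_coeff q u (- a) c d = par ev * riem_coeff q u a c d" for a c d
  proof -
    let ?h = "\<lambda>t. riem q a t c d * u t"
    have "riem_coeff q u (- a) c d = integral {0..2 * pi} (\<lambda>t. par ev * ?h (- of_real t))"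
      unfolding riem_coeff_def riem_par(2) by (simp add: U(2) mult_ac)
    also have "\<dots> = par ev * integral {0..2 * pi} (\<lambda>t. ?h (- of_real t))" by simp
    also have "integral {0..2 * pi} (\<lambda>t. ?h (- of_real t)) = riem_coeff q u a c d"
      unfolding riem_coeff_def
      by (rule periodic_integral_reflect) (auto intro!: holomorphic_intros riem_holomorphic U simp: riem_periodic U(3))
    finally show ?thesis .
  qed
  obtain k where k: "\<And>z. u z = of_real k * mathieu_fund q ev (of_real (mathieu_eig q ev n)) z" "k \<noteq> 0"
    using mathieu_eigfun_repr[OF u] by blast
  obtain z0 :: real where z0: "mathieu_fund q ev (of_real (mathieu_eig q ev n)) (of_real z0) \<noteq> 0"
    using mathieu_fund_nonzero by blast
  define w where "w = complex_of_real z0"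
  have w: "u w \<noteq> 0" using k z0 by (simp add: w_def)
  have f: "riem_coeff q u a c d = riem_coeff q u w c d / u w * u a" for a c d
  proof -
    obtain C where C: "\<And>a. riem_coeff q u a c d = C * mathieu_fund q ev (of_real (mathieu_eig q ev n)) a"
      using mathieu_sol_par[OF sol par] by metis
    show ?thesis using w by (simp add: C k)
  qed
  have "riem_coeff q u a c d = riem_coeff q u w w w / u w ^ 3 * u a * u c * u d" for a c d
  proof -
    have "riem_coeff q u a c d = riem_coeff q u c w d / u w * u a"
      using f[of a c d] by (simp add: riem_coeff_sym(1)[of q u w c d])
    also have "riem_coeff q u c w d = riem_coeff q u d w w / u w * u c"
      using f[of c w d] by (simp add: riem_coeff_sym(2)[of q u w w d])
    also have "riem_coeff q u d w w = riem_coeff q u w w w / u w * u d" by (rule f)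
    finally show ?thesis by (simp add: power3_eq_cube)
  qed
  then show ?thesis by (rule that)
qed

section \<open>Riemann's method\<close>

text \<open>The mixed second derivative; it occurs because both arguments of the Riemann function
  move with the parameter \<open>s\<close> in \<open>riem_coeff_value\<close>.\<close>

definition dist_sq12 :: "complex \<Rightarrow> complex \<Rightarrow> complex \<Rightarrow> complex \<Rightarrow> complex" where
  "dist_sq12 a b c d = - 2 * (sin a * sin b * cos c * cos d) + 2 * (cos a * cos b * sin c * sin d)"

definition riem12 :: "real \<Rightarrow> complex \<Rightarrow> complex \<Rightarrow> complex \<Rightarrow> complex \<Rightarrow> complex" where
  "riem12 q a b c d = bessel_aux2 (4 * of_real q * dist_sq a b c d) * (4 * of_real q * dist_sq1 b a c d) * (4 * of_real q * dist_sq1 a b c d)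
     + bessel_aux1 (4 * of_real q * dist_sq a b c d) * (4 * of_real q * dist_sq12 a b c d)"

lemma dist_sq_sym: "dist_sq a b c d = dist_sq b a c d"
  by (simp add: dist_sq_def algebra_simps)

lemma riem_deriv_compose:
  assumes f: "(f has_field_derivative f') (at s)" and g: "(g has_field_derivative g') (at s)"
  shows "((\<lambda>s. riem q (f s) (g s) c d) has_field_derivative
      f' * riem1 q (f s) (g s) c d + g' * riem1 q (g s) (f s) c d) (at s)"
    and "((\<lambda>s. riem1 q (f s) (g s) c d) has_field_derivative
      f' * riem2 q (f s) (g s) c d + g' * riem12 q (f s) (g s) c d) (at s)"
proof -
  have 1: "((\<lambda>s. 4 * of_real q * dist_sq (f s) (g s) c d) has_field_derivative
      4 * of_real q * (f' * dist_sq1 (f s) (g s) c d + g' * dist_sq1 (g s) (f s) c d)) (at s)"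
    unfolding dist_sq_def dist_sq1_def
    by (rule derivative_eq_intros f g refl)+ (simp add: algebra_simps)
  have 2: "((\<lambda>s. 4 * of_real q * dist_sq1 (f s) (g s) c d) has_field_derivative
      4 * of_real q * (f' * dist_sq2 (f s) (g s) c d + g' * dist_sq12 (f s) (g s) c d)) (at s)"
    unfolding dist_sq12_def dist_sq1_def dist_sq2_def
    by (rule derivative_eq_intros f g refl)+ (simp add: algebra_simps power2_eq_square)
  show "((\<lambda>s. riem q (f s) (g s) c d) has_field_derivative
      f' * riem1 q (f s) (g s) c d + g' * riem1 q (g s) (f s) c d) (at s)"
    unfolding riem_def riem1_def using DERIV_chain2[OF bessel_aux_deriv(1) 1]
    by (simp add: algebra_simps dist_sq_sym[of "g s"])
  show "((\<lambda>s. riem1 q (f s) (g s) c d) has_field_derivative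
      f' * riem2 q (f s) (g s) c d + g' * riem12 q (f s) (g s) c d) (at s)"
    unfolding riem1_def riem2_def riem12_def using DERIV_mult[OF DERIV_chain2[OF bessel_aux_deriv(2) 1] 2]
    by (simp add: algebra_simps power2_eq_square)
qed

lemma riem12_continuous:
  fixes S :: "'a::t2_space set"
  assumes "continuous_on S f" "continuous_on S g" "continuous_on S h" "continuous_on S k"
  shows "continuous_on S (\<lambda>x. riem12 q (f x) (g x) (h x) (k x))"
proof -
  have c: "continuous_on S (\<lambda>x. 4 * of_real q * dist_sq (f x) (g x) (h x) (k x))"
    "continuous_on S (\<lambda>x. 4 * of_real q * dist_sq1 (f x) (g x) (h x) (k x))"
    "continuous_on S (\<lambda>x. 4 * of_real q * dist_sq1 (g x) (f x) (h x) (k x))"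
    "continuous_on S (\<lambda>x. 4 * of_real q * dist_sq12 (f x) (g x) (h x) (k x))"
    unfolding dist_sq_def dist_sq1_def dist_sq12_def by (intro continuous_intros assms)+
  show ?thesis
    unfolding riem12_def
    by (intro continuous_on_add continuous_on_mult c
          continuous_on_compose2[OF bessel_aux_continuous(2) c(1) subset_UNIV]
          continuous_on_compose2[OF bessel_aux_continuous(3) c(1) subset_UNIV])
qed

text \<open>\<open>dist_sq a b c d = (cos (a + b) - cos (c + d)) * (cos (a - b) - cos (c - d))\<close>, so the lines
  \<open>a + b = c + d\<close> and \<open>a - b = c - d\<close> are the characteristics, on which the Riemann function equals \<open>1\<close>.\<close>

lemma riem_characteristic:
  assumes "a + b = 2 * w \<or> a = b"
  shows "riem q a b w w = 1"
proof -
  have "dist_sq a b w w = (cos (a + b) - cos (w + w)) * (cos (a - b) - cos (w - w))"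
  proof -
    have "(sin a)\<^sup>2 = 1 - (cos a)\<^sup>2" "(sin b)\<^sup>2 = 1 - (cos b)\<^sup>2" "(sin w)\<^sup>2 = 1 - (cos w)\<^sup>2"
      by (rule sin_squared_eq)+
    then show ?thesis unfolding dist_sq_def cos_add cos_diff by algebra
  qed
  also have "\<dots> = 0"
  proof -
    have "a + b = w + w \<or> a - b = w - w" using assms by (simp only: mult_2 diff_self right_minus_eq)
    then show ?thesis by (metis diff_self mult_zero_left mult_zero_right)
  qed
  finally show ?thesis
    by (simp add: riem_def bessel_aux_def eval_fps_at_0 bessel_fps_def)
qed

text \<open>The infinitesimal form of \<open>riem_characteristic\<close>: differentiating the
  constant \<open>1\<close> along \<open>a + b = 2 * w\<close> makes the two first derivatives
  equal; along \<open>a = b\<close> their sum vanishes, hence by symmetry each of them.\<close>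

lemma riem1_characteristic:
  "riem1 q (w + s) (w - s) w w = riem1 q (w - s) (w + s) w w"
  "riem1 q a a w w = 0"
proof -
  define x y where "x = w + s" and "y = w - s"
  have "dist_sq1 x y w w - dist_sq1 y x w w = 2 * sin (x - y) * (cos (w + w) - cos (x + y))"
  proof -
    have "(sin x)\<^sup>2 = 1 - (cos x)\<^sup>2" "(sin y)\<^sup>2 = 1 - (cos y)\<^sup>2" by (rule sin_squared_eq)+
    then show ?thesis unfolding dist_sq1_def cos_add sin_diff by algebra
  qed
  also have "\<dots> = 0" by (simp add: x_def y_def)
  finally have "dist_sq1 x y w w = dist_sq1 y x w w" by simp
  then show "riem1 q (w + s) (w - s) w w = riem1 q (w - s) (w + s) w w"
    by (simp add: riem1_def dist_sq_sym[of "w + s"] x_def y_def)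
  have "(sin w)\<^sup>2 = 1 - (cos w)\<^sup>2" by (rule sin_squared_eq)
  then have "dist_sq1 a a w w = 0" for a
    unfolding dist_sq1_def by algebra
  then show "riem1 q a a w w = 0" by (simp add: riem1_def)
qed

text \<open>Riemann's representation at the point \<open>(w, w)\<close>. The segments at height
  \<open>b = w - s\<close> from \<open>a = w - s\<close> to \<open>a = w + s\<close> sweep the
  characteristic triangle with that vertex, and \<open>H s\<close> integrates the closed form
  \<open>Jb da + Ja db\<close> along such a segment. All data are entire and \<open>w\<close> may be
  complex, so instead of Stokes' theorem \<open>H\<close> is differentiated in a complex variable
  \<open>s\<close>: only end point terms remain, where the Riemann function is \<open>1\<close>. At
  \<open>s = pi\<close> the segment is a full period and \<open>H\<close> becomes a Fourier
  coefficient.\<close>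

lemma riem_coeff_value:
  assumes u: "mathieu_eigfun q ev n u" and v: "mathieu_sol q (of_real (mathieu_eig q ev n)) v"
    and e: "e = par ev * (- 1) ^ n" and vs: "\<And>z. v (z + of_real pi) = \<sigma> * u z + e * v z"
    and D: "\<And>a c d. riem_coeff q u a c d = D * u a * u c * u d"
  shows "D * wronskian u v 0 = 2 * e * \<sigma>"
proof -
  note U = mathieu_eigfunD[OF u]
  let ?l = "complex_of_real (mathieu_eig q ev n)"
  define u' v' where "u' = deriv u" and "v' = deriv v"
  have du: "(u has_field_derivative u' z) (at z within S)"
    "(u' has_field_derivative (2 * of_real q * cos (2 * z) - ?l) * u z) (at z within S)" for z S
    using mathieu_solD[OF U(1)] by (simp_all add: u'_def)
  have dv: "(v has_field_derivative v' z) (at z within S)"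
    "(v' has_field_derivative (2 * of_real q * cos (2 * z) - ?l) * v z) (at z within S)" for z S
    using mathieu_solD[OF v] by (simp_all add: v'_def)
  have hol: "u holomorphic_on UNIV" "u' holomorphic_on UNIV" "v holomorphic_on UNIV" "v' holomorphic_on UNIV"
    unfolding holomorphic_on_def field_differentiable_def using du dv by blast+
  obtain w where w: "u w \<noteq> 0" using U(7) by fastforce
  define R where "R a b = riem q a b w w" for a b
  define Ra where "Ra a b = riem1 q a b w w" for a b
  define Rb where "Rb a b = riem1 q b a w w" for a b
  define Jb where "Jb a b = R a b * u a * v' b - u a * v b * Rb a b" for a b
  define Ja where "Ja a b = R a b * u' a * v b - u a * v b * Ra a b" for a b
  define Jba where "Jba a b = Ra a b * u a * v' b + R a b * u' a * v' b - u' a * v b * Rb a b - u a * v b * riem12 q b a w w" for a b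
  define Jbb where "Jbb a b = R a b * u a * ((2 * of_real q * cos (2 * b) - ?l) * v b) - u a * v b * riem2 q b a w w" for a b
  have dR: "((\<lambda>s. R (f s) (g s)) has_field_derivative f' * Ra (f s) (g s) + g' * Rb (f s) (g s)) (at s)"
    "((\<lambda>s. Ra (f s) (g s)) has_field_derivative f' * riem2 q (f s) (g s) w w + g' * riem12 q (f s) (g s) w w) (at s)"
    "((\<lambda>s. Rb (f s) (g s)) has_field_derivative g' * riem2 q (g s) (f s) w w + f' * riem12 q (g s) (f s) w w) (at s)"
    if "(f has_field_derivative f') (at s)" "(g has_field_derivative g') (at s)" for f g f' g' s
    unfolding R_def Ra_def Rb_def using riem_deriv_compose that by blast+
  have chain: "((\<lambda>s. u (f s)) has_field_derivative u' (f s) * f') (at s)"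
    "((\<lambda>s. u' (f s)) has_field_derivative (2 * of_real q * cos (2 * f s) - ?l) * u (f s) * f') (at s)"
    "((\<lambda>s. v (f s)) has_field_derivative v' (f s) * f') (at s)"
    "((\<lambda>s. v' (f s)) has_field_derivative (2 * of_real q * cos (2 * f s) - ?l) * v (f s) * f') (at s)"
    if "(f has_field_derivative f') (at s)" for f f' s
    using DERIV_chain2[OF du(1) that] DERIV_chain2[OF du(2) that] DERIV_chain2[OF dv(1) that] DERIV_chain2[OF dv(2) that] .
  have r2: "riem2 q a b w w = riem2 q b a w w + (2 * of_real q * cos (2 * a) - 2 * of_real q * cos (2 * b)) * R a b" for a b
    using riem_pde[of q a b w w] by (simp add: R_def algebra_simps)
  have cu: "continuous_on X (\<lambda>x. u (f x))" "continuous_on X (\<lambda>x. u' (f x))" "continuous_on X (\<lambda>x. v (f x))" "continuous_on X (\<lambda>x. v' (f x))"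
    if "continuous_on X f" for f and X :: "'x::t2_space set"
    using continuous_on_entire_compose[OF hol(1) that] continuous_on_entire_compose[OF hol(2) that]
      continuous_on_entire_compose[OF hol(3) that] continuous_on_entire_compose[OF hol(4) that] by auto
  have cJ: "continuous_on X (\<lambda>x. Jb (f x) (g x))" "continuous_on X (\<lambda>x. Jba (f x) (g x))" "continuous_on X (\<lambda>x. Jbb (f x) (g x))"
    if "continuous_on X f" "continuous_on X g" for f g and X :: "'x::t2_space set"
    unfolding Jb_def Jba_def Jbb_def R_def Ra_def Rb_def
    by (intro continuous_on_add continuous_on_diff continuous_on_mult continuous_on_cos continuous_on_const
          riem_continuous riem12_continuous cu that)+
  \<comment> \<open>\<theta> maps \<open>{0..2 * pi}\<close> affinely onto \<open>{- 1..1}\<close>,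
    so that the range of integration does not depend on \<open>s\<close>; the factor
    \<open>s / pi\<close> in \<open>G\<close> is the derivative of the first argument in
    \<open>t\<close>.\<close>
  define \<theta> where "\<theta> z = (z - of_real pi) / of_real pi" for z :: complex
  have d\<theta>: "(\<theta> has_field_derivative 1 / of_real pi) (at z)" for z
    unfolding \<theta>_def by (rule derivative_eq_intros refl)+ (simp_all add: divide_simps)
  define G where "G s t = s / of_real pi * Jb (w + s * \<theta> (of_real t)) (w - s)" for s and t :: real
  define G' where "G' s t = 1 / of_real pi * (Jb (w + s * \<theta> (of_real t)) (w - s) +
     s * \<theta> (of_real t) * Jba (w + s * \<theta> (of_real t)) (w - s) - s * Jbb (w + s * \<theta> (of_real t)) (w - s))" for s and t :: real
  define H where "H s = integral {0..2 * pi} (G s)" for s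
  have dG: "((\<lambda>s. G s t) has_field_derivative G' s t) (at s within UNIV)" for s t
  proof -
    define f where "f s = w + s * \<theta> (of_real t)" for s
    define g where "g s = w - s" for s
    have f: "(f has_field_derivative \<theta> (of_real t)) (at s)" unfolding f_def by (rule derivative_eq_intros refl)+ simp
    have g: "(g has_field_derivative - 1) (at s)" unfolding g_def by (rule derivative_eq_intros refl)+ simp
    have J: "((\<lambda>s. Jb (f s) (g s)) has_field_derivative
       \<theta> (of_real t) * Jba (f s) (g s) - Jbb (f s) (g s)) (at s)"
      unfolding Jb_def
      by (rule derivative_eq_intros dR[OF f g] chain[OF f] chain[OF g] refl)+
         (simp add: Jba_def Jbb_def algebra_simps)
    have "((\<lambda>s. s / of_real pi * Jb (f s) (g s)) has_field_derivative
       1 / of_real pi * (Jb (f s) (g s) + s * \<theta> (of_real t) * Jba (f s) (g s) - s * Jbb (f s) (g s))) (at s)"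
      using DERIV_mult[OF DERIV_cdivide[OF DERIV_ident] J] by (rule DERIV_cong) (simp add: field_simps)
    then show ?thesis by (simp add: G_def G'_def f_def g_def)
  qed
  have c\<theta>: "continuous_on X (\<lambda>x. \<theta> (f x))" if "continuous_on X f" for f and X :: "'x::t2_space set"
    unfolding \<theta>_def using that by (intro continuous_intros) auto
  have dH: "(H has_field_derivative integral {0..2 * pi} (G' s)) (at s)" for s
  proof -
    have "((\<lambda>s. integral (cbox 0 (2 * pi)) (G s)) has_field_derivative integral (cbox 0 (2 * pi)) (G' s)) (at s within UNIV)"
    proof (rule leibniz_rule_field_derivative)
      show "continuous_on (UNIV \<times> cbox 0 (2 * pi)) (\<lambda>(x, t). G' x t)"
        unfolding split_beta G'_def
        by (intro continuous_on_add continuous_on_diff continuous_on_mult cJ c\<theta> continuous_on_const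
              continuous_on_of_real continuous_on_fst continuous_on_snd continuous_on_id)
      show "G s integrable_on cbox 0 (2 * pi)" for s
        unfolding G_def
        by (intro integrable_continuous continuous_on_add continuous_on_diff continuous_on_mult cJ c\<theta> continuous_on_const
              continuous_on_of_real continuous_on_fst continuous_on_snd continuous_on_id)
    qed (rule dG, auto)
    then show ?thesis by (simp add: H_def[abs_def])
  qed
  \<comment> \<open>Since the form is closed, \<open>G' s\<close> is the \<open>t\<close>-derivative
    of \<open>?K\<close>, and the integral reduces to the two ends of the segment, which lie on
    characteristics.\<close>
  have iG: "integral {0..2 * pi} (G' s) = u (w + s) * v' (w - s) - u' (w + s) * v (w - s) +
      (u (w - s) * v' (w - s) + u' (w - s) * v (w - s))" for s
  proof -
    let ?K = "\<lambda>z. \<theta> z * Jb (w + s * \<theta> z) (w - s) - Ja (w + s * \<theta> z) (w - s)"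
    have "((\<lambda>t. ?K (of_real t)) has_vector_derivative G' s t) (at t within {0..2 * pi})" for t
    proof (rule has_vector_derivative_real_field)
      define f where "f z = w + s * \<theta> z" for z
      define g :: "complex \<Rightarrow> complex" where "g z = w - s" for z
      have f: "(f has_field_derivative s / of_real pi) (at z)" for z
        unfolding f_def by (rule derivative_eq_intros d\<theta> refl)+ simp
      have g: "(g has_field_derivative 0) (at z)" for z unfolding g_def by (rule derivative_eq_intros refl)+
      have J: "((\<lambda>z. Jb (f z) (g z)) has_field_derivative s / of_real pi * Jba (f z) (g z)) (at z)" for z
        unfolding Jb_def
        by (rule derivative_eq_intros dR[OF f g] chain[OF f] chain[OF g] refl)+
           (simp add: Jba_def field_simps)
      have Ja: "((\<lambda>z. Ja (f z) (g z)) has_field_derivative s / of_real pi * Jbb (f z) (g z)) (at z)" for z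
        unfolding Ja_def
        by (rule derivative_eq_intros dR[OF f g] chain[OF f] chain[OF g] refl)+
           (simp add: Jbb_def r2[of "f z" "g z"] field_simps)
      have "((\<lambda>z. \<theta> z * Jb (f z) (g z) - Ja (f z) (g z)) has_field_derivative
          1 / of_real pi * (Jb (f z) (g z) + s * \<theta> z * Jba (f z) (g z) - s * Jbb (f z) (g z))) (at z)" for z
        using DERIV_diff[OF DERIV_mult[OF d\<theta> J] Ja] by (rule DERIV_cong) (simp add: field_simps)
      from this[of "of_real t"] show "(?K has_field_derivative G' s t) (at (of_real t))"
        by (simp add: G'_def f_def g_def)
    qed
    then have "(G' s has_integral (?K (of_real (2 * pi)) - ?K (of_real 0))) {0..2 * pi}"
      by (intro fundamental_theorem_of_calculus) auto
    moreover have "\<theta> (of_real (2 * pi)) = 1" "\<theta> (of_real 0) = - 1" by (simp_all add: \<theta>_def)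
    ultimately have "integral {0..2 * pi} (G' s) = Jb (w + s) (w - s) - Ja (w + s) (w - s) + (Jb (w - s) (w - s) + Ja (w - s) (w - s))"
      by (simp add: integral_unique)
    also have "R (w + s) (w - s) = 1" "R (w - s) (w - s) = 1"
      unfolding R_def by (rule riem_characteristic; simp)+
    moreover have "Ra (w + s) (w - s) = Rb (w + s) (w - s)" "Ra (w - s) (w - s) = 0" "Rb (w - s) (w - s) = 0"
      unfolding Ra_def Rb_def by (simp_all add: riem1_characteristic)
    ultimately show ?thesis by (simp add: Jb_def Ja_def algebra_simps)
  qed
  \<comment> \<open>The two products are chosen so that their derivative is the negative of the end
    point terms in \<open>iG\<close>.\<close>
  define E where "E s = H s + u (w + s) * v (w - s) + u (w - s) * v (w - s)" for s
  have "(E has_field_derivative 0) (at s)" for s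
  proof -
    define f where "f s = w + s" for s
    define g where "g s = w - s" for s
    have f: "(f has_field_derivative 1) (at s)" unfolding f_def by (rule derivative_eq_intros refl)+ simp
    have g: "(g has_field_derivative - 1) (at s)" unfolding g_def by (rule derivative_eq_intros refl)+ simp
    have "((\<lambda>s. H s + u (f s) * v (g s) + u (g s) * v (g s)) has_field_derivative 0) (at s)"
      by (rule derivative_eq_intros dH chain[OF f] chain[OF g] refl)+
         (simp only: iG f_def g_def, simp add: algebra_simps)
    then show ?thesis by (simp add: E_def[abs_def] f_def g_def)
  qed
  then obtain K where "\<And>s. E s = K"
    using has_field_derivative_zero_constant[of UNIV E] by auto
  then have E: "E (of_real pi) = E 0" by simp
  define b where "b = w - of_real pi"
  have R1: "riem_coeff1 q u b w w = D * u' b * u w * u w"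
  proof -
    have "((\<lambda>a. riem_coeff q u a w w) has_field_derivative riem_coeff1 q u b w w) (at b)"
      by (rule riem_coeff_deriv(1)) (rule U)
    moreover have "((\<lambda>a. riem_coeff q u a w w) has_field_derivative D * u' b * u w * u w) (at b)"
      unfolding D by (rule derivative_eq_intros du refl)+ simp
    ultimately show ?thesis by (rule DERIV_unique)
  qed
  have "H (of_real pi) = integral {0..2 * pi} (\<lambda>t. Jb (b + of_real t) b)"
  proof -
    have "w + of_real pi * \<theta> z = b + z" for z by (simp add: \<theta>_def b_def)
    then show ?thesis by (simp add: H_def G_def[abs_def] flip: b_def)
  qed
  also have "\<dots> = integral {0..2 * pi} (\<lambda>t. Jb (of_real t) b)"
  proof (rule periodic_integral_shift[of "\<lambda>z. Jb z b"])
    show "(\<lambda>z. Jb z b) holomorphic_on UNIV"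
    proof -
      have "(\<lambda>z. Rb z b) holomorphic_on UNIV"
        unfolding holomorphic_on_def field_differentiable_def
        using dR(3)[OF DERIV_ident DERIV_const[of b]] by blast
      then show ?thesis unfolding Jb_def R_def
        by (intro holomorphic_intros riem_holomorphic hol)
    qed
    show "Jb (z + 2 * of_real pi) b = Jb z b" for z
      by (simp add: Jb_def R_def Rb_def riem_periodic U(3) riem1_def dist_sq_def dist_sq1_def complex_periodic)
  qed
  also have "\<dots> = integral {0..2 * pi} (\<lambda>t. v' b * (riem q b (of_real t) w w * u (of_real t)) - v b * (riem1 q b (of_real t) w w * u (of_real t)))"
    by (simp add: Jb_def R_def Rb_def riem_sym(1)[of q _ b] mult_ac)
  also have "\<dots> = v' b * riem_coeff q u b w w - v b * riem_coeff1 q u b w w"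
    unfolding riem_coeff_def riem_coeff1_def
    by (intro integral_unique has_integral_diff has_integral_mult_right integrable_integral integrable_continuous_interval
          continuous_on_mult riem_continuous cu continuous_on_const continuous_on_of_real continuous_on_id)
  also have "\<dots> = D * u w * u w * (u b * v' b - u' b * v b)"
    unfolding R1 D by (simp add: algebra_simps)
  also have "u b * v' b - u' b * v b = wronskian u v 0"
    using wronskian_const[OF U(1) v, of b 0] by (simp add: wronskian_def u'_def v'_def)
  finally have Hpi: "H (of_real pi) = D * u w * u w * wronskian u v 0" .
  have ee: "e * e = 1" unfolding e by (simp add: par_def power_mult_distrib[symmetric] flip: power_add mult_2)
  have "u (b + of_real pi) = e * u b" unfolding e by (rule mathieu_eigfun_shift_pi[OF u])
  then have "e * u w = (e * e) * u b" by (simp add: b_def)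
  then have ub: "u b = e * u w" using ee by simp
  have uw: "u (w + of_real pi) = e * u w" unfolding e by (rule mathieu_eigfun_shift_pi[OF u])
  have "v (b + of_real pi) = \<sigma> * u b + e * v b" by (rule vs)
  then have "e * v w = e * \<sigma> * u b + (e * e) * v b" by (simp add: b_def algebra_simps)
  then have "e * v w = (e * e) * \<sigma> * u w + (e * e) * v b" by (simp add: ub mult_ac)
  then have vb: "v b = e * v w - \<sigma> * u w" using ee by (simp add: algebra_simps)
  have "H 0 = 0" by (simp add: H_def G_def[abs_def])
  \<comment> \<open>Constancy of \<open>E\<close> between \<open>0\<close> and \<open>pi\<close>.
    After inserting the multiplier relations for \<open>u\<close> and \<open>v\<close> the products
    \<open>u w * v w\<close> cancel because \<open>e * e = 1\<close>, and the term with \<sigma> is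
    what remains.\<close>
  then have "D * u w * u w * wronskian u v 0 + e * u w * v b + u b * v b = 2 * (u w * v w)"
    using E by (simp add: E_def Hpi uw b_def)
  then have "D * u w * u w * wronskian u v 0 + 2 * (e * e) * u w * v w - 2 * e * \<sigma> * u w * u w = 2 * (u w * v w)"
    unfolding ub vb by (simp add: algebra_simps)
  then have "(u w * u w) * (D * wronskian u v 0) = (u w * u w) * (2 * e * \<sigma>)"
    using ee by (simp add: algebra_simps)
  then show ?thesis using w by simp
qed

section \<open>Identification with the connection coefficient\<close>

lemma linearly_independent_wronskian:
  assumes u: "mathieu_sol q l u" and v: "mathieu_sol q l v" and W: "wronskian u v 0 \<noteq> 0"
  shows "linearly_independent2 u v"
  unfolding linearly_independent2_def
proof (intro allI impI)
  fix \<alpha> \<beta> assume "\<forall>z. \<alpha> * u z + \<beta> * v z = 0"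
  then have z: "(\<lambda>z. \<alpha> * u z + \<beta> * v z) = (\<lambda>z. 0)" by auto
  have "((\<lambda>z. \<alpha> * u z + \<beta> * v z) has_field_derivative \<alpha> * deriv u 0 + \<beta> * deriv v 0) (at 0)"
    by (intro DERIV_add DERIV_cmult mathieu_solD(1)[OF u] mathieu_solD(1)[OF v])
  then have d: "\<alpha> * deriv u 0 + \<beta> * deriv v 0 = 0" unfolding z using DERIV_unique DERIV_const by blast
  have e: "\<alpha> * u 0 + \<beta> * v 0 = 0" using fun_cong[OF z, of 0] .
  have "\<alpha> * wronskian u v 0 = (\<alpha> * u 0 + \<beta> * v 0) * deriv v 0 - (\<alpha> * deriv u 0 + \<beta> * deriv v 0) * v 0"
    "\<beta> * wronskian u v 0 = (\<alpha> * deriv u 0 + \<beta> * deriv v 0) * u 0 - (\<alpha> * u 0 + \<beta> * v 0) * deriv u 0"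
    by (simp_all add: wronskian_def algebra_simps)
  then have "\<alpha> * wronskian u v 0 = 0" "\<beta> * wronskian u v 0 = 0" unfolding d e by simp_all
  then show "\<alpha> = 0 \<and> \<beta> = 0" using W by simp
qed

lemma wronskian_nonzero:
  assumes u: "mathieu_sol q l u" and v: "mathieu_sol q l v" and li: "linearly_independent2 u v"
  shows "wronskian u v 0 \<noteq> 0"
proof
  assume W: "wronskian u v 0 = 0"
  have 1: "\<alpha> = 0 \<and> \<beta> = 0" if "\<alpha> * u 0 + \<beta> * v 0 = 0" "\<alpha> * deriv u 0 + \<beta> * deriv v 0 = 0" for \<alpha> \<beta>
  proof -
    have "\<alpha> * u z + \<beta> * v z = 0" for z
    proof -
      have "\<alpha> * u z + \<beta> * v z = (\<alpha> * u 0 + \<beta> * v 0) * mathieu_fund q True l z +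
          (\<alpha> * deriv u 0 + \<beta> * deriv v 0) * mathieu_fund q False l z"
        by (subst (1) mathieu_sol_repr[OF u], subst (1) mathieu_sol_repr[OF v]) (simp add: algebra_simps)
      then show ?thesis using that by simp
    qed
    then show ?thesis using li unfolding linearly_independent2_def by blast
  qed
  have "u 0 = 0" using 1[of "v 0" "- u 0"] W by (simp add: wronskian_def algebra_simps)
  moreover have "deriv u 0 = 0" using 1[of "deriv v 0" "- deriv u 0"] W by (simp add: wronskian_def algebra_simps)
  ultimately show False using 1[of 1 0] by simp
qed

text \<open>\<open>riem_coeff_value\<close> shows that every admissible second solution yields
  \<open>D\<close>. Existence is witnessed by the fundamental solution of the opposite parity: since
  \<open>disc\<close> vanishes, the Wronskian at \<open>pi\<close> forces it to have the same
  multiplier as \<open>u\<close>. The separate index \<open>N\<close> absorbs the shift between the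
  two numberings of the odd family.\<close>

lemma connection_coefficient_eq:
  assumes u: "mathieu_eigfun q ev n u"
    and D: "\<And>a c d. riem_coeff q u a c d = D * u a * u c * u d"
    and N: "(- 1) ^ N = par ev * (- 1) ^ n"
  shows "connection_coefficient N q (mathieu_eig q ev n) u = D"
  unfolding connection_coefficient_def mathieu_solution_iff
proof (rule the_equality)
  note U = mathieu_eigfunD[OF u]
  let ?l = "complex_of_real (mathieu_eig q ev n)"
  fix m assume "\<exists>v \<sigma>. mathieu_sol q ?l v \<and> linearly_independent2 u v \<and>
     (\<forall>z. v (z + of_real pi) = \<sigma> * u z + (- 1) ^ N * v z) \<and> m = 2 * (- 1) ^ N * \<sigma> / wronskian u v 0"
  then obtain v \<sigma> where v: "mathieu_sol q ?l v" "linearly_independent2 u v"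
     "\<And>z. v (z + of_real pi) = \<sigma> * u z + (- 1) ^ N * v z" "m = 2 * (- 1) ^ N * \<sigma> / wronskian u v 0" by blast
  have "D * wronskian u v 0 = 2 * (- 1) ^ N * \<sigma>"
    using riem_coeff_value[OF u v(1) N v(3) D] .
  then have "m * wronskian u v 0 = D * wronskian u v 0"
    using v(4) wronskian_nonzero[OF U(1) v(1,2)] by simp
  then show "m = D" using wronskian_nonzero[OF U(1) v(1,2)] by simp
next
  note U = mathieu_eigfunD[OF u]
  let ?l = "complex_of_real (mathieu_eig q ev n)"
  let ?v = "mathieu_fund q (\<not> ev) ?l"
  obtain c :: real where c: "c \<noteq> 0" "\<And>z. u z = of_real c * mathieu_fund q ev ?l z"
    using mathieu_eigfun_repr[OF u] by blast
  have u': "deriv u = (\<lambda>z. of_real c * mathieu_fund' q ev ?l z)"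
  proof -
    have "u = (\<lambda>z. of_real c * mathieu_fund q ev ?l z)" using c(2) by auto
    then have "deriv u = deriv (\<lambda>z. of_real c * mathieu_fund q ev ?l z)" by (rule arg_cong)
    then show ?thesis
      by (simp only: mathieu_sol_cmult(2)[OF mathieu_sol_fund[of q ?l ev]] deriv_mathieu_fund)
  qed
  have W: "wronskian u ?v 0 = of_real c * par ev"
    using c(1) by (cases ev) (simp_all add: wronskian_def u' c(2) deriv_mathieu_fund mathieu_fund_0 par_def)
  \<comment> \<open>The component of the shifted \<open>?v\<close> along \<open>u\<close> is read
    off at \<open>pi\<close>, from the value in the even case and from the derivative in the odd
    one; dividing by \<open>c\<close> accounts for the scaling of \<open>u\<close>.\<close>
  let ?\<sigma> = "(if ev then ?v (of_real pi) else deriv ?v (of_real pi)) / of_real c"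
  have cd: "codisc q ev ?l = (- 1) ^ N" using codisc_eig[of ev q n, symmetric] N by simp
  have disc0: "disc q ev ?l = 0" by (rule mathieu_eig)
  have "mathieu_fund q True ?l (of_real pi) * mathieu_fund' q False ?l (of_real pi) -
      mathieu_fund' q True ?l (of_real pi) * mathieu_fund q False ?l (of_real pi) = 1"
    using wronskian_const[OF mathieu_sol_fund mathieu_sol_fund, of q True ?l False "of_real pi" 0]
    by (simp add: wronskian_def deriv_mathieu_fund mathieu_fund_0)
  then have sq2: "(- 1) ^ N * (if ev then deriv ?v (of_real pi) else ?v (of_real pi)) = 1"
    using cd disc0 by (cases ev) (simp_all add: codisc_def disc_def deriv_mathieu_fund mult.commute)
  have sq1: "(- 1 :: complex) ^ N * (- 1) ^ N = 1" by (simp add: power_mult_distrib[symmetric])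
  have b: "(if ev then deriv ?v (of_real pi) else ?v (of_real pi)) = (- 1) ^ N"
  proof -
    have "x = p" if "p * x = 1" "p * p = 1" for p x :: complex
    proof -
      have "x = (p * p) * x" using that by simp
      also have "\<dots> = p * (p * x)" by (simp only: mult.assoc)
      finally show ?thesis using that by simp
    qed
    then show ?thesis using sq1 sq2 by blast
  qed
  have vs: "?v (z + of_real pi) = ?\<sigma> * u z + (- 1) ^ N * ?v z" for z
    using mathieu_sol_repr[OF mathieu_sol_shift(1)[OF mathieu_sol_fund], of q "\<not> ev" ?l z] b c(1)
    by (cases ev) (simp_all add: mathieu_sol_shift(2)[OF mathieu_sol_fund] c(2))
  have W0: "wronskian u ?v 0 \<noteq> 0" using W c by simp
  have "D * wronskian u ?v 0 = 2 * (- 1) ^ N * ?\<sigma>"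
    by (rule riem_coeff_value[OF u mathieu_sol_fund N vs D])
  then have "D = 2 * (- 1) ^ N * ?\<sigma> / wronskian u ?v 0" by (simp only: nonzero_eq_divide_eq[OF W0])
  then show "\<exists>v \<sigma>. mathieu_sol q ?l v \<and> linearly_independent2 u v \<and>
     (\<forall>z. v (z + of_real pi) = \<sigma> * u z + (- 1) ^ N * v z) \<and> D = 2 * (- 1) ^ N * \<sigma> / wronskian u v 0"
    using linearly_independent_wronskian[OF U(1) mathieu_sol_fund W0] mathieu_sol_fund vs by blast
qed

section \<open>The reproducing kernel of a strip\<close>

text \<open>The periodic analogue of the Cauchy kernel: simple poles at the multiples of
  \<open>2 * pi\<close> with principal part \<open>1 / (\<i> * z)\<close> at \<open>0\<close>, and
  bounded away from the real line.\<close>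

definition strip_kernel :: "complex \<Rightarrow> complex" where
  "strip_kernel z = 1 / (1 - exp (- (\<i> * z)))"

lemma strip_kernel_denom: "Im z \<noteq> 0 \<Longrightarrow> 1 - exp (- (\<i> * z)) \<noteq> 0"
proof
  assume "Im z \<noteq> 0" "1 - exp (- (\<i> * z)) = 0"
  then have "norm (exp (- (\<i> * z))) = 1" by simp
  then have "exp (Im z) = 1" by (simp add: norm_exp_eq_Re)
  then show False using \<open>Im z \<noteq> 0\<close> by simp
qed

lemma strip_kernel_bound:
  assumes "\<bar>Im z\<bar> \<ge> 1"
  shows "norm (strip_kernel z) \<le> 2"
proof -
  have n: "norm (exp (- (\<i> * z))) = exp (Im z)" by (simp add: norm_exp_eq_Re)
  have "1 / 2 \<le> norm (1 - exp (- (\<i> * z)))"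
  proof (cases "Im z \<ge> 1")
    case True
    then have "exp (Im z) \<ge> 2" using exp_ge_add_one_self[of "Im z"] by linarith
    moreover have "norm (exp (- (\<i> * z))) - norm (1::complex) \<le> norm (1 - exp (- (\<i> * z)))"
      using norm_triangle_ineq2[of "exp (- (\<i> * z))" 1] by (simp add: norm_minus_commute)
    ultimately show ?thesis using n by simp
  next
    case False
    then have "Im z \<le> - 1" using assms by linarith
    then have "exp (- Im z) \<ge> 2" using exp_ge_add_one_self[of "- Im z"] by linarith
    then have "exp (Im z) \<le> 1 / 2" by (simp add: exp_minus field_simps)
    moreover have "norm (1::complex) - norm (exp (- (\<i> * z))) \<le> norm (1 - exp (- (\<i> * z)))"
      by (rule norm_triangle_ineq2)
    ultimately show ?thesis using n by simp
  qed
  then show ?thesis by (simp add: strip_kernel_def norm_divide divide_simps)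
qed

lemma exp_periodic: "exp (\<i> * (z + 2 * of_real pi)) = exp (\<i> * z)" "exp (- (\<i> * (z + 2 * of_real pi))) = exp (- (\<i> * z))"
proof -
  have "exp (\<i> * (z + 2 * of_real pi)) = exp (\<i> * z + 2 * of_real pi * \<i>)" by (simp add: algebra_simps)
  then show 1: "exp (\<i> * (z + 2 * of_real pi)) = exp (\<i> * z)" by (simp add: exp_add)
  then show "exp (- (\<i> * (z + 2 * of_real pi))) = exp (- (\<i> * z))" by (simp only: exp_minus)
qed

lemma strip_kernel_periodic: "strip_kernel (z + 2 * of_real pi) = strip_kernel z"
  by (simp only: strip_kernel_def exp_periodic)

lemma strip_kernel_holomorphic: "0 \<notin> Im ` S \<Longrightarrow> strip_kernel holomorphic_on S"
  unfolding strip_kernel_def using strip_kernel_denom by (intro holomorphic_intros) force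

text \<open>\<open>strip_kernel z\<close> is \<open>1\<close> minus \<open>\<i>\<close> times the derivative of the periodic function \<open>Ln (1 - exp (- \<i> * z))\<close> in the lower
  half plane, and \<open>- \<i>\<close> times the derivative of \<open>Ln (1 - exp (\<i> * z))\<close> in the upper one.\<close>

lemma strip_kernel_integral:
  "Im w < 0 \<Longrightarrow> ((\<lambda>x. strip_kernel (w + of_real x)) has_integral of_real (2 * pi)) {0..2 * pi}"
  "Im w > 0 \<Longrightarrow> ((\<lambda>x. strip_kernel (w + of_real x)) has_integral 0) {0..2 * pi}"
proof -
  have nonneg: "1 - e \<notin> \<real>\<^sub>\<le>\<^sub>0" if "norm e < 1" for e :: complex
    using that complex_Re_le_cmod[of e] by (auto simp: complex_nonpos_Reals_iff)
  assume w: "Im w < 0"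
  let ?L = "\<lambda>z. (w + z) - \<i> * Ln (1 - exp (- (\<i> * (w + z))))"
  have "((\<lambda>x. ?L (of_real x)) has_vector_derivative strip_kernel (w + of_real x)) (at x within {0..2 * pi})" for x
  proof (rule has_vector_derivative_real_field)
    let ?e = "exp (- (\<i> * (w + of_real x)))"
    have n: "norm ?e < 1" using w by (simp add: norm_exp_eq_Re)
    have "1 - ?e \<noteq> 0" using n by (metis eq_iff_diff_eq_0 norm_one less_irrefl)
    then have "1 - \<i> * (inverse (1 - ?e) * (\<i> * ?e)) = strip_kernel (w + of_real x)"
      by (simp add: strip_kernel_def field_simps)
    moreover have "(?L has_field_derivative 1 - \<i> * (inverse (1 - ?e) * (\<i> * ?e))) (at (of_real x))"
      using nonneg[OF n] by (auto intro!: derivative_eq_intros)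
    ultimately show "(?L has_field_derivative strip_kernel (w + of_real x)) (at (of_real x))" by simp
  qed
  then have "((\<lambda>x. strip_kernel (w + of_real x)) has_integral (?L (of_real (2 * pi)) - ?L (of_real 0))) {0..2 * pi}"
    by (intro fundamental_theorem_of_calculus) auto
  then show "((\<lambda>x. strip_kernel (w + of_real x)) has_integral of_real (2 * pi)) {0..2 * pi}"
    using exp_periodic(2)[of w] by simp
next
  have nonneg: "1 - e \<notin> \<real>\<^sub>\<le>\<^sub>0" if "norm e < 1" for e :: complex
    using that complex_Re_le_cmod[of e] by (auto simp: complex_nonpos_Reals_iff)
  assume w: "Im w > 0"
  let ?L = "\<lambda>z. - \<i> * Ln (1 - exp (\<i> * (w + z)))"
  have "((\<lambda>x. ?L (of_real x)) has_vector_derivative strip_kernel (w + of_real x)) (at x within {0..2 * pi})" for x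
  proof (rule has_vector_derivative_real_field)
    let ?e = "exp (\<i> * (w + of_real x))"
    have n: "norm ?e < 1" using w by (simp add: norm_exp_eq_Re)
    have "1 - ?e \<noteq> 0" using n by (metis eq_iff_diff_eq_0 norm_one less_irrefl)
    have "- \<i> * (inverse (1 - E) * (- (\<i> * E))) = 1 / (1 - inverse E)" if "E \<noteq> 0" "1 - E \<noteq> 0" for E :: complex
    proof -
      have "1 - inverse E = - (1 - E) / E" using that by (simp add: field_simps)
      then have "1 / (1 - inverse E) = - (E / (1 - E))" using that by (simp add: field_simps)
      then show ?thesis by (simp add: divide_inverse mult.left_commute[of "inverse (1 - E)"] mult.commute[of E])
    qed
    from this[OF exp_not_eq_zero \<open>1 - ?e \<noteq> 0\<close>]
    have "- \<i> * (inverse (1 - ?e) * (- (\<i> * ?e))) = strip_kernel (w + of_real x)"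
      by (simp only: strip_kernel_def exp_minus)
    moreover have "(?L has_field_derivative - \<i> * (inverse (1 - ?e) * (- (\<i> * ?e)))) (at (of_real x))"
      using nonneg[OF n] by (auto intro!: derivative_eq_intros)
    ultimately show "(?L has_field_derivative strip_kernel (w + of_real x)) (at (of_real x))" by simp
  qed
  then have "((\<lambda>x. strip_kernel (w + of_real x)) has_integral (?L (of_real (2 * pi)) - ?L (of_real 0))) {0..2 * pi}"
    by (intro fundamental_theorem_of_calculus) auto
  then show "((\<lambda>x. strip_kernel (w + of_real x)) has_integral 0) {0..2 * pi}"
    using exp_periodic(1)[of w] by simp
qed

text \<open>Cauchy's formula on a period strip, whose vertical sides cancel by periodicity.
  Subtracting \<open>g t\<close> times the kernel removes the pole, and the kernel alone integrates
  to \<open>2 * pi\<close> below \<open>t\<close> and to \<open>0\<close> above.\<close>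

lemma strip_formula:
  assumes g: "g holomorphic_on UNIV" and per: "\<And>z. g (z + 2 * of_real pi) = g z"
    and w: "Im w1 < Im t" "Im t < Im w2"
  shows "integral {0..2 * pi} (\<lambda>x. g (w1 + of_real x) * strip_kernel (w1 + of_real x - t)) -
     integral {0..2 * pi} (\<lambda>x. g (w2 + of_real x) * strip_kernel (w2 + of_real x - t)) = 2 * of_real pi * g t"
proof -
  let ?F = "\<lambda>z. g z * strip_kernel (z - t)"
  define h where "h z = (if z = t then deriv g t / \<i> else (g z - g t) * strip_kernel (z - t))" for z
  \<comment> \<open>Wide enough to contain a full period centred at \<open>t\<close>, and narrow
    enough to exclude the other poles, at nonzero multiples of \<open>2 * pi\<close> from
    \<open>t\<close>.\<close>
  define S where "S = {z. - (3 * pi / 2) < Re (z - t) \<and> Re (z - t) < 3 * pi / 2}"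
  have nz: "1 - exp (- (\<i> * (z - t))) \<noteq> 0" if "z \<in> S" "z \<noteq> t" for z
  proof
    assume "1 - exp (- (\<i> * (z - t))) = 0"
    then have "exp (- (\<i> * (z - t))) = 1" by simp
    then obtain n :: int where n: "Re (- (\<i> * (z - t))) = 0" "Im (- (\<i> * (z - t))) = of_int (2 * n) * pi"
      unfolding exp_eq_1 by auto
    have "\<bar>of_int n * pi\<bar> < 1 * pi"
      using that(1) n(2) by (auto simp: S_def)
    then have "\<bar>real_of_int n\<bar> < 1" by (simp add: abs_mult del: mult_1)
    then have "n = 0" by linarith
    then have "z - t = 0" using n by (simp add: complex_eq_iff)
    then show False using that by simp
  qed
  have S: "convex S" "open S"
  proof -
    have e: "S = {z. Re z > Re t - 3 * pi / 2} \<inter> {z. Re z < Re t + 3 * pi / 2}" by (auto simp: S_def)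
    show "convex S" "open S" unfolding e
      by (intro convex_Int convex_halfspace_Re_gt convex_halfspace_Re_lt
            open_Int open_halfspace_Re_gt open_halfspace_Re_lt)+
  qed
  have dh: "h field_differentiable (at z)" if "z \<in> S - {t}" for z
  proof -
    have "(\<lambda>z. (g z - g t) * strip_kernel (z - t)) holomorphic_on S - {t}"
      unfolding strip_kernel_def using nz
      by (intro holomorphic_intros holomorphic_on_subset[OF g]) auto
    then have "h holomorphic_on S - {t}"
      by (rule holomorphic_transform) (auto simp: h_def)
    then show ?thesis using that S(2) holomorphic_on_imp_differentiable_at open_delete by blast
  qed
  have ch: "continuous_on S h"
  proof -
    have "isCont h z" if "z \<in> S" for z
    proof (cases "z = t")
      case False
      then show ?thesis using dh[of z] that field_differentiable_imp_continuous_at by blast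
    next
      case True
      have 1: "((\<lambda>z. (g z - g t) / (z - t)) \<longlongrightarrow> deriv g t) (at t)"
        using holomorphic_derivI[OF g open_UNIV, of t] has_field_derivative_iff by blast
      have "((\<lambda>z. 1 - exp (- (\<i> * (z - t)))) has_field_derivative \<i>) (at t)"
        by (rule derivative_eq_intros refl)+ simp
      then have 2: "((\<lambda>z. (1 - exp (- (\<i> * (z - t))) - (1 - exp (- (\<i> * (t - t))))) / (z - t)) \<longlongrightarrow> \<i>) (at t)"
        unfolding has_field_derivative_iff .
      have "((\<lambda>z. ((g z - g t) / (z - t)) / ((1 - exp (- (\<i> * (z - t))) - (1 - exp (- (\<i> * (t - t))))) / (z - t))) \<longlongrightarrow> deriv g t / \<i>) (at t)"
        by (intro tendsto_divide 1 2) auto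
      then have "(h \<longlongrightarrow> deriv g t / \<i>) (at t)"
        by (rule Lim_transform_eventually) (auto simp: eventually_at_filter h_def strip_kernel_def)
      then show ?thesis using True by (simp add: isCont_def h_def)
    qed
    then show ?thesis by (simp add: continuous_at_imp_continuous_on)
  qed
  obtain P where P': "\<And>x. x \<in> S \<Longrightarrow> (P has_field_derivative h x) (at x within S)"
    using holomorphic_convex_primitive[OF S(1) finite.insertI[OF finite.emptyI, of t] ch] dh S(2) interior_open by metis
  then have P: "(P has_field_derivative h x) (at x)" if "x \<in> S" for x
    using that S(2) by (metis at_within_open)
  define a where "a = t - of_real pi"
  have aS: "a + of_real x + \<i> * of_real y \<in> S" if "x \<in> {0..2 * pi}" for x y
  proof -
    have "- (3 * pi / 2) < x - pi" "x - pi < 3 * pi / 2"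
      using that pi_gt_zero unfolding atLeastAtMost_iff by linarith+
    then show ?thesis by (simp add: a_def S_def)
  qed
  have hint: "((\<lambda>x. h (a + \<i> * of_real y + of_real x)) has_integral
      (P (a + \<i> * of_real y + of_real (2 * pi)) - P (a + \<i> * of_real y + of_real 0))) {0..2 * pi}" for y
  proof (rule fundamental_theorem_of_calculus)
    fix x :: real assume x: "x \<in> {0..2 * pi}"
    have "((\<lambda>z. P (a + \<i> * of_real y + z)) has_field_derivative h (a + \<i> * of_real y + of_real x)) (at (of_real x))"
      using P[of "of_real x + (a + \<i> * of_real y)"] aS[OF x, of y] unfolding DERIV_shift by (simp add: add_ac)
    then show "((\<lambda>x. P (a + \<i> * of_real y + of_real x)) has_vector_derivative h (a + \<i> * of_real y + of_real x)) (at x within {0..2 * pi})"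
      by (rule has_vector_derivative_real_field)
  qed auto
  \<comment> \<open>The increment of the primitive across one period does not depend on the height,
    because \<open>h\<close> agrees on the two vertical sides.\<close>
  define Q where "Q y = P (a + \<i> * of_real y + of_real (2 * pi)) - P (a + \<i> * of_real y + of_real 0)" for y
  have "(Q has_vector_derivative 0) (at y)" for y
  proof -
    have 1: "((\<lambda>z. P (a + \<i> * z + of_real x)) has_field_derivative h (a + \<i> * of_real y + of_real x) * \<i>) (at (of_real y))"
      if "x \<in> {0..2 * pi}" for x
    proof (rule DERIV_chain2[of P])
      show "(P has_field_derivative h (a + \<i> * of_real y + of_real x)) (at (a + \<i> * of_real y + of_real x))"
        using P aS[OF that, of y] by (simp add: add_ac)
      show "((\<lambda>z. a + \<i> * z + of_real x) has_field_derivative \<i>) (at (of_real y))"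
        by (rule derivative_eq_intros refl)+ simp
    qed
    have e: "h (a + \<i> * of_real y + of_real (2 * pi)) = h (a + \<i> * of_real y + of_real 0)"
    proof -
      have "strip_kernel (a + \<i> * of_real y + of_real (2 * pi) - t) = strip_kernel (a + \<i> * of_real y - t)"
        using strip_kernel_periodic[of "a + \<i> * of_real y - t"] by (simp add: algebra_simps)
      moreover have "g (a + \<i> * of_real y + of_real (2 * pi)) = g (a + \<i> * of_real y)"
        using per[of "a + \<i> * of_real y"] by simp
      moreover have "a + \<i> * of_real y + of_real (2 * pi) \<noteq> t" "a + \<i> * of_real y \<noteq> t"
        by (auto simp: a_def complex_eq_iff)
      ultimately show ?thesis by (simp add: h_def)
    qed
    have "((\<lambda>z. P (a + \<i> * z + of_real (2 * pi)) - P (a + \<i> * z + of_real 0)) has_field_derivative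
       h (a + \<i> * of_real y + of_real (2 * pi)) * \<i> - h (a + \<i> * of_real y + of_real 0) * \<i>) (at (of_real y))"
      by (intro DERIV_diff 1) auto
    then show ?thesis unfolding Q_def e using has_vector_derivative_real_field[of _ 0 y UNIV] by simp
  qed
  then obtain C where "\<And>y. Q y = C"
    using has_vector_derivative_zero_constant[of UNIV Q] by auto
  then have hC: "((\<lambda>x. h (a + \<i> * of_real y + of_real x)) has_integral C) {0..2 * pi}" for y
    using hint[of y] by (simp add: Q_def)
  \<comment> \<open>In a half plane without the pole the whole integrand is holomorphic, so the
    segment may be moved to the one that starts at \<open>a + \<i> * y\<close>, where the integrand
    splits into \<open>h\<close> and a multiple of the kernel.\<close>
  have main: "integral {0..2 * pi} (\<lambda>x. ?F (w + of_real x)) = C + g t * K"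
    if U: "convex U" "open U" "\<And>z x. z \<in> U \<Longrightarrow> z + of_real x \<in> U" "w \<in> U" "\<And>z. z \<in> U \<Longrightarrow> Im z \<noteq> Im t"
      and y: "a + \<i> * of_real y \<in> U"
      and K: "((\<lambda>x. strip_kernel (a + \<i> * of_real y - t + of_real x)) has_integral K) {0..2 * pi}" for U w y K
  proof -
    have "?F holomorphic_on U"
    proof (intro holomorphic_on_mult holomorphic_on_subset[OF g])
      have "strip_kernel \<circ> (\<lambda>z. z - t) holomorphic_on U"
        using U(5) by (intro holomorphic_on_compose strip_kernel_holomorphic holomorphic_intros) auto
      then show "(\<lambda>z. strip_kernel (z - t)) holomorphic_on U" by (simp add: o_def)
    qed auto
    moreover have "?F (z + 2 * of_real pi) = ?F z" for z
      using strip_kernel_periodic[of "z - t"] per[of z] by (simp add: algebra_simps)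
    ultimately obtain C' where C': "\<And>w. w \<in> U \<Longrightarrow> ((\<lambda>x. ?F (w + of_real x)) has_integral C') {0..2 * pi}"
      using periodic_has_integral_on[OF U(1-3), of ?F] by metis
    have "((\<lambda>x. h (a + \<i> * of_real y + of_real x) + g t * strip_kernel (a + \<i> * of_real y - t + of_real x)) has_integral
        (C + g t * K)) {0..2 * pi}"
      by (intro has_integral_add hC has_integral_mult_right K)
    moreover have "h (a + \<i> * of_real y + of_real x) + g t * strip_kernel (a + \<i> * of_real y - t + of_real x) =
        ?F (a + \<i> * of_real y + of_real x)" for x
    proof -
      have "a + \<i> * of_real y + of_real x \<noteq> t" using U(3)[OF y, of x] U(5) by auto
      then show ?thesis by (simp add: h_def algebra_simps)
    qed
    ultimately have "((\<lambda>x. ?F (a + \<i> * of_real y + of_real x)) has_integral (C + g t * K)) {0..2 * pi}" by simp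
    then have "C' = C + g t * K" using C'[OF y] has_integral_unique by blast
    then show ?thesis using C'[OF U(4)] integral_unique by blast
  qed
  have 1: "integral {0..2 * pi} (\<lambda>x. ?F (w1 + of_real x)) = C + g t * of_real (2 * pi)"
  proof (rule main[of "{z. Im z < Im t}" _ "- 1"])
    show "((\<lambda>x. strip_kernel (a + \<i> * of_real (- 1) - t + of_real x)) has_integral of_real (2 * pi)) {0..2 * pi}"
      by (rule strip_kernel_integral) (simp add: a_def)
  qed (use w in \<open>auto simp: a_def convex_halfspace_Im_lt open_halfspace_Im_lt\<close>)
  have 2: "integral {0..2 * pi} (\<lambda>x. ?F (w2 + of_real x)) = C + g t * 0"
  proof (rule main[of "{z. Im z > Im t}" _ "1"])
    show "((\<lambda>x. strip_kernel (a + \<i> * of_real 1 - t + of_real x)) has_integral 0) {0..2 * pi}"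
      by (rule strip_kernel_integral) (simp add: a_def)
  qed (use w in \<open>auto simp: a_def convex_halfspace_Im_gt open_halfspace_Im_gt\<close>)
  show ?thesis unfolding 1 2 by simp
qed

section \<open>Estimates on strips and the expansion\<close>

definition strip_norm :: "(complex \<Rightarrow> complex) \<Rightarrow> real \<Rightarrow> real" where
  "strip_norm u y = integral {0..2 * pi} (\<lambda>x. (norm (u (\<i> * of_real y + of_real x)))\<^sup>2)"

text \<open>Since \<open>u\<close> commutes with conjugation, its squared modulus on a horizontal
  line is the restriction of an entire periodic function. Norms thus become contour integrals that
  may be shifted.\<close>

lemma strip_norm_complex:
  assumes u: "mathieu_eigfun q ev n u"
  shows "complex_of_real (integral {0..2 * pi} (\<lambda>x. (norm (u (w + of_real x)))\<^sup>2)) =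
     integral {0..2 * pi} (\<lambda>x. u (of_real x + \<i> * of_real (Im w)) * u (of_real x - \<i> * of_real (Im w)))"
proof -
  note U = mathieu_eigfunD[OF u]
  let ?h = "\<lambda>z. u (z + \<i> * of_real (Im w)) * u (z - \<i> * of_real (Im w))"
  have cu: "continuous_on S (\<lambda>x::real. u (w + of_real x))" for S
    by (intro continuous_on_entire_compose[OF U(5)] continuous_intros)
  have "complex_of_real (integral {0..2 * pi} (\<lambda>x. (norm (u (w + of_real x)))\<^sup>2)) =
     integral {0..2 * pi} (\<lambda>x. complex_of_real ((norm (u (w + of_real x)))\<^sup>2))"
    by (rule integral_of_real_cont[symmetric]) (intro continuous_intros cu)
  also have "(\<lambda>x. complex_of_real ((norm (u (w + of_real x)))\<^sup>2)) = (\<lambda>x. ?h (of_real (Re w) + of_real x))"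
  proof
    fix x :: real
    have 1: "of_real (Re w) + of_real x + \<i> * of_real (Im w) = w + of_real x"
      "of_real (Re w) + of_real x - \<i> * of_real (Im w) = cnj (w + of_real x)"
      by (simp_all add: complex_eq_iff)
    show "complex_of_real ((norm (u (w + of_real x)))\<^sup>2) = ?h (of_real (Re w) + of_real x)"
      unfolding 1 U(4) by (rule complex_norm_square)
  qed
  also have "integral {0..2 * pi} \<dots> = integral {0..2 * pi} (\<lambda>x. ?h (of_real x))"
  proof (rule periodic_integral_shift)
    have s: "u (z + 2 * of_real pi + e) = u (z + e)" for z e
      using U(3)[of "z + e"] by (simp add: add_ac)
    show "?h (z + 2 * of_real pi) = ?h z" for z
      using s[of z "\<i> * of_real (Im w)"] s[of z "- (\<i> * of_real (Im w))"] by simp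
    have "(u \<circ> (\<lambda>z. z + e)) holomorphic_on UNIV" for e
      by (intro holomorphic_on_compose holomorphic_intros U)
    then have "(\<lambda>z. u (z + e)) holomorphic_on UNIV" for e by (simp add: o_def)
    from this[of "\<i> * of_real (Im w)"] this[of "- (\<i> * of_real (Im w))"] show "?h holomorphic_on UNIV"
      by (intro holomorphic_intros) simp_all
  qed
  finally show ?thesis .
qed

lemma strip_norm_shift:
  assumes u: "mathieu_eigfun q ev n u"
  shows "integral {0..2 * pi} (\<lambda>x. (norm (u (w + of_real x)))\<^sup>2) = strip_norm u (Im w)"
    and "strip_norm u (- y) = strip_norm u y" "strip_norm u 0 = pi"
proof -
  have 1: "complex_of_real (strip_norm u y) =
     integral {0..2 * pi} (\<lambda>x. u (of_real x + \<i> * of_real y) * u (of_real x - \<i> * of_real y))" for y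
    unfolding strip_norm_def strip_norm_complex[OF u] by simp
  have "complex_of_real (integral {0..2 * pi} (\<lambda>x. (norm (u (w + of_real x)))\<^sup>2)) = complex_of_real (strip_norm u (Im w))"
    unfolding 1 strip_norm_complex[OF u] ..
  then show "integral {0..2 * pi} (\<lambda>x. (norm (u (w + of_real x)))\<^sup>2) = strip_norm u (Im w)" by (simp only: of_real_eq_iff)
  have "complex_of_real (strip_norm u (- y)) = complex_of_real (strip_norm u y)"
    unfolding 1 by (simp add: mult.commute)
  then show "strip_norm u (- y) = strip_norm u y" by (simp only: of_real_eq_iff)
  have "complex_of_real (strip_norm u 0) = of_real pi"
    unfolding 1 using mathieu_eigfunD(7)[OF u] by simp
  then show "strip_norm u 0 = pi" by (simp only: of_real_eq_iff)
qed

lemma strip_norm_nonneg: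
  assumes u: "mathieu_eigfun q ev n u"
  shows "strip_norm u y \<ge> 0"
  unfolding strip_norm_def
  by (intro integral_nonneg integrable_continuous_interval continuous_intros
      continuous_on_entire_compose[OF mathieu_eigfunD(5)[OF u]]) auto

text \<open>Move the contour so that one of the two factors is on the real line.\<close>

lemma strip_norm_sq_le:
  assumes u: "mathieu_eigfun q ev n u"
  shows "(strip_norm u y)\<^sup>2 \<le> pi * strip_norm u (2 * y)"
proof -
  note U = mathieu_eigfunD[OF u]
  let ?h = "\<lambda>z. u (z + \<i> * of_real y) * u (z - \<i> * of_real y)"
  have "complex_of_real (strip_norm u y) = integral {0..2 * pi} (\<lambda>x. ?h (of_real x))"
    unfolding strip_norm_def strip_norm_complex[OF u] by simp
  also have "\<dots> = integral {0..2 * pi} (\<lambda>x. ?h (\<i> * of_real y + of_real x))"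
  proof (rule periodic_integral_shift[symmetric])
    have s: "u (z + 2 * of_real pi + e) = u (z + e)" for z e
      using U(3)[of "z + e"] by (simp add: add_ac)
    show "?h (z + 2 * of_real pi) = ?h z" for z
      using s[of z "\<i> * of_real y"] s[of z "- (\<i> * of_real y)"] by simp
    have "(u \<circ> (\<lambda>z. z + e)) holomorphic_on UNIV" for e
      by (intro holomorphic_on_compose holomorphic_intros U)
    then have "(\<lambda>z. u (z + e)) holomorphic_on UNIV" for e by (simp add: o_def)
    from this[of "\<i> * of_real y"] this[of "- (\<i> * of_real y)"] show "?h holomorphic_on UNIV"
      by (intro holomorphic_intros) simp_all
  qed
  also have "\<dots> = integral {0..2 * pi} (\<lambda>x. u (\<i> * of_real (2 * y) + of_real x) * u (\<i> * of_real 0 + of_real x))"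
    by (simp add: algebra_simps)
  finally have e: "strip_norm u y = norm \<dots>" using strip_norm_nonneg[OF u, of y] by (metis abs_of_nonneg norm_of_real)
  have "(strip_norm u y)\<^sup>2 \<le> strip_norm u (2 * y) * strip_norm u 0"
    unfolding e unfolding strip_norm_def
    by (intro Cauchy_Schwarz_integral continuous_on_entire_compose[OF U(5)] continuous_intros)
  then show ?thesis by (simp add: strip_norm_shift[OF u] mult.commute)
qed

lemma continuous_on_strip_kernel:
  assumes "Im w \<noteq> 0" "continuous_on S f" "continuous_on S g"
  shows "continuous_on S (\<lambda>x. strip_kernel (w + of_real (f x) - of_real (g x)))"
  unfolding strip_kernel_def using assms(1) strip_kernel_denom
  by (intro continuous_intros assms(2,3)) auto

text \<open>The strip formula is used with the lines at heights \<open>R + 1\<close> and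
  \<open>- (R + 1)\<close>, at distance at least \<open>1\<close> from \<open>z\<close>, where the
  kernel is at most \<open>2\<close>. By Cauchy-Schwarz each line contributes at most
  \<open>sqrt (8 * pi * strip_norm u (R + 1))\<close>.\<close>

lemma mathieu_eigfun_pointwise:
  assumes u: "mathieu_eigfun q ev n u" and z: "\<bar>Im z\<bar> \<le> R"
  shows "(norm (u z))\<^sup>2 \<le> 8 / pi * strip_norm u (R + 1)"
proof -
  note U = mathieu_eigfunD[OF u]
  define y where "y = R + 1"
  define T where "T w = integral {0..2 * pi} (\<lambda>x. u (w + of_real x) * strip_kernel (w + of_real x - z))" for w
  have T: "(norm (T w))\<^sup>2 \<le> 8 * pi * strip_norm u y" if w: "Im w = y \<or> Im w = - y" for w
  proof -
    have k: "\<bar>Im (w - z)\<bar> \<ge> 1" using w z by (auto simp: y_def)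
    then have ck: "continuous_on {0..2 * pi} (\<lambda>x. strip_kernel (w + of_real x - z))"
      using continuous_on_strip_kernel[of "w - z" "{0..2 * pi}" "\<lambda>x. x" "\<lambda>x. 0"] by (simp add: algebra_simps)
    have "(norm (T w))\<^sup>2 \<le> integral {0..2 * pi} (\<lambda>x. (norm (u (w + of_real x)))\<^sup>2) *
       integral {0..2 * pi} (\<lambda>x. (norm (strip_kernel (w + of_real x - z)))\<^sup>2)"
      unfolding T_def
      by (intro Cauchy_Schwarz_integral continuous_on_entire_compose[OF U(5)] ck) (intro continuous_intros)
    also have "integral {0..2 * pi} (\<lambda>x. (norm (u (w + of_real x)))\<^sup>2) = strip_norm u y"
      using w strip_norm_shift[OF u] by auto
    finally have "(norm (T w))\<^sup>2 \<le> strip_norm u y * integral {0..2 * pi} (\<lambda>x. (norm (strip_kernel (w + of_real x - z)))\<^sup>2)" .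
    also have "\<dots> \<le> strip_norm u y * integral {0..2 * pi} (\<lambda>x. 4)"
    proof (intro mult_left_mono integral_le strip_norm_nonneg[OF u])
      show "(norm (strip_kernel (w + of_real x - z)))\<^sup>2 \<le> 4" for x
        using power_mono[OF strip_kernel_bound[of "w + of_real x - z"], of 2] k by simp
    qed (intro integrable_continuous_interval continuous_intros ck)+
    finally show ?thesis by (simp add: mult_ac)
  qed
  have w1: "Im (- (\<i> * of_real y)) = - y" and w2: "Im (\<i> * of_real y) = y" by simp_all
  have "T (- (\<i> * of_real y)) - T (\<i> * of_real y) = 2 * of_real pi * u z"
    unfolding T_def by (rule strip_formula[OF U(5,3)]) (use z in \<open>auto simp: y_def\<close>)
  then have "2 * pi * norm (u z) = norm (T (- (\<i> * of_real y)) - T (\<i> * of_real y))"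
    by (simp add: norm_mult)
  also have "\<dots> \<le> norm (T (- (\<i> * of_real y))) + norm (T (\<i> * of_real y))" by (rule norm_triangle_ineq4)
  also have "\<dots> \<le> sqrt (8 * pi * strip_norm u y) + sqrt (8 * pi * strip_norm u y)"
    using T[of "- (\<i> * of_real y)"] T[of "\<i> * of_real y"] w1 w2 by (intro add_mono real_le_rsqrt) auto
  finally have "pi * norm (u z) \<le> sqrt (8 * pi * strip_norm u y)" by simp
  then have "(pi * norm (u z))\<^sup>2 \<le> 8 * pi * strip_norm u y"
    using strip_norm_nonneg[OF u, of y] by (simp add: sqrt_ge_absD abs_mult)
  then show ?thesis unfolding y_def by (simp add: power_mult_distrib power2_eq_square field_simps)
qed

text \<open>Pairing \<open>f\<close> with the combination \<open>S\<close> gives the sum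
  \<open>A\<close>, and the squared norm of \<open>S\<close> is \<open>pi * A\<close> by
  orthogonality and the normalization; Cauchy-Schwarz then yields Bessel's inequality after
  cancelling \<open>A\<close>.\<close>

lemma mathieu_bessel_inequality:
  assumes u: "\<And>n. mathieu_eigfun q ev n (u n)" and f: "continuous_on {0..2 * pi} f"
  shows "(\<Sum>n<N. (norm (integral {0..2 * pi} (\<lambda>t. f t * u n (of_real t))))\<^sup>2) \<le> pi * integral {0..2 * pi} (\<lambda>t. (norm (f t))\<^sup>2)"
proof -
  note U = mathieu_eigfunD[OF u]
  have cu: "continuous_on X (\<lambda>t::real. u n (of_real t))" for n X
    by (intro continuous_on_entire_compose[OF U(5)] continuous_intros)
  define c where "c n = integral {0..2 * pi} (\<lambda>t. f t * u n (of_real t))" for n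
  define S where "S t = (\<Sum>n<N. cnj (c n) * u n (of_real t))" for t :: real
  define A where "A = (\<Sum>n<N. (norm (c n))\<^sup>2)"
  have A0: "A \<ge> 0" unfolding A_def by (intro sum_nonneg) auto
  have cS: "continuous_on {0..2 * pi} S" unfolding S_def by (intro continuous_intros cu)
  have "((\<lambda>t. \<Sum>n<N. cnj (c n) * (f t * u n (of_real t))) has_integral (\<Sum>n<N. cnj (c n) * c n)) {0..2 * pi}"
    unfolding c_def
    by (intro has_integral_sum has_integral_mult_right integrable_integral integrable_continuous_interval continuous_on_mult f cu) auto
  moreover have "(\<Sum>n<N. cnj (c n) * c n) = of_real A"
    by (simp add: A_def complex_norm_square mult.commute del: of_real_power)
  moreover have "(\<lambda>t. \<Sum>n<N. cnj (c n) * (f t * u n (of_real t))) = (\<lambda>t. f t * S t)"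
    by (simp add: S_def sum_distrib_left mult_ac)
  ultimately have 1: "integral {0..2 * pi} (\<lambda>t. f t * S t) = of_real A" by (simp add: integral_unique)
  have real: "cnj (u n (of_real t)) = u n (of_real t)" for n t using U(4)[of n "of_real t"] by simp
  have "complex_of_real (integral {0..2 * pi} (\<lambda>t. (norm (S t))\<^sup>2)) = integral {0..2 * pi} (\<lambda>t. complex_of_real ((norm (S t))\<^sup>2))"
    by (rule integral_of_real_cont[symmetric]) (intro continuous_intros cS)
  also have "(\<lambda>t. complex_of_real ((norm (S t))\<^sup>2)) = (\<lambda>t. \<Sum>n<N. \<Sum>m<N. cnj (c n) * c m * (u n (of_real t) * u m (of_real t)))"
  proof
    fix t
    have "complex_of_real ((norm (S t))\<^sup>2) = S t * cnj (S t)" by (rule complex_norm_square)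
    also have "\<dots> = (\<Sum>n<N. \<Sum>m<N. (cnj (c n) * u n (of_real t)) * (c m * u m (of_real t)))"
      by (simp add: S_def sum_product real)
    finally show "complex_of_real ((norm (S t))\<^sup>2) = (\<Sum>n<N. \<Sum>m<N. cnj (c n) * c m * (u n (of_real t) * u m (of_real t)))"
      by (simp add: mult_ac)
  qed
  also have "integral {0..2 * pi} \<dots> = (\<Sum>n<N. \<Sum>m<N. cnj (c n) * c m * integral {0..2 * pi} (\<lambda>t. u n (of_real t) * u m (of_real t)))"
    by (intro integral_unique has_integral_sum has_integral_mult_right integrable_integral integrable_continuous_interval continuous_on_mult cu) auto
  also have "\<dots> = (\<Sum>n<N. \<Sum>m<N. if m = n then cnj (c n) * c n * of_real pi else 0)"
    by (intro sum.cong refl) (auto simp: U(7) mathieu_eigfun_orthogonal[OF u u])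
  also have "\<dots> = (\<Sum>n<N. of_real (pi * (norm (c n))\<^sup>2))"
    by (intro sum.cong refl) (simp add: complex_norm_square mult_ac del: of_real_power)
  also have "\<dots> = of_real (pi * A)" by (simp only: A_def sum_distrib_left of_real_sum)
  finally have 2: "integral {0..2 * pi} (\<lambda>t. (norm (S t))\<^sup>2) = pi * A" by (simp only: of_real_eq_iff)
  have "A\<^sup>2 \<le> integral {0..2 * pi} (\<lambda>t. (norm (f t))\<^sup>2) * (pi * A)"
    using Cauchy_Schwarz_integral[OF f cS] A0 unfolding 1 2 by simp
  then have "A * A \<le> (pi * integral {0..2 * pi} (\<lambda>t. (norm (f t))\<^sup>2)) * A" by (simp add: power2_eq_square mult_ac)
  moreover have "pi * integral {0..2 * pi} (\<lambda>t. (norm (f t))\<^sup>2) \<ge> 0"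
    by (intro mult_nonneg_nonneg integral_nonneg integrable_continuous_interval continuous_intros f) auto
  ultimately show ?thesis using A0 unfolding A_def[symmetric] c_def[symmetric]
    by (cases "A = 0") (auto simp: A_def[symmetric])
qed

text \<open>Testing the strip formula against the eigenfunction itself bounds \<open>1 / strip_norm (u n) y\<close> by squared Fourier
  coefficients of the kernel, which are summable by Bessel's inequality.\<close>

lemma summable_inverse_strip_norm:
  assumes u: "\<And>n. mathieu_eigfun q ev n (u n)" and y: "y \<ge> 1"
  shows "strip_norm (u n) y > 0" "summable (\<lambda>n. 1 / strip_norm (u n) y)"
proof -
  note U = mathieu_eigfunD[OF u]
  have cu: "continuous_on X (\<lambda>t. u n (f t))" if "continuous_on X f" for n f and X :: "'x::t2_space set"
    by (rule continuous_on_entire_compose[OF U(5) that])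
  define a where "a w n x = integral {0..2 * pi} (\<lambda>t. strip_kernel (w + of_real x - of_real t) * u n (of_real t))" for w n and x :: real
  define A where "A w n = integral {0..2 * pi} (\<lambda>x. (norm (a w n x))\<^sup>2)" for w n
  define T where "T w n = integral {0..2 * pi} (\<lambda>t. u n (of_real t) *
     integral {0..2 * pi} (\<lambda>x. u n (w + of_real x) * strip_kernel (w + of_real x - of_real t)))" for w n
  have ca: "continuous_on {0..2 * pi} (a w n)" if w: "\<bar>Im w\<bar> = y" for w n
  proof -
    have "continuous_on {0..2 * pi} (\<lambda>x. integral (cbox 0 (2 * pi)) (\<lambda>t. strip_kernel (w + of_real x - of_real t) * u n (of_real t)))"
      by (rule integral_continuous_on_param, unfold split_beta)
         (use w y in \<open>intro continuous_on_mult continuous_on_strip_kernel cu continuous_intros; auto\<close>)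
    then show ?thesis by (simp add: a_def[abs_def])
  qed
  have A0: "A w n \<ge> 0" if w: "\<bar>Im w\<bar> = y" for w n
    unfolding A_def by (intro integral_nonneg integrable_continuous_interval continuous_intros ca w) auto
  have T: "(norm (T w n))\<^sup>2 \<le> strip_norm (u n) y * A w n" if w: "\<bar>Im w\<bar> = y" for w n
  proof -
    have c: "continuous_on (cbox (0, 0) (2 * pi, 2 * pi)) (\<lambda>(t, x). u n (of_real t) * (u n (w + of_real x) * strip_kernel (w + of_real x - of_real t)))"
      unfolding split_beta
      by (use w y in \<open>intro continuous_on_mult continuous_on_strip_kernel cu continuous_intros; auto\<close>)
    have "T w n = integral {0..2 * pi} (\<lambda>t. integral {0..2 * pi} (\<lambda>x. u n (of_real t) * (u n (w + of_real x) * strip_kernel (w + of_real x - of_real t))))"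
      by (simp add: T_def)
    also have "\<dots> = integral {0..2 * pi} (\<lambda>x. integral {0..2 * pi} (\<lambda>t. u n (of_real t) * (u n (w + of_real x) * strip_kernel (w + of_real x - of_real t))))"
      using integral_swap_continuous[OF c] by simp
    also have "\<dots> = integral {0..2 * pi} (\<lambda>x. u n (w + of_real x) * a w n x)"
      by (simp add: a_def mult_ac flip: integral_mult_right)
    finally have "T w n = integral {0..2 * pi} (\<lambda>x. u n (w + of_real x) * a w n x)" .
    then have "(norm (T w n))\<^sup>2 \<le> integral {0..2 * pi} (\<lambda>x. (norm (u n (w + of_real x)))\<^sup>2) * A w n"
      unfolding A_def by (simp only:) (intro Cauchy_Schwarz_integral cu ca w continuous_intros)
    also have "integral {0..2 * pi} (\<lambda>x. (norm (u n (w + of_real x)))\<^sup>2) = strip_norm (u n) y"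
      unfolding strip_norm_shift(1)[OF u] using w strip_norm_shift(2)[OF u, of n y] by (cases "Im w \<ge> 0") auto
    finally show ?thesis .
  qed
  \<comment> \<open>For each \<open>x\<close>, Bessel's inequality for the kernel as a function of
    \<open>t\<close> gives \<open>pi\<close> times \<open>2 * pi * 4\<close>; the outer integral
    contributes another \<open>2 * pi\<close>.\<close>
  have sumA: "(\<Sum>n<N. A w n) \<le> 16 * pi ^ 3" if w: "\<bar>Im w\<bar> = y" for w N
  proof -
    have "(\<Sum>n<N. A w n) = integral {0..2 * pi} (\<lambda>x. \<Sum>n<N. (norm (a w n x))\<^sup>2)"
      unfolding A_def
      by (rule integral_sum[symmetric]) (auto intro!: integrable_continuous_interval continuous_intros ca w)
    also have "\<dots> \<le> integral {0..2 * pi} (\<lambda>x. pi * (8 * pi))"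
    proof (rule integral_le)
      fix x :: real
      have ck: "continuous_on {0..2 * pi} (\<lambda>t. strip_kernel (w + of_real x - of_real t))"
        using w y by (intro continuous_on_strip_kernel continuous_intros) auto
      have "(\<Sum>n<N. (norm (a w n x))\<^sup>2) \<le> pi * integral {0..2 * pi} (\<lambda>t. (norm (strip_kernel (w + of_real x - of_real t)))\<^sup>2)"
        unfolding a_def by (rule mathieu_bessel_inequality[OF u ck])
      also have "integral {0..2 * pi} (\<lambda>t. (norm (strip_kernel (w + of_real x - of_real t)))\<^sup>2) \<le> integral {0..2 * pi} (\<lambda>t. 4)"
      proof (rule integral_le)
        show "(norm (strip_kernel (w + of_real x - of_real t)))\<^sup>2 \<le> 4" for t
          using power_mono[OF strip_kernel_bound[of "w + of_real x - of_real t"], of 2] w y by simp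
      qed (intro integrable_continuous_interval continuous_intros ck)+
      finally show "(\<Sum>n<N. (norm (a w n x))\<^sup>2) \<le> pi * (8 * pi)" by simp
    qed (intro integrable_continuous_interval continuous_intros ca w)+
    also have "\<dots> = 16 * pi ^ 3" by (simp add: power3_eq_cube)
    finally show ?thesis .
  qed
  define v w where "v = - (\<i> * of_real y)" and "w = \<i> * of_real y"
  have vw: "\<bar>Im v\<bar> = y" "\<bar>Im w\<bar> = y" using y by (simp_all add: v_def w_def)
  \<comment> \<open>By the strip formula and the normalization \<open>T v n - T w n\<close> equals
    \<open>2 * pi\<close> times \<open>pi\<close>; squaring produces the left side.\<close>
  have main: "4 * pi ^ 4 \<le> strip_norm (u n) y * (2 * (A v n + A w n))" for n
  proof -
    have "T v n - T w n = integral {0..2 * pi} (\<lambda>t. u n (of_real t) * (2 * of_real pi * u n (of_real t)))"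
    proof -
      have i: "(\<lambda>t. u n (of_real t) * integral {0..2 * pi} (\<lambda>x. u n (w + of_real x) * strip_kernel (w + of_real x - of_real t))) integrable_on {0..2 * pi}"
        if w: "\<bar>Im w\<bar> = y" for w
      proof -
        have "continuous_on {0..2 * pi} (\<lambda>t. integral (cbox 0 (2 * pi)) (\<lambda>x. u n (w + of_real x) * strip_kernel (w + of_real x - of_real t)))"
          by (rule integral_continuous_on_param, unfold split_beta)
             (use w y in \<open>intro continuous_on_mult continuous_on_strip_kernel cu continuous_intros; auto\<close>)
        then show ?thesis by (intro integrable_continuous_interval continuous_on_mult cu continuous_intros) simp_all
      qed
      have "T v n - T w n = integral {0..2 * pi} (\<lambda>t. u n (of_real t) * integral {0..2 * pi} (\<lambda>x. u n (v + of_real x) * strip_kernel (v + of_real x - of_real t))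
          - u n (of_real t) * integral {0..2 * pi} (\<lambda>x. u n (w + of_real x) * strip_kernel (w + of_real x - of_real t)))"
        unfolding T_def by (rule integral_diff[symmetric]) (rule i vw)+
      also have "\<dots> = integral {0..2 * pi} (\<lambda>t. u n (of_real t) * (2 * of_real pi * u n (of_real t)))"
      proof (rule integral_cong)
        fix t :: real
        have "integral {0..2 * pi} (\<lambda>x. u n (v + of_real x) * strip_kernel (v + of_real x - of_real t)) -
          integral {0..2 * pi} (\<lambda>x. u n (w + of_real x) * strip_kernel (w + of_real x - of_real t)) = 2 * of_real pi * u n (of_real t)"
          by (rule strip_formula[OF U(5,3)]) (use y in \<open>auto simp: v_def w_def\<close>)
        then show "u n (of_real t) * integral {0..2 * pi} (\<lambda>x. u n (v + of_real x) * strip_kernel (v + of_real x - of_real t))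
          - u n (of_real t) * integral {0..2 * pi} (\<lambda>x. u n (w + of_real x) * strip_kernel (w + of_real x - of_real t)) =
          u n (of_real t) * (2 * of_real pi * u n (of_real t))"
          by (simp only: right_diff_distrib[symmetric])
      qed
      finally show ?thesis .
    qed
    also have "\<dots> = 2 * of_real pi * integral {0..2 * pi} (\<lambda>t. u n (of_real t) * u n (of_real t))"
      by (simp only: mult.left_commute[of _ "2 * of_real pi"] integral_mult_right)
    also have "\<dots> = of_real (2 * pi\<^sup>2)" by (simp add: U(7) power2_eq_square)
    finally have "2 * pi\<^sup>2 = norm (T v n - T w n)" by (simp only: norm_of_real) simp
    also have "\<dots> \<le> norm (T v n) + norm (T w n)" by (rule norm_triangle_ineq4)
    finally have "(2 * pi\<^sup>2)\<^sup>2 \<le> (norm (T v n) + norm (T w n))\<^sup>2" by (intro power_mono) auto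
    also have "\<dots> \<le> 2 * ((norm (T v n))\<^sup>2 + (norm (T w n))\<^sup>2)"
      using sum_squares_bound[of "norm (T v n)" "norm (T w n)"] by (simp add: power2_sum)
    also have "\<dots> \<le> 2 * (strip_norm (u n) y * A v n + strip_norm (u n) y * A w n)"
      by (intro mult_left_mono add_mono T vw) auto
    finally show ?thesis by (simp add: power_mult_distrib algebra_simps flip: power_mult)
  qed
  have pos: "strip_norm (u n) y > 0" for n
  proof (rule ccontr)
    assume "\<not> strip_norm (u n) y > 0"
    then have "strip_norm (u n) y = 0" using strip_norm_nonneg[OF u, of n y] by simp
    then show False using main[of n] by simp
  qed
  then show "strip_norm (u n) y > 0" .
  have le: "1 / strip_norm (u n) y \<le> (A v n + A w n) / (2 * pi ^ 4)" for n
    using main[of n] pos[of n] by (simp add: field_simps)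
  show "summable (\<lambda>n. 1 / strip_norm (u n) y)"
  proof (rule summableI_nonneg_bounded)
    fix N
    have "(\<Sum>n<N. 1 / strip_norm (u n) y) \<le> (\<Sum>n<N. (A v n + A w n) / (2 * pi ^ 4))" by (intro sum_mono le)
    also have "\<dots> = ((\<Sum>n<N. A v n) + (\<Sum>n<N. A w n)) / (2 * pi ^ 4)"
      by (simp add: sum.distrib sum_divide_distrib[symmetric])
    also have "\<dots> \<le> (16 * pi ^ 3 + 16 * pi ^ 3) / (2 * pi ^ 4)"
      by (intro divide_right_mono add_mono sumA vw) auto
    finally show "(\<Sum>n<N. 1 / strip_norm (u n) y) \<le> (16 * pi ^ 3 + 16 * pi ^ 3) / (2 * pi ^ 4)" .
  qed (use pos in \<open>simp add: less_imp_le\<close>)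
qed

text \<open>The factorization is evaluated with all three arguments at the point of the line where
  \<open>u\<close> is largest. There the cube of \<open>norm (u z)\<close> dominates the power
  \<open>3 / 2\<close> of the norm on the line, while the Riemann function is bounded independently
  of the eigenfunction.\<close>

lemma riem_coeff_bound:
  obtains C where "C \<ge> 0" "\<And>ev n u D. mathieu_eigfun q ev n u \<Longrightarrow> (\<And>a c d. riem_coeff q u a c d = D * u a * u c * u d) \<Longrightarrow>
    (norm D)\<^sup>2 * strip_norm u y ^ 3 \<le> C"
proof -
  let ?z = "\<lambda>x::real. \<i> * complex_of_real y + of_real x"
  let ?r = "\<lambda>p. riem q (?z (fst p)) (of_real (snd p)) (?z (fst p)) (?z (fst p))"
  let ?K = "{0..2 * pi} \<times> {0..2 * pi}"
  have "continuous_on ?K ?r" by (intro riem_continuous continuous_intros)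
  then have "bounded (?r ` ?K)" by (intro compact_imp_bounded compact_continuous_image compact_Times) auto
  then obtain B where "\<forall>v\<in>?r ` ?K. norm v \<le> B" unfolding bounded_iff by blast
  then have B: "norm (?r p) \<le> B" if "p \<in> ?K" for p using that by blast
  have B0: "B \<ge> 0" using order_trans[OF norm_ge_zero B[of "(0, 0)"]] by simp
  show ?thesis
  proof (rule that[of "16 * pi ^ 5 * B\<^sup>2"])
    fix ev n u D
    assume u: "mathieu_eigfun q ev n u" and D: "\<And>a c d. riem_coeff q u a c d = D * u a * u c * u d"
    note U = mathieu_eigfunD[OF u]
    have cu: "continuous_on X (\<lambda>t. u (f t))" if "continuous_on X f" for f and X :: "real set"
      by (rule continuous_on_entire_compose[OF U(5) that])
    have cn: "continuous_on {0..2 * pi} (\<lambda>x. (norm (u (?z x)))\<^sup>2)" by (intro continuous_intros cu)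
    obtain x where x: "x \<in> {0..2 * pi}" "\<And>t. t \<in> {0..2 * pi} \<Longrightarrow> (norm (u (?z t)))\<^sup>2 \<le> (norm (u (?z x)))\<^sup>2"
      using continuous_attains_sup[OF _ _ cn] by auto
    define m where "m = (norm (u (?z x)))\<^sup>2"
    have "strip_norm u y \<le> integral {0..2 * pi} (\<lambda>t. m)"
      unfolding strip_norm_def
    proof (rule integral_le)
      show "(norm (u (?z t)))\<^sup>2 \<le> m" if "t \<in> {0..2 * pi}" for t using x(2)[OF that] by (simp add: m_def)
    qed (intro integrable_continuous_interval cn continuous_intros)+
    then have m: "strip_norm u y \<le> 2 * pi * m" by simp
    have cr: "continuous_on {0..2 * pi} (\<lambda>t. riem q (?z x) (of_real t) (?z x) (?z x))"
      by (intro riem_continuous continuous_intros)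
    have "(norm (riem_coeff q u (?z x) (?z x) (?z x)))\<^sup>2 \<le>
        integral {0..2 * pi} (\<lambda>t. (norm (riem q (?z x) (of_real t) (?z x) (?z x)))\<^sup>2) * integral {0..2 * pi} (\<lambda>t. (norm (u (of_real t)))\<^sup>2)"
      unfolding riem_coeff_def by (intro Cauchy_Schwarz_integral cr cu continuous_intros)
    also have "\<dots> \<le> integral {0..2 * pi} (\<lambda>t. B\<^sup>2) * integral {0..2 * pi} (\<lambda>t. (norm (u (of_real t)))\<^sup>2)"
    proof (intro mult_right_mono integral_le)
      show "(norm (riem q (?z x) (of_real t) (?z x) (?z x)))\<^sup>2 \<le> B\<^sup>2" if "t \<in> {0..2 * pi}" for t
        using B[of "(x, t)"] x(1) that by (intro power_mono) auto
    qed (auto intro!: integrable_continuous_interval continuous_intros cr cu integral_nonneg)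
    also have "integral {0..2 * pi} (\<lambda>t. (norm (u (of_real t)))\<^sup>2) = pi"
      using strip_norm_shift(1)[OF u, of 0] strip_norm_shift(3)[OF u] by simp
    finally have "(norm D)\<^sup>2 * m ^ 3 \<le> 2 * pi\<^sup>2 * B\<^sup>2"
      unfolding D by (simp add: m_def norm_mult power_mult_distrib power2_eq_square power3_eq_cube mult_ac)
    have "(norm D)\<^sup>2 * strip_norm u y ^ 3 \<le> (norm D)\<^sup>2 * (2 * pi * m) ^ 3"
      by (intro mult_left_mono power_mono m strip_norm_nonneg[OF u]) auto
    also have "\<dots> = 8 * pi ^ 3 * ((norm D)\<^sup>2 * m ^ 3)" by (simp add: power_mult_distrib)
    also have "\<dots> \<le> 8 * pi ^ 3 * (2 * pi\<^sup>2 * B\<^sup>2)"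
      using \<open>(norm D)\<^sup>2 * m ^ 3 \<le> 2 * pi\<^sup>2 * B\<^sup>2\<close> by (intro mult_left_mono) auto
    also have "\<dots> = 16 * pi ^ 5 * B\<^sup>2" by (simp add: power2_eq_square eval_nat_numeral)
    finally show "(norm D)\<^sup>2 * strip_norm u y ^ 3 \<le> 16 * pi ^ 5 * B\<^sup>2" .
  qed simp
qed

text \<open>Uniform for arguments with bounded imaginary parts, as needed for convergence on discs.
  In powers of \<open>strip_norm (u n) (4 * y)\<close> the four factors together contribute
  \<open>1 / 2\<close> and \<open>D n\<close> contributes \<open>- 3 / 2\<close>.\<close>

lemma mathieu_term_bound:
  assumes u: "\<And>n. mathieu_eigfun q ev n (u n)"
    and D: "\<And>n a c d. riem_coeff q (u n) a c d = D n * u n a * u n c * u n d"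
    and R: "R \<ge> 0"
  obtains M where "summable M" "\<And>n a b c d. \<bar>Im a\<bar> \<le> R \<Longrightarrow> \<bar>Im b\<bar> \<le> R \<Longrightarrow> \<bar>Im c\<bar> \<le> R \<Longrightarrow> \<bar>Im d\<bar> \<le> R \<Longrightarrow>
     norm (D n * u n a * u n b * u n c * u n d) \<le> M n"
proof -
  \<comment> \<open>The \<open>1\<close> is the distance required by the pointwise bound; the later
    factor \<open>4\<close> comes from applying \<open>strip_norm_sq_le\<close> twice.\<close>
  define y where "y = R + 1"
  obtain C where C: "C \<ge> 0" "\<And>ev n u D. mathieu_eigfun q ev n u \<Longrightarrow> (\<And>a c d. riem_coeff q u a c d = D * u a * u c * u d) \<Longrightarrow>
    (norm D)\<^sup>2 * strip_norm u (4 * y) ^ 3 \<le> C" using riem_coeff_bound by metis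
  define M where "M n = (8 / pi)\<^sup>2 * sqrt (pi ^ 3 * C) * (1 / strip_norm (u n) (4 * y))" for n
  have y4: "4 * y \<ge> 1" using R by (simp add: y_def)
  show ?thesis
  proof (rule that)
    show "summable M" unfolding M_def
      by (intro summable_mult summable_inverse_strip_norm(2)[OF u y4])
    fix n a b c d
    assume im: "\<bar>Im a\<bar> \<le> R" "\<bar>Im b\<bar> \<le> R" "\<bar>Im c\<bar> \<le> R" "\<bar>Im d\<bar> \<le> R"
    let ?I = "strip_norm (u n)"
    define s where "s = sqrt (8 / pi * ?I y)"
    have I0: "?I y \<ge> 0" for y by (rule strip_norm_nonneg[OF u])
    have s: "norm (u n z) \<le> s" if "\<bar>Im z\<bar> \<le> R" for z
      unfolding s_def y_def by (rule real_le_rsqrt) (rule mathieu_eigfun_pointwise[OF u that])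
    have s0: "s \<ge> 0" using I0[of y] by (simp add: s_def)
    have s4: "s ^ 4 = (8 / pi)\<^sup>2 * (?I y)\<^sup>2"
    proof -
      have "s ^ 4 = (s\<^sup>2)\<^sup>2" by (simp flip: power_mult)
      also have "s\<^sup>2 = 8 / pi * ?I y" using I0[of y] by (simp add: s_def)
      finally show ?thesis by (simp only: power_mult_distrib)
    qed
    have "norm (D n * u n a * u n b * u n c * u n d) = norm (D n) * (norm (u n a) * norm (u n b) * norm (u n c) * norm (u n d))"
      by (simp add: norm_mult mult_ac)
    also have "\<dots> \<le> norm (D n) * (s * s * s * s)"
      by (intro mult_left_mono mult_mono s im mult_nonneg_nonneg s0 norm_ge_zero)
    also have "s * s * s * s = s ^ 4" by (simp add: eval_nat_numeral)
    also have "norm (D n) * s ^ 4 = (8 / pi)\<^sup>2 * (norm (D n) * (?I y)\<^sup>2)" by (simp add: s4)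
    also have "norm (D n) * (?I y)\<^sup>2 \<le> sqrt (pi ^ 3 * C) * (1 / ?I (4 * y))"
    proof -
      have pos: "?I (4 * y) > 0" by (rule summable_inverse_strip_norm(1)[OF u y4])
      have "((?I y)\<^sup>2)\<^sup>2 \<le> (pi * ?I (2 * y))\<^sup>2"
        by (intro power_mono strip_norm_sq_le[OF u]) auto
      also have "\<dots> = pi\<^sup>2 * (?I (2 * y))\<^sup>2" by (rule power_mult_distrib)
      also have "\<dots> \<le> pi\<^sup>2 * (pi * ?I (2 * (2 * y)))" by (intro mult_left_mono strip_norm_sq_le[OF u]) auto
      also have "\<dots> = pi ^ 3 * ?I (4 * y)" by (simp add: power2_eq_square power3_eq_cube)
      finally have 4: "((?I y)\<^sup>2)\<^sup>2 \<le> pi ^ 3 * ?I (4 * y)" .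
      have "(norm (D n) * (?I y)\<^sup>2 * ?I (4 * y))\<^sup>2 = (norm (D n))\<^sup>2 * (?I (4 * y))\<^sup>2 * ((?I y)\<^sup>2)\<^sup>2"
        by (simp add: power_mult_distrib)
      also have "\<dots> \<le> (norm (D n))\<^sup>2 * (?I (4 * y))\<^sup>2 * (pi ^ 3 * ?I (4 * y))"
        by (intro mult_left_mono 4) auto
      also have "\<dots> = pi ^ 3 * ((norm (D n))\<^sup>2 * ?I (4 * y) ^ 3)" by (simp add: power2_eq_square power3_eq_cube)
      also have "\<dots> \<le> pi ^ 3 * C" by (intro mult_left_mono C(2)[OF u D]) auto
      finally have "norm (D n) * (?I y)\<^sup>2 * ?I (4 * y) \<le> sqrt (pi ^ 3 * C)" by (rule real_le_rsqrt)
      then show ?thesis using pos by (simp add: field_simps)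
    qed
    finally show "norm (D n * u n a * u n b * u n c * u n d) \<le> M n"
      by (simp add: M_def mult.assoc mult_left_mono)
  qed
qed

text \<open>A family of one parity sees only the part of \<open>riem\<close> with that parity in
  \<open>b\<close>. The difference \<open>G\<close> of this part, times \<open>pi\<close>, and the
  series is entire, periodic, of the same parity and orthogonal to every \<open>u m\<close>, hence
  zero. The factor \<open>pi\<close> comes from the normalization.\<close>

lemma riem_half_expansion:
  assumes u: "\<And>n. mathieu_eigfun q ev n (u n)"
    and D: "\<And>n a c d. riem_coeff q (u n) a c d = D n * u n a * u n c * u n d"
  shows "(\<lambda>n. D n * u n a * u n b * u n c * u n d) sums
    (of_real pi * ((riem q a b c d + par ev * riem q a (- b) c d) / 2))"
proof -
  note U = mathieu_eigfunD[OF u]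
  define s where "s n z = D n * u n a * u n z * u n c * u n d" for n z
  define S where "S z = (\<Sum>n. s n z)" for z
  define R0 where "R0 = \<bar>Im a\<bar> + \<bar>Im c\<bar> + \<bar>Im d\<bar>"
  have bd: "\<exists>M. summable M \<and> (\<forall>n z. \<bar>Im z\<bar> \<le> R \<longrightarrow> norm (s n z) \<le> M n)" for R
  proof -
    obtain M where M: "summable M" "\<And>n a' b c' d'. \<bar>Im a'\<bar> \<le> R0 + \<bar>R\<bar> \<Longrightarrow> \<bar>Im b\<bar> \<le> R0 + \<bar>R\<bar> \<Longrightarrow>
       \<bar>Im c'\<bar> \<le> R0 + \<bar>R\<bar> \<Longrightarrow> \<bar>Im d'\<bar> \<le> R0 + \<bar>R\<bar> \<Longrightarrow> norm (D n * u n a' * u n b * u n c' * u n d') \<le> M n"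
      using mathieu_term_bound[OF u D, of "R0 + \<bar>R\<bar>"] by (auto simp: R0_def)
    have "norm (s n z) \<le> M n" if "\<bar>Im z\<bar> \<le> R" for n z
      unfolding s_def by (rule M(2)) (use that in \<open>auto simp: R0_def\<close>)
    then show ?thesis using M(1) by blast
  qed
  have sm: "summable (\<lambda>n. s n z)" for z
  proof -
    obtain M where "summable M" "\<forall>n z'. \<bar>Im z'\<bar> \<le> \<bar>Im z\<bar> \<longrightarrow> norm (s n z') \<le> M n" using bd by blast
    then show ?thesis by (intro summable_comparison_test[of "\<lambda>n. s n z" M]) auto
  qed
  have hs: "s n holomorphic_on X" for n X
    unfolding s_def[abs_def] by (intro holomorphic_intros U)
  have hS: "S holomorphic_on UNIV"
  proof (rule holomorphic_uniform_sequence[where f = "\<lambda>N z. \<Sum>n<N. s n z"])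
    fix x :: complex
    obtain M where M: "summable M" "\<And>n z. \<bar>Im z\<bar> \<le> \<bar>Im x\<bar> + 1 \<Longrightarrow> norm (s n z) \<le> M n" using bd by blast
    have "uniform_limit (cball x 1) (\<lambda>N z. \<Sum>n<N. s n z) S sequentially"
      unfolding S_def
    proof (rule Weierstrass_m_test[OF _ M(1)])
      fix n z assume "z \<in> cball x 1"
      then have "\<bar>Im (z - x)\<bar> \<le> 1" using abs_Im_le_cmod[of "z - x"] by (simp add: dist_norm norm_minus_commute)
      then show "norm (s n z) \<le> M n" by (intro M(2)) auto
    qed
    then show "\<exists>d>0. cball x d \<subseteq> UNIV \<and> uniform_limit (cball x d) (\<lambda>N z. \<Sum>n<N. s n z) S sequentially"
      by (intro exI[of _ 1]) auto
  qed (auto intro!: holomorphic_intros hs)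
  define G where "G z = of_real pi * ((riem q a z c d + par ev * riem q a (- z) c d) / 2) - S z" for z
  have hr: "(\<lambda>z. riem q a (- z) c d) holomorphic_on X" for X
  proof -
    have "(\<lambda>z. riem q a (- z) c d) = (\<lambda>z. riem q (- a) z c d)" by (simp add: riem_par(2))
    then show ?thesis using riem_holomorphic(2) by simp
  qed
  have "G b = 0"
  proof (rule mathieu_eigfun_complete[OF u, where g = G])
    show "G holomorphic_on UNIV"
      unfolding G_def[abs_def] by (intro holomorphic_intros riem_holomorphic hr hS) auto
    have "s n (z + 2 * of_real pi) = s n z" "s n (- z) = par ev * s n z" for n z
      by (simp_all add: s_def U(2,3))
    then have S: "S (z + 2 * of_real pi) = S z" "S (- z) = par ev * S z" for z
      unfolding S_def using suminf_mult[OF sm[of z], of "par ev"] by simp_all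
    have "riem q a (- (z + 2 * of_real pi)) c d = riem q a (- z) c d" for z
      using riem_periodic(3)[of q a "- (z + 2 * of_real pi)" c d] by simp
    then show "G (z + 2 * of_real pi) = G z" for z
      unfolding G_def by (simp only: S riem_periodic)
    show "G (- z) = par ev * G z" for z
      unfolding G_def S minus_minus by (cases ev) (simp_all add: par_def field_simps)
    fix m
    have cm: "continuous_on X (\<lambda>t::real. u m (of_real t))" for X
      by (intro continuous_on_entire_compose[OF U(5)] continuous_intros)
    \<comment> \<open>Uniform convergence on the real line permits termwise integration, and
      orthogonality leaves the single term \<open>n = m\<close>.\<close>
    have 1: "((\<lambda>t. S (of_real t) * u m (of_real t)) has_integral of_real pi * (D m * u m a * u m c * u m d)) {0..2 * pi}"
    proof -
      obtain M where M: "summable M" "\<And>n z. \<bar>Im z\<bar> \<le> 0 \<Longrightarrow> norm (s n z) \<le> M n" using bd by blast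
      have "bounded ((\<lambda>t::real. u m (of_real t)) ` {0..2 * pi})"
        by (intro compact_imp_bounded compact_continuous_image cm) auto
      then obtain B where B: "\<And>t. t \<in> {0..2 * pi} \<Longrightarrow> norm (u m (of_real t)) \<le> B"
        unfolding bounded_iff by blast
      have "uniform_limit (cbox 0 (2 * pi)) (\<lambda>N t. \<Sum>n<N. s n (of_real t) * u m (of_real t)) (\<lambda>t. \<Sum>n. s n (of_real t) * u m (of_real t)) sequentially"
      proof (rule Weierstrass_m_test)
        show "summable (\<lambda>n. M n * B)" by (intro summable_mult2 M)
        show "norm (s n (of_real t) * u m (of_real t)) \<le> M n * B" if "t \<in> cbox 0 (2 * pi)" for n t
          using M(2)[of "of_real t" n] B[of t] that order_trans[OF norm_ge_zero M(2)[of "of_real t" n]]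
          by (auto simp: norm_mult intro!: mult_mono)
      qed
      moreover have "(\<lambda>t. \<Sum>n. s n (complex_of_real t) * u m (of_real t)) = (\<lambda>t. S (of_real t) * u m (of_real t))"
        unfolding S_def using suminf_mult2[OF sm] by auto
      ultimately have ul: "uniform_limit (cbox 0 (2 * pi)) (\<lambda>N t. \<Sum>n<N. s n (of_real t) * u m (of_real t)) (\<lambda>t. S (of_real t) * u m (of_real t)) sequentially"
        by simp
      have cs: "continuous_on (cbox 0 (2 * pi)) (\<lambda>t. \<Sum>n<N. s n (of_real t) * u m (of_real t))" for N
        by (intro continuous_intros continuous_on_entire_compose[OF hs] cm)
      obtain I J where I: "\<And>N. ((\<lambda>t. \<Sum>n<N. s n (of_real t) * u m (of_real t)) has_integral I N) (cbox 0 (2 * pi))"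
         and J: "((\<lambda>t. S (of_real t) * u m (of_real t)) has_integral J) (cbox 0 (2 * pi))" and lim: "I \<longlonglongrightarrow> J"
        using uniform_limit_integral_cbox[OF ul cs] by auto
      have "I N = (\<Sum>n<N. if n = m then of_real pi * (D m * u m a * u m c * u m d) else 0)" for N
      proof -
        have "((\<lambda>t. \<Sum>n<N. (D n * u n a * u n c * u n d) * (u n (of_real t) * u m (of_real t))) has_integral
           (\<Sum>n<N. (D n * u n a * u n c * u n d) * integral {0..2 * pi} (\<lambda>t. u n (of_real t) * u m (of_real t)))) {0..2 * pi}"
          by (intro has_integral_sum has_integral_mult_right integrable_integral integrable_continuous_interval
              continuous_on_mult continuous_on_entire_compose[OF U(5)] continuous_intros) auto
        moreover have "(\<lambda>t. \<Sum>n<N. (D n * u n a * u n c * u n d) * (u n (complex_of_real t) * u m (of_real t))) = (\<lambda>t. \<Sum>n<N. s n (of_real t) * u m (of_real t))"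
          by (simp add: s_def mult_ac)
        ultimately have "I N = (\<Sum>n<N. (D n * u n a * u n c * u n d) * integral {0..2 * pi} (\<lambda>t. u n (of_real t) * u m (of_real t)))"
          using I[of N] has_integral_unique by (auto simp: cbox_interval)
        also have "\<dots> = (\<Sum>n<N. if n = m then of_real pi * (D m * u m a * u m c * u m d) else 0)"
          by (intro sum.cong refl) (auto simp: U(7) mathieu_eigfun_orthogonal[OF u u])
        finally show ?thesis .
      qed
      then have "I N = of_real pi * (D m * u m a * u m c * u m d)" if "N > m" for N using that by simp
      then have "\<forall>\<^sub>F N in sequentially. of_real pi * (D m * u m a * u m c * u m d) = I N"
        unfolding eventually_sequentially by (metis Suc_le_eq)
      then have "I \<longlonglongrightarrow> of_real pi * (D m * u m a * u m c * u m d)"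
        using Lim_transform_eventually[OF tendsto_const] by blast
      then have "J = of_real pi * (D m * u m a * u m c * u m d)" using lim LIMSEQ_unique by blast
      then show ?thesis using J by simp
    qed
    have 2: "((\<lambda>t. riem q a (of_real t) c d * u m (of_real t)) has_integral D m * u m a * u m c * u m d) {0..2 * pi}"
      unfolding D[symmetric] riem_coeff_def
      by (intro integrable_integral integrable_continuous_interval continuous_on_mult riem_continuous cm continuous_intros)
    \<comment> \<open>Reflecting the second argument amounts to reflecting the first, where the
      coefficient is a multiple of \<open>u m\<close>; this produces the sign
      \<open>par ev\<close>.\<close>
    have 3: "((\<lambda>t. riem q a (- of_real t) c d * u m (of_real t)) has_integral par ev * (D m * u m a * u m c * u m d)) {0..2 * pi}"
    proof -
      have "((\<lambda>t. riem q (- a) (of_real t) c d * u m (of_real t)) has_integral D m * u m (- a) * u m c * u m d) {0..2 * pi}"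
        unfolding D[symmetric] riem_coeff_def
        by (intro integrable_integral integrable_continuous_interval continuous_on_mult riem_continuous cm continuous_intros)
      then show ?thesis by (simp add: riem_par(2) U(2) mult_ac)
    qed
    have "((\<lambda>t. of_real pi * ((1 / 2) * (riem q a (of_real t) c d * u m (of_real t)) +
         (par ev / 2) * (riem q a (- of_real t) c d * u m (of_real t))) - S (of_real t) * u m (of_real t)) has_integral
       of_real pi * ((1 / 2) * (D m * u m a * u m c * u m d) + (par ev / 2) * (par ev * (D m * u m a * u m c * u m d))) -
       of_real pi * (D m * u m a * u m c * u m d)) {0..2 * pi}"
      by (intro has_integral_diff has_integral_mult_right has_integral_add 1 2 3)
    moreover have "of_real pi * ((1 / 2) * (D m * u m a * u m c * u m d) + (par ev / 2) * (par ev * (D m * u m a * u m c * u m d))) -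
       of_real pi * (D m * u m a * u m c * u m d) = 0"
      by (simp add: par_def)
    moreover have "of_real pi * ((1 / 2) * (riem q a (of_real t) c d * u m (of_real t)) +
         (par ev / 2) * (riem q a (- of_real t) c d * u m (of_real t))) - S (of_real t) * u m (of_real t) = G (of_real t) * u m (of_real t)" for t :: real
      by (simp add: G_def algebra_simps add_divide_distrib)
    ultimately have "((\<lambda>t. G (of_real t) * u m (of_real t)) has_integral 0) {0..2 * pi}" by simp
    then show "integral {0..2 * pi} (\<lambda>t. G (of_real t) * u m (of_real t)) = 0" by (rule integral_unique)
  qed
  then have "S b = of_real pi * ((riem q a b c d + par ev * riem q a (- b) c d) / 2)"
    unfolding G_def by (simp only: right_minus_eq)
  then show ?thesis using summable_sums[OF sm[of b]] unfolding S_def s_def by (simp only:)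
qed

text \<open>Summability is asserted along with the value, since an equation about
  \<open>suminf\<close> alone does not express convergence.\<close>

theorem theorem4p2:
  fixes \<xi> \<eta> \<xi>\<^sub>0 \<eta>\<^sub>0 r :: complex and k c q :: real
  assumes "k > 0" and "c > 0" and "q = 1 / 4 * c\<^sup>2 * k\<^sup>2"
    and "r\<^sup>2 = (of_real c)\<^sup>2 *
      ((cosh \<xi> * cos \<eta> - cosh \<xi>\<^sub>0 * cos \<eta>\<^sub>0)\<^sup>2 + (sinh \<xi> * sin \<eta> - sinh \<xi>\<^sub>0 * sin \<eta>\<^sub>0)\<^sup>2)"
  shows "summable (\<lambda>n. mathieu_mu n q * mathieu_ce n (\<i> * \<xi>) q * mathieu_ce n \<eta> q *
            mathieu_ce n (\<i> * \<xi>\<^sub>0) q * mathieu_ce n \<eta>\<^sub>0 q) \<and>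
         summable (\<lambda>n. mathieu_nu (Suc n) q * mathieu_se (Suc n) (\<i> * \<xi>) q *
            mathieu_se (Suc n) \<eta> q * mathieu_se (Suc n) (\<i> * \<xi>\<^sub>0) q * mathieu_se (Suc n) \<eta>\<^sub>0 q) \<and>
         bessel_J0 (of_real k * r) =
           1 / of_real pi * (\<Sum>n. mathieu_mu n q * mathieu_ce n (\<i> * \<xi>) q * mathieu_ce n \<eta> q *
             mathieu_ce n (\<i> * \<xi>\<^sub>0) q * mathieu_ce n \<eta>\<^sub>0 q) +
           1 / of_real pi * (\<Sum>n. mathieu_nu (Suc n) q * mathieu_se (Suc n) (\<i> * \<xi>) q *
             mathieu_se (Suc n) \<eta> q * mathieu_se (Suc n) (\<i> * \<xi>\<^sub>0) q * mathieu_se (Suc n) \<eta>\<^sub>0 q)"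
proof -
  have ce: "riem_coeff q (\<lambda>z. mathieu_ce n z q) a c d = mathieu_mu n q * mathieu_ce n a q * mathieu_ce n c q * mathieu_ce n d q" for n a c d
  proof -
    obtain D where D: "\<And>a c d. riem_coeff q (\<lambda>z. mathieu_ce n z q) a c d = D * mathieu_ce n a q * mathieu_ce n c q * mathieu_ce n d q"
      using riem_coeff_factor[OF mathieu_eigfun_ce] by blast
    have "mathieu_mu n q = D"
      unfolding mathieu_mu_def mathieu_a_def eigenvalues_eq mathieu_eig_def[symmetric]
      by (rule connection_coefficient_eq[OF mathieu_eigfun_ce D]) (simp add: par_def)
    then show ?thesis by (simp add: D)
  qed
  \<comment> \<open>The eigenvalues of the odd family are counted from \<open>0\<close> and
    \<open>se\<close> from \<open>1\<close>; the parity sign makes up for the shift, because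
    \<open>(- 1) ^ Suc n\<close> is the negative of \<open>(- 1) ^ n\<close>.\<close>
  have se: "riem_coeff q (\<lambda>z. mathieu_se (Suc n) z q) a c d = mathieu_nu (Suc n) q * mathieu_se (Suc n) a q * mathieu_se (Suc n) c q * mathieu_se (Suc n) d q" for n a c d
  proof -
    obtain D where D: "\<And>a c d. riem_coeff q (\<lambda>z. mathieu_se (Suc n) z q) a c d = D * mathieu_se (Suc n) a q * mathieu_se (Suc n) c q * mathieu_se (Suc n) d q"
      using riem_coeff_factor[OF mathieu_eigfun_se] by blast
    have "mathieu_nu (Suc n) q = D"
      unfolding mathieu_nu_def mathieu_b_def eigenvalues_eq mathieu_eig_def[symmetric] diff_Suc_1
      by (rule connection_coefficient_eq[OF mathieu_eigfun_se D]) (simp add: par_def)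
    then show ?thesis by (simp add: D)
  qed
  note 1 = riem_half_expansion[OF mathieu_eigfun_ce ce, of "\<i> * \<xi>" \<eta> "\<i> * \<xi>\<^sub>0" \<eta>\<^sub>0]
  note 2 = riem_half_expansion[OF mathieu_eigfun_se se, of "\<i> * \<xi>" \<eta> "\<i> * \<xi>\<^sub>0" \<eta>\<^sub>0]
  have "(of_real k * r)\<^sup>2 = 4 * of_real q * dist_sq (\<i> * \<xi>) \<eta> (\<i> * \<xi>\<^sub>0) \<eta>\<^sub>0"
  proof -
    have "(cosh \<xi> * cos \<eta> - cosh \<xi>\<^sub>0 * cos \<eta>\<^sub>0)\<^sup>2 + (sinh \<xi> * sin \<eta> - sinh \<xi>\<^sub>0 * sin \<eta>\<^sub>0)\<^sup>2 = dist_sq (\<i> * \<xi>) \<eta> (\<i> * \<xi>\<^sub>0) \<eta>\<^sub>0"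
    proof -
      have "(sin (\<i> * \<xi>))\<^sup>2 = 1 - (cos (\<i> * \<xi>))\<^sup>2" "(sin (\<i> * \<xi>\<^sub>0))\<^sup>2 = 1 - (cos (\<i> * \<xi>\<^sub>0))\<^sup>2"
        "(sin \<eta>)\<^sup>2 = 1 - (cos \<eta>)\<^sup>2" "(sin \<eta>\<^sub>0)\<^sup>2 = 1 - (cos \<eta>\<^sub>0)\<^sup>2" "\<i>\<^sup>2 = - 1"
        by (rule sin_squared_eq power2_i)+
      \<comment> \<open>In terms of sines at imaginary arguments each \<open>sinh\<close> carries a
        factor \<open>- \<i>\<close>; the product of two such factors turns the sign of the mixed
        sine term into \<open>+\<close>.\<close>
      then show ?thesis unfolding dist_sq_def cosh_conv_cos sinh_conv_sin by algebra
    qed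
    then show ?thesis unfolding power_mult_distrib assms(3,4) by (simp add: power_mult_distrib)
  qed
  then have "bessel_J0 (of_real k * r) = riem q (\<i> * \<xi>) \<eta> (\<i> * \<xi>\<^sub>0) \<eta>\<^sub>0"
    by (simp add: bessel_J0_eq riem_def)
  \<comment> \<open>The even and odd parts in \<eta> supplied by the two families add up to the
    whole Riemann function.\<close>
  then show ?thesis
    using sums_summable[OF 1] sums_summable[OF 2] unfolding sums_unique[OF 1, symmetric] sums_unique[OF 2, symmetric]
    by (simp add: par_def field_simps)
qed

end
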